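(* Let $n\ge2$, $s\in(0,1]$, and let $u:(0,\infty)\to\mathbb{R}$ be upper semicontinuous, regarded as the radial function $x\mapsto u(|x|)$ on $\mathbb{R}^n\setminus\{0\}$, such that $$\int_0^{+\infty}\frac{|u(r)|}{(1+r)^{n+2s}}\,r^{n-1}\,dr<+\infty .$$ If for all $r>0$ and all $\tau\ge1$ $$u(r)-u(r\tau)+\big(u(r)-u(\tfrac{r}{\tau})\big)\tau^{-n+2s}\le 0,$$ then $u$ is $s$-subharmonic in $\mathbb{R}^n\setminus\{0\}$.
   Context: For $s\in(0,1)$ and $u$ locally integrable with $\int_{\mathbb{R}^n}\frac{|u(x)|}{(1+|x|^2)^{(n+2s)/2}}dx<\infty$, the fractional Laplacian is $(-\Delta)^s u(x)=c_{s,n}\int_{\mathbb{R}^n}\frac{u(x)-u(y)}{|x-y|^{n+2s}}dy$ with $c_{s,n}>0$, understood in the distributional sense $\langle(-\Delta)^s u,h\rangle=\int u\,(-\Delta)^s h\,dx$, $h\in C_0^\infty$; for $s=1$, $(-\Delta)^1=-\Delta$. A function $u$ satisfying this integrability condition is called $s$-subharmonic in a domain $\Omega$ if $u:\Omega\to[-\infty,\infty)$ is upper semicontinuous in $\Omega$ and $-(-\Delta)^s u\ge0$ in $\mathcal{D}'(\Omega)$, i.e. $-(-\Delta)^su$ is a positive Borel measure in $\Omega$. *)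

theory Defs
  imports "HOL-Analysis.Analysis"
begin

definition usc_on :: "'a::topological_space set \<Rightarrow> ('a \<Rightarrow> real) \<Rightarrow> bool" where
  "usc_on S f \<longleftrightarrow> (\<forall>x\<in>S. \<forall>a. f x < a \<longrightarrow> (\<forall>\<^sub>F y in at x within S. f y < a))"

definition partial_dir :: "'n::finite \<Rightarrow> (real^'n \<Rightarrow> real) \<Rightarrow> real^'n \<Rightarrow> real" where
  "partial_dir i f x = deriv (\<lambda>t. f (x + t *\<^sub>R axis i 1)) 0"

primrec iter_partial :: "'n::finite list \<Rightarrow> (real^'n \<Rightarrow> real) \<Rightarrow> real^'n \<Rightarrow> real" where
  "iter_partial [] f = f"
| "iter_partial (i # is) f = partial_dir i (iter_partial is f)"

definition smooth_fn :: "(real^'n::finite \<Rightarrow> real) \<Rightarrow> bool" where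
  "smooth_fn f \<longleftrightarrow> (\<forall>is. continuous_on UNIV (iter_partial is f) \<and>
      (\<forall>i x. (\<lambda>t. iter_partial is f (x + t *\<^sub>R axis i 1)) differentiable (at 0)))"

definition test_fn :: "(real^'n::finite) set \<Rightarrow> (real^'n \<Rightarrow> real) \<Rightarrow> bool" where
  "test_fn \<Omega> h \<longleftrightarrow> smooth_fn h \<and> compact (closure {x. h x \<noteq> 0}) \<and> closure {x. h x \<noteq> 0} \<subseteq> \<Omega>"

definition laplacian :: "(real^'n::finite \<Rightarrow> real) \<Rightarrow> real^'n \<Rightarrow> real" where
  "laplacian h x = (\<Sum>i\<in>UNIV. iter_partial [i, i] h x)"

definition frac_const :: "real \<Rightarrow> nat \<Rightarrow> real" where
  "frac_const s n = s * 4 powr s * Gamma (real n / 2 + s) / (pi powr (real n / 2) * Gamma (1 - s))"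

definition frac_lap :: "real \<Rightarrow> (real^'n::finite \<Rightarrow> real) \<Rightarrow> real^'n \<Rightarrow> real" where
  "frac_lap s h x =
     (if s = 1 then - laplacian h x
      else frac_const s CARD('n) *
        Lim (at_right 0) (\<lambda>\<epsilon>. LINT y|lborel.
           indicator {y. dist x y > \<epsilon>} y * ((h x - h y) / dist x y powr (real CARD('n) + 2 * s))))"

definition s_subharmonic :: "real \<Rightarrow> (real^'n::finite) set \<Rightarrow> (real^'n \<Rightarrow> real) \<Rightarrow> bool" where
  "s_subharmonic s \<Omega> v \<longleftrightarrow>
     (\<forall>K. compact K \<longrightarrow> set_integrable lborel K v) \<and>
     integrable lborel (\<lambda>x. \<bar>v x\<bar> / (1 + (norm x)\<^sup>2) powr ((real CARD('n) + 2 * s) / 2)) \<and>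
     usc_on \<Omega> v \<and>
     (\<forall>h. test_fn \<Omega> h \<and> (\<forall>x. 0 \<le> h x) \<longrightarrow> (LINT x|lborel. v x * frac_lap s h x) \<le> 0)"

end

theory Submission
  imports Defs
begin

text \<open>
  Let \<^term>\<open>p = n + 2 * s\<close> and \<^term>\<open>v x = u (norm x)\<close>. Truncate the kernel \<open>|x - y|^(-p)\<close> to the set
  where \<open>|x - y|^2 > \<epsilon>^2 |x| |y|\<close>. This set is symmetric in x and y, and it is invariant under the
  inversion of y in the sphere through x. Inversion therefore folds the integral of
  \<open>v x - v y\<close> against the truncated kernel onto \<open>|y| > |x|\<close>, where, with \<open>\<tau> = |y| / |x|\<close>, the
  integrand becomes the kernel times the left-hand side of the hypothesis; so that integral is
  nonpositive. By symmetry the pairing of v with the truncated operator applied to a test function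
  \<open>h \<ge> 0\<close> is nonpositive as well. Near x the truncation differs from the removal of the ball of
  radius \<open>\<epsilon> |x|\<close> only in a shell of relative width \<open>\<epsilon>\<close>, which costs \<open>O(\<epsilon>^(2 - 2 s))\<close> since h is
  Lipschitz. If \<open>s < 1\<close> this tends to 0 and the truncated operators converge to the fractional
  Laplacian. If \<open>s = 1\<close> they diverge like \<open>ln (1/\<epsilon>)\<close> times a negative multiple of the Laplacian of h,
  up to a bounded error, and dividing by \<open>ln (1/\<epsilon>)\<close> gives the claim.
\<close>

section \<open>Polar coordinates and inversion\<close>

text \<open>As \<open>u\<close> is only upper semicontinuous, differences of its values give no
  cancellation at the diagonal, so no singular integral of \<open>u\<close> itself can be formed.
  The truncation has to serve two purposes at once: removing a ball of fixed radius around x is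
  symmetric but not stable under inversion, and a radius depending on x alone breaks the symmetry.
  The image y' of y satisfies |x - y'| = |x - y| |x| / |y| and |y'| = |x|^2 / |y|, so the quotient
  |x - y|^2 / (|x| |y|) does not change; thresholding it is the remedy. The kernel gains \<tau>^(n +
  2 s) and the Jacobian is \<tau>^(-2 n); their product is the power in the hypothesis. The second
  constraint is that \<open>u\<close> is integrable only against (1 + |x|)^(-n - 2 s), so every
  error must carry this decay in x. The points x are therefore split into an annulus around the
  support of h, where constants suffice, and the rest, where x keeps a distance from the support and
  the singularity of the kernel is not met.\<close>

lemma nn_integral_cong_AE_imp:
  assumes "AE x in M. P x" "\<And>x. P x \<Longrightarrow> f x = g x"
  shows "(\<integral>\<^sup>+x. f x \<partial>M) = (\<integral>\<^sup>+x. g x \<partial>M)"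
  using assms by (intro nn_integral_cong_AE) auto

text \<open>Half-lines form an intersection-stable generator of the Borel sets, and finiteness on
  them supplies the exhausting sequence. Radial measures are identified below through their
  distribution functions.\<close>

lemma measure_eq_atMost:
  fixes M N :: "real measure"
  assumes "sets M = sets borel" "sets N = sets borel"
    and "\<And>a. emeasure M {..a} = emeasure N {..a}" "\<And>a. emeasure M {..a} \<noteq> \<infinity>"
  shows "M = N"
proof (rule measure_eqI_generator_eq[where E = "range atMost" and \<Omega> = UNIV and A = "\<lambda>k. {..real k}"])
  show "Int_stable (range (atMost :: real \<Rightarrow> _))"
    by (auto simp: Int_stable_def)
  show "sets M = sigma_sets UNIV (range atMost)" "sets N = sigma_sets UNIV (range atMost)"
    using assms(1,2) by (simp_all add: borel_eq_atMost)
  show "(\<Union>i. {..real i}) = UNIV"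
    using real_arch_simple by auto
qed (use assms in auto)

text \<open>Normalised so that the mass up to a radius \<open>a\<close> is \<open>a ^ d\<close>; the
  volume of the unit ball is then carried by \<open>cone_measure\<close>.\<close>

definition radial_density :: "nat \<Rightarrow> real \<Rightarrow> ennreal" where
  "radial_density d r = ennreal (real d * r ^ (d - 1)) * indicator {0<..} r"

lemma radial_density_measurable [measurable]: "radial_density d \<in> borel_measurable borel"
  unfolding radial_density_def by measurable

lemma emeasure_radial_density:
  assumes "d > 0"
  shows "emeasure (density lborel (radial_density d)) {..a} = ennreal ((max 0 a) ^ d)"
proof -
  have "emeasure (density lborel (radial_density d)) {..a} =
     (\<integral>\<^sup>+r. radial_density d r * indicator {..a} r \<partial>lborel)"
    by (simp add: emeasure_density)
  also have "\<dots> = (\<integral>\<^sup>+r. ennreal (real d * r ^ (d - 1)) * indicator {0..max 0 a} r \<partial>lborel)"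
  proof (rule nn_integral_cong_AE_imp[OF AE_lborel_singleton[of 0]])
    fix r :: real assume "r \<noteq> 0"
    then show "radial_density d r * indicator {..a} r
        = ennreal (real d * r ^ (d - 1)) * indicator {0..max 0 a} r"
      by (cases "r > 0"; cases "r \<le> a") (simp_all add: radial_density_def)
  qed
  also have "\<dots> = ennreal ((max 0 a) ^ d - 0 ^ d)"
    by (intro nn_integral_FTC_Icc) (auto intro!: derivative_eq_intros)
  finally show ?thesis using assms by (simp add: power_0_left)
qed

lemma indicator_measurable_borel [measurable]:
  "indicator (cball 0 1 - {0}) \<in> borel_measurable (borel :: 'a::euclidean_space measure)"
  "indicator (- {0}) \<in> borel_measurable (borel :: 'a::euclidean_space measure)"
  "indicator (ball 0 R) \<in> borel_measurable (borel :: 'a::euclidean_space measure)"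
  "indicator (- cball 0 R) \<in> borel_measurable (borel :: 'a::euclidean_space measure)"
  by (rule borel_measurable_indicator; simp)+

text \<open>The surface measure of the unit sphere divided by the dimension.\<close>
definition cone_measure :: "'a::euclidean_space measure" where
  "cone_measure = distr (density lborel (indicator (cball 0 1 - {0}))) borel sgn"

lemma measurable_sgn_euclidean [measurable]:
  "sgn \<in> borel_measurable (borel :: 'a::euclidean_space measure)"
  unfolding sgn_div_norm[abs_def] by measurable

lemma sets_cone_measure [measurable_cong, simp]: "sets cone_measure = sets borel"
  by (simp add: cone_measure_def)

lemma emeasure_cone_measure:
  assumes [measurable]: "B \<in> sets borel"
  shows "emeasure (cone_measure :: 'a::euclidean_space measure) B
    = emeasure lborel {y. y \<noteq> 0 \<and> norm y \<le> 1 \<and> sgn y \<in> B}"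
proof -
  have [measurable]: "{y::'a. sgn y \<in> B} \<in> sets borel" by measurable
  have "emeasure (cone_measure :: 'a measure) B
      = (\<integral>\<^sup>+y. indicator (cball 0 1 - {0}) y * indicator {y. sgn y \<in> B} y \<partial>lborel)"
    by (simp add: cone_measure_def emeasure_distr vimage_def) (simp add: emeasure_density)
  also have "\<dots> = (\<integral>\<^sup>+y. indicator {y. y \<noteq> 0 \<and> norm y \<le> 1 \<and> sgn y \<in> B} y \<partial>lborel)"
    by (intro nn_integral_cong) (auto simp: indicator_def)
  finally show ?thesis by simp
qed

lemma finite_cone_measure: "finite_measure (cone_measure :: 'a::euclidean_space measure)"
proof
  have "emeasure (cone_measure :: 'a measure) UNIV \<le> emeasure lborel (cball (0::'a) 1)"
    by (subst emeasure_cone_measure) (auto intro!: emeasure_mono)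
  also have "\<dots> < \<infinity>"
    by (simp add: emeasure_cball)
  finally show "emeasure (cone_measure :: 'a measure) (space cone_measure) \<noteq> \<infinity>"
    by (simp add: cone_measure_def)
qed

lemma emeasure_cone_UNIV:
  "emeasure (cone_measure :: 'a::euclidean_space measure) UNIV = ennreal (unit_ball_vol (DIM('a)))"
proof -
  have "emeasure (cone_measure :: 'a measure) UNIV = emeasure lborel (cball (0::'a) 1 - {0})"
    by (subst emeasure_cone_measure) (auto intro!: arg_cong[where f="emeasure lborel"])
  also have "\<dots> = emeasure lborel (cball (0::'a) 1)"
    by (subst emeasure_Diff) auto
  finally show ?thesis by (simp add: emeasure_cball)
qed

text \<open>A dilation by \<open>a\<close> preserves directions and multiplies Lebesgue measure by
  \<open>a ^ DIM('a)\<close>.\<close>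

lemma emeasure_cone_scale:
  assumes [measurable]: "B \<in> sets borel" and a: "a > 0"
  shows "emeasure lborel {y::'a::euclidean_space. y \<noteq> 0 \<and> norm y \<le> a \<and> sgn y \<in> B}
     = ennreal (a ^ DIM('a)) * emeasure (cone_measure :: 'a measure) B"
proof -
  let ?S = "{y::'a. y \<noteq> 0 \<and> norm y \<le> a \<and> sgn y \<in> B}"
  have [measurable]: "?S \<in> sets borel" by measurable
  have "emeasure lborel ?S
      = emeasure (density (distr lborel borel (\<lambda>x::'a. 0 + a *\<^sub>R x)) (\<lambda>_. \<bar>a\<bar>^DIM('a))) ?S"
    using lborel_affine[of a "0::'a"] a by simp
  also have "\<dots> = ennreal (a ^ DIM('a)) * emeasure lborel {x. a *\<^sub>R x \<in> ?S}"
    using a by (simp add: emeasure_density nn_integral_cmult emeasure_distr vimage_def)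
  also have "{x. a *\<^sub>R x \<in> ?S} = {y. y \<noteq> 0 \<and> norm y \<le> 1 \<and> sgn y \<in> B}"
    using a by (auto simp: sgn_scaleR)
  finally show ?thesis by (simp add: emeasure_cone_measure)
qed

text \<open>A product of sigma-finite measures is determined by its values on rectangles
  \<open>A \<times> B\<close>. With \<open>B\<close> fixed, both sides are measures in
  \<open>A\<close>, and on half-lines they agree by the homogeneity in
  \<open>emeasure_cone_scale\<close>.\<close>

lemma polar_measure:
  "density lborel (radial_density (DIM('a))) \<Otimes>\<^sub>M (cone_measure :: 'a::euclidean_space measure)
   = distr (density lborel (indicator (- {0}))) (borel \<Otimes>\<^sub>M borel) (\<lambda>y::'a. (norm y, sgn y))"
proof (rule pair_measure_eqI)
  interpret finite_measure "cone_measure :: 'a measure" by (rule finite_cone_measure)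
  show "sigma_finite_measure (cone_measure :: 'a measure)" ..
  show "sigma_finite_measure (density lborel (radial_density (DIM('a))))"
    by (rule sigma_finite_measure.sigma_finite_iff_density_finite'[THEN iffD2, rotated 2])
       (auto simp: radial_density_def indicator_def sigma_finite_lborel)
  show "sets (density lborel (radial_density (DIM('a))) \<Otimes>\<^sub>M (cone_measure :: 'a measure))
    = sets (distr (density lborel (indicator (- {0}))) (borel \<Otimes>\<^sub>M borel) (\<lambda>y::'a. (norm y, sgn y)))"
    by (simp cong: sets_pair_measure_cong)
next
  fix A and B :: "'a set" assume AB: "A \<in> sets (density lborel (radial_density (DIM('a))))" "B \<in> sets cone_measure"
  then have [measurable]: "A \<in> sets borel" "B \<in> sets borel" by auto
  interpret finite_measure "cone_measure :: 'a measure" by (rule finite_cone_measure)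
  let ?C = "{y::'a. y \<noteq> 0 \<and> sgn y \<in> B}"
  have [measurable]: "?C \<in> sets borel" by measurable
  let ?M = "density lborel (\<lambda>r. emeasure (cone_measure::'a measure) B * radial_density (DIM('a)) r)"
  let ?N = "distr (density lborel (indicator ?C)) borel norm"
  have M: "emeasure ?M X = emeasure (density lborel (radial_density (DIM('a)))) X * emeasure cone_measure B"
    if [measurable]: "X \<in> sets borel" for X
  proof -
    have "emeasure ?M X = (\<integral>\<^sup>+r. emeasure (cone_measure::'a measure) B * (radial_density (DIM('a)) r * indicator X r) \<partial>lborel)"
      by (simp add: emeasure_density mult.assoc)
    then show ?thesis by (simp add: emeasure_density nn_integral_cmult mult.commute)
  qed
  have N: "emeasure ?N X = emeasure lborel {y. y \<noteq> 0 \<and> norm y \<in> X \<and> sgn y \<in> B}"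
    if [measurable]: "X \<in> sets borel" for X
  proof -
    have [measurable]: "{y::'a. norm y \<in> X} \<in> sets borel" by measurable
    have "emeasure ?N X = (\<integral>\<^sup>+y. indicator ?C y * indicator {y. norm y \<in> X} y \<partial>lborel)"
      by (simp add: emeasure_distr emeasure_density vimage_def)
    also have "\<dots> = (\<integral>\<^sup>+y. indicator {y. y \<noteq> 0 \<and> norm y \<in> X \<and> sgn y \<in> B} y \<partial>lborel)"
      by (intro nn_integral_cong) (auto simp: indicator_def)
    finally show ?thesis by simp
  qed
  have "?M = ?N"
  proof (rule measure_eq_atMost)
    fix a :: real
    have "emeasure ?M {..a} = ennreal ((max 0 a) ^ DIM('a)) * emeasure (cone_measure::'a measure) B"
      by (subst M) (simp_all add: emeasure_radial_density)
    also have "\<dots> = emeasure ?N {..a}"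
    proof (cases "a > 0")
      case True
      then show ?thesis by (subst N) (simp_all add: emeasure_cone_scale max_def)
    next
      case False
      then have "{y::'a. y \<noteq> 0 \<and> norm y \<in> {..a} \<and> sgn y \<in> B} = {}"
        by auto (meson norm_le_zero_iff not_less order_trans)
      moreover have "emeasure ?N {..a} = emeasure lborel {y. y \<noteq> 0 \<and> norm y \<in> {..a} \<and> sgn y \<in> B}"
        by (rule N) simp
      moreover have "(max 0 a) ^ DIM('a) = 0"
        using False by (simp add: max_def)
      ultimately show ?thesis by (simp only: emeasure_empty) simp
    qed
    finally show "emeasure ?M {..a} = emeasure ?N {..a}" .
    show "emeasure ?M {..a} \<noteq> \<infinity>"
      by (subst M) (simp_all add: emeasure_radial_density ennreal_mult_eq_top_iff)
  qed auto
  then have "emeasure ?M A = emeasure ?N A" by simp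
  also have "\<dots> = emeasure (distr (density lborel (indicator (- {0}))) (borel \<Otimes>\<^sub>M borel) (\<lambda>y::'a. (norm y, sgn y))) (A \<times> B)"
  proof -
    have [measurable]: "{y::'a. norm y \<in> A \<and> sgn y \<in> B} \<in> sets borel" by measurable
    have "emeasure (distr (density lborel (indicator (- {0}))) (borel \<Otimes>\<^sub>M borel) (\<lambda>y::'a. (norm y, sgn y))) (A \<times> B)
       = (\<integral>\<^sup>+y. indicator (- {0}) y * indicator {y::'a. norm y \<in> A \<and> sgn y \<in> B} y \<partial>lborel)"
      by (simp add: emeasure_distr emeasure_density vimage_def)
    also have "\<dots> = (\<integral>\<^sup>+y. indicator {y. y \<noteq> 0 \<and> norm y \<in> A \<and> sgn y \<in> B} y \<partial>lborel)"
      by (intro nn_integral_cong) (auto simp: indicator_def)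
    finally show ?thesis by (simp add: N)
  qed
  finally show "emeasure (density lborel (radial_density (DIM('a)))) A * emeasure cone_measure B
     = emeasure (distr (density lborel (indicator (- {0}))) (borel \<Otimes>\<^sub>M borel) (\<lambda>y::'a. (norm y, sgn y))) (A \<times> B)"
    by (simp add: M)
qed

lemma nn_integral_polar:
  fixes f :: "'a::euclidean_space \<Rightarrow> ennreal"
  assumes [measurable]: "f \<in> borel_measurable borel"
  shows "(\<integral>\<^sup>+y. f y \<partial>lborel)
     = (\<integral>\<^sup>+r. radial_density (DIM('a)) r * (\<integral>\<^sup>+\<theta>. f (r *\<^sub>R \<theta>) \<partial>cone_measure) \<partial>lborel)"
proof -
  interpret finite_measure "cone_measure :: 'a measure" by (rule finite_cone_measure)
  have "(\<integral>\<^sup>+y. f y \<partial>lborel) = (\<integral>\<^sup>+y. f (norm y *\<^sub>R sgn y) \<partial>density lborel (indicator (- {0})))"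
    by (subst nn_integral_density, simp, simp)
       (rule nn_integral_cong_AE_imp[OF AE_lborel_singleton[of 0]], auto simp: sgn_div_norm)
  also have "\<dots> = (\<integral>\<^sup>+z. f (fst z *\<^sub>R snd z) \<partial>(density lborel (radial_density (DIM('a))) \<Otimes>\<^sub>M (cone_measure :: 'a measure)))"
    unfolding polar_measure by (subst nn_integral_distr) simp_all
  also have "\<dots> = (\<integral>\<^sup>+r. (\<integral>\<^sup>+\<theta>. f (r *\<^sub>R \<theta>) \<partial>cone_measure) \<partial>density lborel (radial_density (DIM('a))))"
    by (subst nn_integral_fst[symmetric]) simp_all
  also have "\<dots> = (\<integral>\<^sup>+r. radial_density (DIM('a)) r * (\<integral>\<^sup>+\<theta>. f (r *\<^sub>R \<theta>) \<partial>cone_measure) \<partial>lborel)"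
    by (subst nn_integral_density) simp_all
  finally show ?thesis .
qed

lemma AE_cone_measure_norm: "AE \<theta> in (cone_measure :: 'a::euclidean_space measure). norm \<theta> = 1"
proof -
  have "AE y in density lborel (indicator (cball 0 1 - {0})). norm (sgn (y::'a)) = 1"
    by (subst AE_density) (auto simp: norm_sgn)
  then show ?thesis unfolding cone_measure_def by (subst AE_distr_iff) auto
qed

section \<open>Inversion in a sphere centred at the origin\<close>

text \<open>Substituting t = R^2 / r turns d t^(d - 1) dt into d r^(d - 1) (R / r)^(2 d) dr. Instead
  of a substitution rule, the proof compares the masses of half-lines.\<close>

lemma inversion_radial_measure:
  assumes R: "R > 0" and d: "d > 0"
  shows "distr (density lborel (\<lambda>r. radial_density d r * (ennreal ((R / r) ^ (2 * d)) * indicator {R<..} r))) borel (\<lambda>r. R\<^sup>2 / r)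
       = density lborel (\<lambda>r. radial_density d r * indicator {..<R} r)" (is "?M = ?N")
proof (rule measure_eq_atMost)
  fix a :: real
  let ?f = "\<lambda>r. radial_density d r * (ennreal ((R / r) ^ (2 * d)) * indicator {R<..} r)"
  let ?b = "max 0 (min a R)"
  have N: "emeasure ?N {..a} = ennreal (?b ^ d)"
  proof -
    have "emeasure ?N {..a} = (\<integral>\<^sup>+r. radial_density d r * indicator {..min a R} r \<partial>lborel)"
      by (subst emeasure_density, simp, simp)
         (rule nn_integral_cong_AE_imp[OF AE_lborel_singleton[of R]], auto simp: indicator_def)
    also have "\<dots> = emeasure (density lborel (radial_density d)) {..min a R}"
      by (simp add: emeasure_density)
    finally show ?thesis by (simp add: emeasure_radial_density d)
  qed
  have M: "emeasure ?M {..a} = (\<integral>\<^sup>+r. ?f r * indicator {r. R\<^sup>2 / r \<le> a} r \<partial>lborel)"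
    by (simp add: emeasure_distr emeasure_density vimage_def)
  show "emeasure ?M {..a} = emeasure ?N {..a}"
  proof (cases "a > 0")
    case False
    have "?f r * indicator {r. R\<^sup>2 / r \<le> a} r = 0" for r
    proof (cases "r > R")
      case True
      then have "R\<^sup>2 / r > 0" using R by simp
      then show ?thesis using False by (simp add: indicator_def)
    qed simp
    then have "emeasure ?M {..a} = 0" unfolding M by (simp only: nn_integral_0_iff_AE nn_integral_const mult_zero_left)
    then show ?thesis using False R d unfolding N by (simp add: max_def min_def)
  next
    case a: True
    \<comment> \<open>The image measure lives below \<open>R\<close>, so the half-line up to
      \<open>a\<close> is cut off there. Up to the point \<open>R\<close>, its preimage is the
      half-line from R^2 / b on, whose mass comes from an explicit primitive.\<close>
    define b where "b = min a R"
    have b: "b > 0" "b \<le> R" using a R by (auto simp: b_def)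
    have iff: "R\<^sup>2 / r \<le> a \<longleftrightarrow> R\<^sup>2 / b \<le> r" if "r > R" for r
    proof -
      have "R\<^sup>2 / r \<le> a \<longleftrightarrow> R\<^sup>2 / a \<le> r" using that a R by (simp add: field_simps)
      moreover have "R\<^sup>2 / R \<le> r" using that R by (simp add: power2_eq_square)
      moreover have "a \<ge> R \<Longrightarrow> R\<^sup>2 / a \<le> r"
        using that a R by (simp add: field_simps power2_eq_square) (meson less_imp_le mult_mono order_trans)
      ultimately show ?thesis by (auto simp: b_def min_def)
    qed
    have le: "R \<le> R\<^sup>2 / b" using b R by (simp add: field_simps power2_eq_square)
    let ?g = "\<lambda>r::real. real d * R ^ (2 * d) / r ^ (Suc d)"
    let ?F = "\<lambda>r::real. - (R ^ (2 * d) / r ^ d)"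
    have "emeasure ?M {..a} = (\<integral>\<^sup>+r. ennreal (?g r) * indicator {R\<^sup>2 / b..} r \<partial>lborel)"
      unfolding M
    proof (rule nn_integral_cong_AE_imp[OF AE_lborel_singleton[of R]])
      fix r assume r: "r \<noteq> R"
      show "?f r * indicator {r. R\<^sup>2 / r \<le> a} r = ennreal (?g r) * indicator {R\<^sup>2 / b..} r"
      proof (cases "r > R")
        case True
        then have "r > 0" using R by simp
        have "real d * r ^ (d - 1) * (R / r) ^ (2 * d) = ?g r"
          using \<open>r > 0\<close> d by (cases d) (simp_all add: field_simps power_mult power2_eq_square power_mult_distrib)
        then show ?thesis using True \<open>r > 0\<close> iff[OF True] d R
          by (auto simp: indicator_def radial_density_def ennreal_mult[symmetric])
      next
        case False
        then show ?thesis using r le by (auto simp: indicator_def)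
      qed
    qed
    also have "\<dots> = ennreal (0 - ?F (R\<^sup>2 / b))"
    proof (rule nn_integral_FTC_atLeast)
      fix r assume "R\<^sup>2 / b \<le> r"
      then have r: "r > 0" using le R by linarith
      have pr: "r ^ d = r * r ^ (d - 1)" using d by (cases d) auto
      show "(?F has_real_derivative ?g r) (at r)" using r
        by (auto intro!: derivative_eq_intros simp: pr field_simps)
      show "0 \<le> ?g r" using r by simp
    next
      have "((\<lambda>r::real. inverse (r ^ d)) \<longlongrightarrow> 0) at_top"
        by (intro tendsto_inverse_0_at_top filterlim_pow_at_top d filterlim_ident)
      then have "((\<lambda>r. - (R ^ (2 * d) * inverse (r ^ d))) \<longlongrightarrow> - (R ^ (2 * d) * 0)) at_top"
        by (intro tendsto_intros)
      then show "(?F \<longlongrightarrow> 0) at_top" by (simp add: field_simps)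
    qed simp
    also have "0 - ?F (R\<^sup>2 / b) = b ^ d"
      using R b by (simp add: power_divide power_mult)
    finally show ?thesis using a R b unfolding N by (simp add: b_def max_def)
  qed
  then show "emeasure ?M {..a} \<noteq> \<infinity>" unfolding N by simp
qed auto

text \<open>Inversion keeps directions and acts only on the radius, so polar coordinates reduce the
  change of variables to \<open>inversion_radial_measure\<close>. The power with exponent
  \<open>2 * DIM('a)\<close> is the Jacobian.\<close>

lemma nn_integral_inversion:
  fixes f :: "'a::euclidean_space \<Rightarrow> ennreal"
  assumes [measurable]: "f \<in> borel_measurable borel" and R: "R > 0"
  shows "(\<integral>\<^sup>+y. f y * indicator (ball 0 R) y \<partial>lborel)
     = (\<integral>\<^sup>+y. f ((R / norm y)\<^sup>2 *\<^sub>R y) * ennreal ((R / norm y) ^ (2 * DIM('a))) * indicator (- cball 0 R) y \<partial>lborel)"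
proof -
  interpret finite_measure "cone_measure :: 'a measure" by (rule finite_cone_measure)
  let ?d = "DIM('a)"
  let ?G = "\<lambda>r. (\<integral>\<^sup>+\<theta>. f (r *\<^sub>R (\<theta>::'a)) \<partial>cone_measure)"
  let ?w = "\<lambda>r. ennreal ((R / r) ^ (2 * ?d)) * indicator {R<..} r"
  have "(\<integral>\<^sup>+y. f y * indicator (ball 0 R) y \<partial>lborel)
    = (\<integral>\<^sup>+r. radial_density ?d r * (\<integral>\<^sup>+\<theta>. f (r *\<^sub>R \<theta>) * indicator (ball 0 R) (r *\<^sub>R \<theta>) \<partial>cone_measure) \<partial>lborel)"
    by (subst nn_integral_polar) simp_all
  also have "\<dots> = (\<integral>\<^sup>+r. radial_density ?d r * indicator {..<R} r * ?G r \<partial>lborel)"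
  proof (intro nn_integral_cong)
    fix r :: real
    show "radial_density ?d r * (\<integral>\<^sup>+\<theta>. f (r *\<^sub>R \<theta>) * indicator (ball 0 R) (r *\<^sub>R \<theta>) \<partial>cone_measure)
       = radial_density ?d r * indicator {..<R} r * ?G r"
    proof (cases "r > 0")
      case True
      have "(\<integral>\<^sup>+\<theta>. f (r *\<^sub>R \<theta>) * indicator (ball 0 R) (r *\<^sub>R (\<theta>::'a)) \<partial>cone_measure)
         = (\<integral>\<^sup>+\<theta>. indicator {..<R} r * f (r *\<^sub>R (\<theta>::'a)) \<partial>cone_measure)"
        by (rule nn_integral_cong_AE_imp[OF AE_cone_measure_norm]) (use True in \<open>auto simp: indicator_def\<close>)
      then show ?thesis by (simp add: nn_integral_cmult mult.assoc)
    qed (simp add: radial_density_def)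
  qed
  also have "\<dots> = (\<integral>\<^sup>+r. ?G r \<partial>density lborel (\<lambda>r. radial_density ?d r * indicator {..<R} r))"
    by (subst nn_integral_density) simp_all
  also have "\<dots> = (\<integral>\<^sup>+r. radial_density ?d r * ?w r * ?G (R\<^sup>2 / r) \<partial>lborel)"
    by (subst inversion_radial_measure[symmetric]) (simp_all add: R nn_integral_density nn_integral_distr)
  also have "\<dots> = (\<integral>\<^sup>+r. radial_density ?d r * (\<integral>\<^sup>+\<theta>. f ((R / norm (r *\<^sub>R \<theta>))\<^sup>2 *\<^sub>R (r *\<^sub>R \<theta>))
       * ennreal ((R / norm (r *\<^sub>R \<theta>)) ^ (2 * ?d)) * indicator (- cball 0 R) (r *\<^sub>R \<theta>) \<partial>cone_measure) \<partial>lborel)"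
  proof (intro nn_integral_cong)
    fix r :: real
    show "radial_density ?d r * ?w r * ?G (R\<^sup>2 / r) = radial_density ?d r * (\<integral>\<^sup>+\<theta>. f ((R / norm (r *\<^sub>R \<theta>))\<^sup>2 *\<^sub>R (r *\<^sub>R \<theta>))
       * ennreal ((R / norm (r *\<^sub>R \<theta>)) ^ (2 * ?d)) * indicator (- cball 0 R) (r *\<^sub>R \<theta>) \<partial>cone_measure)"
    proof (cases "r > 0")
      case True
      have "(\<integral>\<^sup>+\<theta>. f ((R / norm (r *\<^sub>R \<theta>))\<^sup>2 *\<^sub>R (r *\<^sub>R \<theta>))
       * ennreal ((R / norm (r *\<^sub>R \<theta>)) ^ (2 * ?d)) * indicator (- cball 0 R) (r *\<^sub>R (\<theta>::'a)) \<partial>cone_measure)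
         = (\<integral>\<^sup>+\<theta>. ?w r * f ((R\<^sup>2 / r) *\<^sub>R (\<theta>::'a)) \<partial>cone_measure)"
        by (rule nn_integral_cong_AE_imp[OF AE_cone_measure_norm])
          (use True in \<open>auto simp: indicator_def power2_eq_square mult_ac\<close>)
      then show ?thesis by (simp add: nn_integral_cmult mult.assoc)
    qed (simp add: radial_density_def)
  qed
  also have "\<dots> = (\<integral>\<^sup>+y. f ((R / norm y)\<^sup>2 *\<^sub>R y) * ennreal ((R / norm y) ^ (2 * ?d)) * indicator (- cball 0 R) y \<partial>lborel)"
    by (subst nn_integral_polar) simp_all
  finally show ?thesis .
qed


section \<open>Taylor estimates for test functions\<close>

lemma iter_partial_append: "iter_partial (is @ js) f = iter_partial is (iter_partial js f)"
  by (induction "is") simp_all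

lemma smooth_fn_partial_dir:
  assumes "smooth_fn f" shows "smooth_fn (partial_dir i f)"
proof -
  have "iter_partial js (partial_dir i f) = iter_partial (js @ [i]) f" for js
    by (simp add: iter_partial_append)
  then show ?thesis using assms unfolding smooth_fn_def by simp
qed

lemma smooth_fn_continuous: "smooth_fn f \<Longrightarrow> continuous_on UNIV f"
  unfolding smooth_fn_def by (metis iter_partial.simps(1))

text \<open>\<open>smooth_fn\<close> provides differentiability only at parameter 0 of each axis
  line, but from every base point; moving the base point along the line reaches every
  \<open>t\<close>.\<close>

lemma smooth_fn_DERIV_partial:
  assumes "smooth_fn f"
  shows "((\<lambda>t. f (x + t *\<^sub>R axis i 1)) has_real_derivative partial_dir i f (x + t *\<^sub>R axis i 1)) (at t)"
proof -
  let ?y = "x + t *\<^sub>R axis i 1"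
  have "(\<lambda>t. f (?y + t *\<^sub>R axis i 1)) differentiable (at 0)"
    using assms unfolding smooth_fn_def by (metis iter_partial.simps(1))
  then have "((\<lambda>t. f (?y + t *\<^sub>R axis i 1)) has_real_derivative partial_dir i f ?y) (at 0)"
    unfolding partial_dir_def by (simp add: DERIV_deriv_iff_real_differentiable)
  then have "((\<lambda>s. f (x + (t + s) *\<^sub>R axis i 1)) has_real_derivative partial_dir i f ?y) (at 0)"
    by (simp add: scaleR_add_left add.assoc)
  then show ?thesis
    using DERIV_shift[of "\<lambda>s. f (x + s *\<^sub>R axis i 1)" "partial_dir i f ?y" 0 t] by (simp add: add.commute)
qed

text \<open>The classical step from partial to total derivatives: walk from \<open>x\<close> to
  \<open>x + z\<close> one coordinate at a time and apply the mean value inequality on each edge.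
  Every point visited differs from \<open>x\<close> by a vector whose components are bounded by
  those of \<open>z\<close>, hence lies within \<open>norm z\<close> of \<open>x\<close>.\<close>

lemma smooth_fn_increment:
  assumes f: "smooth_fn f"
    and M: "\<And>i y. dist x y \<le> norm z \<Longrightarrow> \<bar>partial_dir i f y - partial_dir i f x\<bar> \<le> M"
  shows "\<bar>f (x + z) - f x - (\<Sum>i\<in>UNIV. z $ i * partial_dir i f x)\<bar> \<le> M * (\<Sum>i\<in>UNIV. \<bar>z $ i\<bar>)"
proof -
  \<comment> \<open>The corner reached once the edges in \<open>A\<close> are walked: the
    coordinates of \<open>z\<close> in \<open>A\<close>, and 0 elsewhere.\<close>
  define P where "P A = (\<Sum>i\<in>A. (z $ i) *\<^sub>R axis i (1::real))" for A
  have Pk: "P A $ k = (if k \<in> A then z $ k else 0)" for A k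
  proof -
    have "P A $ k = (\<Sum>i\<in>A. if k = i then z $ k else 0)"
      unfolding P_def sum_component by (intro sum.cong) (auto simp: axis_def)
    then show ?thesis by (simp add: sum.delta')
  qed
  have *: "\<bar>f (x + P A) - f x - (\<Sum>i\<in>A. z $ i * partial_dir i f x)\<bar> \<le> M * (\<Sum>i\<in>A. \<bar>z $ i\<bar>)"
    if "finite A" for A :: "'a set"
    using that
  proof (induction A rule: finite_induct)
    case (insert i A)
    let ?g = "\<lambda>t. f (x + P A + t *\<^sub>R axis i 1) - t * partial_dir i f x"
    have "norm (?g (z $ i) - ?g 0) \<le> M * norm (z $ i - 0)"
    proof (rule field_differentiable_bound[where f' = "\<lambda>t. partial_dir i f (x + P A + t *\<^sub>R axis i 1) - partial_dir i f x"])
      show "convex (closed_segment 0 (z $ i))" by simp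
      fix t assume t: "t \<in> closed_segment 0 (z $ i)"
      show "(?g has_field_derivative partial_dir i f (x + P A + t *\<^sub>R axis i 1) - partial_dir i f x) (at t within closed_segment 0 (z $ i))"
        by (rule DERIV_subset[OF DERIV_diff[OF smooth_fn_DERIV_partial[OF f]]])
           (auto intro!: derivative_eq_intros)
      have tz: "\<bar>t\<bar> \<le> \<bar>z $ i\<bar>" using t by (auto simp: closed_segment_eq_real_ivl split: if_splits)
      have "norm (P A + t *\<^sub>R axis i 1) \<le> norm z"
        by (rule norm_le_componentwise_cart) (use insert.hyps tz in \<open>auto simp: Pk axis_def\<close>)
      then have "dist x (x + P A + t *\<^sub>R axis i 1) \<le> norm z"
        by (simp add: dist_norm add.assoc) (metis norm_minus_cancel minus_add_distrib diff_conv_add_uminus)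
      then show "norm (partial_dir i f (x + P A + t *\<^sub>R axis i 1) - partial_dir i f x) \<le> M"
        using M by simp
    qed auto
    moreover have "P (insert i A) = P A + (z $ i) *\<^sub>R axis i 1"
      using insert.hyps by (simp add: P_def)
    ultimately have "\<bar>f (x + P (insert i A)) - f (x + P A) - z $ i * partial_dir i f x\<bar> \<le> M * \<bar>z $ i\<bar>"
      by (simp add: add.assoc)
    then show ?case using insert.IH insert.hyps by (simp add: distrib_left)
  qed (simp add: P_def)
  have "P UNIV = z" by (simp add: vec_eq_iff Pk)
  then show ?thesis using *[of UNIV] by simp
qed

text \<open>\<open>smooth_fn\<close> speaks of partial derivatives only. Taylor expansion along an
  arbitrary segment needs the chain rule, hence the total derivative, which continuity of the
  partials provides.\<close>

lemma smooth_fn_has_derivative: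
  assumes f: "smooth_fn f"
  shows "(f has_derivative (\<lambda>z. \<Sum>i\<in>UNIV. z $ i * partial_dir i f x)) (at x)"
  unfolding has_derivative_at_alt
proof (intro conjI allI impI)
  show "bounded_linear (\<lambda>z. \<Sum>i\<in>UNIV. z $ i * partial_dir i f x)"
    by (intro bounded_linear_sum bounded_linear_mult_left[THEN bounded_linear_compose] bounded_linear_vec_nth)
  fix e :: real assume e: "e > 0"
  let ?n = "real CARD('a)"
  have n: "?n > 0" by simp
  \<comment> \<open>The tolerance is divided by the dimension because the sum of the absolute
    coordinates of a vector is bounded by \<open>?n\<close> times its norm.\<close>
  have "\<exists>d>0. \<forall>y. dist x y < d \<longrightarrow> \<bar>partial_dir i f y - partial_dir i f x\<bar> \<le> e / ?n" for i
  proof -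
    have "continuous_on UNIV (partial_dir i f)"
      by (rule smooth_fn_continuous[OF smooth_fn_partial_dir[OF f]])
    then have "isCont (partial_dir i f) x" by (simp add: continuous_on_eq_continuous_at)
    then obtain d where "d > 0" "\<forall>y. dist y x < d \<longrightarrow> dist (partial_dir i f y) (partial_dir i f x) < e / ?n"
      using e n unfolding continuous_at_eps_delta by (metis divide_pos_pos)
    then show ?thesis by (intro exI[of _ d]) (auto simp: dist_commute dist_real_def less_imp_le)
  qed
  then obtain d where d: "\<And>i. d i > 0"
    "\<And>i y. dist x y < d i \<Longrightarrow> \<bar>partial_dir i f y - partial_dir i f x\<bar> \<le> e / ?n" by metis
  show "\<exists>d>0. \<forall>y. norm (y - x) < d \<longrightarrow> norm (f y - f x - (\<Sum>i\<in>UNIV. (y - x) $ i * partial_dir i f x)) \<le> e * norm (y - x)"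
  proof (intro exI[of _ "Min (range d)"] conjI allI impI)
    show "Min (range d) > 0" using d by simp
    fix y assume y: "norm (y - x) < Min (range d)"
    have "\<bar>f (x + (y - x)) - f x - (\<Sum>i\<in>UNIV. (y - x) $ i * partial_dir i f x)\<bar> \<le> e / ?n * (\<Sum>i\<in>UNIV. \<bar>(y - x) $ i\<bar>)"
    proof (rule smooth_fn_increment[OF f])
      fix i w assume "dist x w \<le> norm (y - x)"
      then have "dist x w < Min (range d)" using y by linarith
      then show "\<bar>partial_dir i f w - partial_dir i f x\<bar> \<le> e / ?n" by (intro d) simp
    qed
    also have "\<dots> \<le> e / ?n * (?n * norm (y - x))"
      using e sum_bounded_above[of UNIV "\<lambda>i. \<bar>(y - x) $ i\<bar>" "norm (y - x)"] component_le_norm_cart[of "y - x"]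
      by (intro mult_left_mono) auto
    also have "\<dots> = e * norm (y - x)" using n by simp
    finally show "norm (f y - f x - (\<Sum>i\<in>UNIV. (y - x) $ i * partial_dir i f x)) \<le> e * norm (y - x)" by simp
  qed
qed

lemma smooth_fn_DERIV_line:
  assumes f: "smooth_fn f"
  shows "((\<lambda>t. f (x + t *\<^sub>R z)) has_real_derivative (\<Sum>i\<in>UNIV. z $ i * partial_dir i f (x + t *\<^sub>R z))) (at t)"
proof -
  have "((\<lambda>t. x + t *\<^sub>R z) has_derivative (\<lambda>h. h *\<^sub>R z)) (at t)"
    by (auto intro!: derivative_eq_intros)
  note has_derivative_compose[OF this smooth_fn_has_derivative[OF f]]
  moreover have "(\<lambda>h. \<Sum>i\<in>UNIV. (h *\<^sub>R z) $ i * partial_dir i f (x + t *\<^sub>R z))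
      = (*) (\<Sum>i\<in>UNIV. z $ i * partial_dir i f (x + t *\<^sub>R z))"
    by (auto simp: fun_eq_iff sum_distrib_left mult_ac)
  ultimately show ?thesis by (simp add: has_field_derivative_def)
qed

lemma partial_dir_zero:
  assumes "open U" "x \<in> U" "\<And>y. y \<in> U \<Longrightarrow> f y = 0"
  shows "partial_dir i f x = 0"
proof -
  have "((\<lambda>t. x + t *\<^sub>R axis i 1) \<longlongrightarrow> x + 0 *\<^sub>R axis i (1::real)) (nhds 0)"
    by (intro tendsto_intros filterlim_ident)
  then have "\<forall>\<^sub>F t in nhds 0. x + t *\<^sub>R axis i (1::real) \<in> U"
    using assms(1,2) by (simp add: tendsto_def)
  then have "\<forall>\<^sub>F t in nhds 0. f (x + t *\<^sub>R axis i 1) = 0"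
    by eventually_elim (rule assms)
  then have "deriv (\<lambda>t. f (x + t *\<^sub>R axis i 1)) 0 = deriv (\<lambda>t. 0) (0::real)"
    by (intro deriv_cong_ev) auto
  then show ?thesis by (simp add: partial_dir_def)
qed

lemma partial_dir_support: "{x. partial_dir i h x \<noteq> 0} \<subseteq> closure {x. h x \<noteq> 0}"
proof clarify
  fix x assume x: "partial_dir i h x \<noteq> 0"
  show "x \<in> closure {x. h x \<noteq> 0}"
  proof (rule ccontr)
    assume "x \<notin> closure {x. h x \<noteq> 0}"
    then have "partial_dir i h x = 0"
      by (intro partial_dir_zero[of "- closure {x. h x \<noteq> 0}"])
        (use closure_subset[of "{x. h x \<noteq> 0}"] in \<open>auto simp: open_Compl\<close>)
    then show False using x by simp
  qed
qed

text \<open>Differentiation does not enlarge the support, so bounds for test functions apply to all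
  their derivatives. This is why the Taylor constants below are uniform in \<open>x\<close>.\<close>

lemma test_fn_partial_dir:
  assumes "test_fn \<Omega> h" shows "test_fn \<Omega> (partial_dir i h)"
proof -
  note partial_dir_support[of i h]
  then have "closure {x. partial_dir i h x \<noteq> 0} \<subseteq> closure {x. h x \<noteq> 0}"
    by (simp add: closure_minimal)
  moreover have "compact (closure {x. partial_dir i h x \<noteq> 0})"
    using assms calculation unfolding test_fn_def by (metis closed_closure compact_Int_closed inf.absorb2)
  ultimately show ?thesis
    using assms smooth_fn_partial_dir unfolding test_fn_def by blast
qed

lemma test_fn_bounded:
  assumes "test_fn \<Omega> h" obtains C where "C > 0" "\<And>x. \<bar>h x\<bar> \<le> C"
proof -
  let ?K = "closure {x. h x \<noteq> 0}"
  have "compact (h ` ?K)"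
    using assms unfolding test_fn_def
    by (intro compact_continuous_image) (auto intro: continuous_on_subset[OF smooth_fn_continuous])
  then obtain C where C: "\<And>y. y \<in> h ` ?K \<Longrightarrow> norm y \<le> C" "C > 0"
    using compact_imp_bounded bounded_pos by metis
  have "\<bar>h x\<bar> \<le> C" for x
  proof (cases "h x = 0")
    case False
    then have "x \<in> ?K" using closure_subset by fastforce
    then show ?thesis using C by simp
  qed (use C in simp)
  then show thesis using that C by blast
qed

lemma sum_abs_component_le: "(\<Sum>i\<in>UNIV. \<bar>z $ i\<bar>) \<le> real CARD('n) * norm (z :: real^'n)"
  using sum_bounded_above[of UNIV "\<lambda>i. \<bar>z $ i\<bar>" "norm z"] component_le_norm_cart[of z] by simp

text \<open>Common step of the Taylor estimates: the remainder at order m+1 is controlled by the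
  remainders at order m of the partial derivatives.\<close>
lemma smooth_fn_remainder_step:
  assumes f: "smooth_fn f"
    and q: "\<And>t. (q has_real_derivative (\<Sum>i\<in>UNIV. z $ i * r i t)) (at t)"
    and B: "\<And>i t. 0 \<le> t \<Longrightarrow> t \<le> 1 \<Longrightarrow> \<bar>partial_dir i f (x + t *\<^sub>R z) - r i t\<bar> \<le> B"
  shows "\<bar>f (x + z) - f x - (q 1 - q 0)\<bar> \<le> real CARD('n) * norm (z::real^'n) * B"
proof -
  let ?g = "\<lambda>t. f (x + t *\<^sub>R z) - q t"
  let ?g' = "\<lambda>t. \<Sum>i\<in>UNIV. z $ i * (partial_dir i f (x + t *\<^sub>R z) - r i t)"
  have "\<And>t. (?g has_real_derivative ?g' t) (at t)"
    by (rule derivative_eq_intros smooth_fn_DERIV_line[OF f] q)+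
       (simp add: right_diff_distrib sum_subtractf)
  then obtain t where t: "0 < t" "t < 1" "?g 1 - ?g 0 = (1 - 0) * ?g' t"
    using MVT2[of 0 1 ?g ?g'] by auto
  \<comment> \<open>\<open>undefined\<close> is an arbitrary index: a single one already shows that
    \<open>B\<close> bounds an absolute value.\<close>
  have B0: "0 \<le> B" using B[of 0 undefined] by fastforce
  have "\<bar>?g' t\<bar> \<le> (\<Sum>i\<in>UNIV. \<bar>z $ i\<bar> * B)"
    by (rule order_trans[OF sum_abs]) (use t B in \<open>auto intro!: sum_mono mult_left_mono simp: abs_mult\<close>)
  also have "\<dots> = (\<Sum>i\<in>UNIV. \<bar>z $ i\<bar>) * B" by (simp add: sum_distrib_right)
  also have "\<dots> \<le> real CARD('n) * norm z * B"
    by (rule mult_right_mono[OF sum_abs_component_le B0])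
  finally show ?thesis using t(3) by (simp add: algebra_simps)
qed

text \<open>The remainder of order zero: the comparison polynomial is 0 and the partial derivatives
  are bounded outright. Here and in the next two lemmas the sum of the constants over the
  coordinates serves as their common bound.\<close>

lemma test_fn_lipschitz:
  fixes h :: "real^'n \<Rightarrow> real"
  assumes h: "test_fn \<Omega> h"
  obtains C where "C > 0" "\<And>x z. \<bar>h (x + z) - h x\<bar> \<le> C * norm z"
proof -
  have "\<forall>i. \<exists>C>0. \<forall>x. \<bar>partial_dir i h x\<bar> \<le> C"
    using test_fn_bounded[OF test_fn_partial_dir[OF h]] by metis
  then obtain C where C: "\<And>i. C i > 0" "\<And>i x. \<bar>partial_dir i h x\<bar> \<le> C i" by metis
  have CS: "\<bar>partial_dir i h x\<bar> \<le> (\<Sum>i\<in>UNIV. C i)" for i x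
    using C by (intro order_trans[OF C(2)[of i x]] member_le_sum) (auto intro: less_imp_le)
  have "\<bar>h (x + z) - h x - ((\<lambda>t. 0) 1 - (\<lambda>t. 0) (0::real))\<bar> \<le> real CARD('n) * norm z * (\<Sum>i\<in>UNIV. C i)" for x z
    by (rule smooth_fn_remainder_step[where r = "\<lambda>_ _. 0"])
       (use h CS in \<open>auto simp: test_fn_def\<close>)
  then show thesis
    using that[of "real CARD('n) * (\<Sum>i\<in>UNIV. C i)"] C by (simp add: sum_pos mult_ac)
qed

text \<open>Lipschitz partial derivatives leave a quadratic remainder. Against
  \<open>norm z powr (- p)\<close> it is integrable near 0 exactly when p < n + 2, which is the case
  s < 1.\<close>

lemma test_fn_taylor2:
  fixes h :: "real^'n \<Rightarrow> real"
  assumes h: "test_fn \<Omega> h"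
  obtains C where "C > 0" "\<And>x z. \<bar>h (x + z) - h x - (\<Sum>i\<in>UNIV. z $ i * partial_dir i h x)\<bar> \<le> C * norm z ^ 2"
proof -
  have "\<forall>i. \<exists>C>0. \<forall>x z. \<bar>partial_dir i h (x + z) - partial_dir i h x\<bar> \<le> C * norm z"
    using test_fn_lipschitz[OF test_fn_partial_dir[OF h]] by metis
  then obtain C where C: "\<And>i. C i > 0" "\<And>i x z. \<bar>partial_dir i h (x + z) - partial_dir i h x\<bar> \<le> C i * norm z" by metis
  let ?S = "\<Sum>i\<in>UNIV. C i"
  have CS: "C i \<le> ?S" for i using C by (intro member_le_sum) (auto intro: less_imp_le)
  have "\<bar>h (x + z) - h x - ((\<lambda>t. t * (\<Sum>i\<in>UNIV. z $ i * partial_dir i h x)) 1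
       - (\<lambda>t. t * (\<Sum>i\<in>UNIV. z $ i * partial_dir i h x)) 0)\<bar> \<le> real CARD('n) * norm z * (?S * norm z)" for x z
  proof (rule smooth_fn_remainder_step[where r = "\<lambda>i _. partial_dir i h x"])
    fix i and t :: real assume t: "0 \<le> t" "t \<le> 1"
    have "\<bar>partial_dir i h (x + t *\<^sub>R z) - partial_dir i h x\<bar> \<le> C i * (t * norm z)"
      using C(2)[of i x "t *\<^sub>R z"] t by simp
    also have "\<dots> \<le> ?S * norm z"
      using t C(1)[of i] CS[of i] by (intro mult_mono) (auto intro: mult_left_le_one_le)
    finally show "\<bar>partial_dir i h (x + t *\<^sub>R z) - partial_dir i h x\<bar> \<le> ?S * norm z" .
  qed (use h in \<open>auto simp: test_fn_def intro!: derivative_eq_intros\<close>)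
  then show thesis
    using that[of "real CARD('n) * ?S"] C by (simp add: sum_pos mult_ac power2_eq_square)
qed

text \<open>Made for s = 1: there the second-order part against the kernel diverges logarithmically
  and has to be split off, while a cubic remainder is integrable near 0.\<close>

lemma test_fn_taylor3:
  fixes h :: "real^'n \<Rightarrow> real"
  assumes h: "test_fn \<Omega> h"
  obtains C where "C > 0" "\<And>x z. \<bar>h (x + z) - h x - (\<Sum>i\<in>UNIV. z $ i * partial_dir i h x)
     - (\<Sum>i\<in>UNIV. \<Sum>j\<in>UNIV. z $ i * z $ j * partial_dir j (partial_dir i h) x) / 2\<bar> \<le> C * norm z ^ 3"
proof -
  have "\<forall>i. \<exists>C>0. \<forall>x z. \<bar>partial_dir i h (x + z) - partial_dir i h x - (\<Sum>j\<in>UNIV. z $ j * partial_dir j (partial_dir i h) x)\<bar> \<le> C * norm z ^ 2"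
    using test_fn_taylor2[OF test_fn_partial_dir[OF h]] by metis
  from choice[OF this] obtain C where C: "\<And>i. C i > 0" "\<And>i x z. \<bar>partial_dir i h (x + z) - partial_dir i h x
      - (\<Sum>j\<in>UNIV. z $ j * partial_dir j (partial_dir i h) x)\<bar> \<le> C i * norm z ^ 2" by auto
  let ?S = "\<Sum>i\<in>UNIV. C i"
  have CS: "C i \<le> ?S" for i using C by (intro member_le_sum) (auto intro: less_imp_le)
  \<comment> \<open>Its derivative in \<open>t\<close> combines the first-order Taylor polynomials
    of the partial derivatives, as \<open>smooth_fn_remainder_step\<close> requires;
    \<open>t^2 / 2\<close> is the primitive of \<open>t\<close>.\<close>
  let ?q = "\<lambda>x z t. t * (\<Sum>i\<in>UNIV. z $ i * partial_dir i h x)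
      + t^2 / 2 * (\<Sum>i\<in>UNIV. \<Sum>j\<in>UNIV. z $ i * z $ j * partial_dir j (partial_dir i h) x)"
  have "\<bar>h (x + z) - h x - (?q x z 1 - ?q x z 0)\<bar> \<le> real CARD('n) * norm z * (?S * norm z ^ 2)" for x z
  proof (rule smooth_fn_remainder_step[where r = "\<lambda>i t. partial_dir i h x + t * (\<Sum>j\<in>UNIV. z $ j * partial_dir j (partial_dir i h) x)"])
    fix i and t :: real assume t: "0 \<le> t" "t \<le> 1"
    have "\<bar>partial_dir i h (x + t *\<^sub>R z) - (partial_dir i h x + t * (\<Sum>j\<in>UNIV. z $ j * partial_dir j (partial_dir i h) x))\<bar>
        \<le> C i * (t * norm z) ^ 2"
      using C(2)[of i x "t *\<^sub>R z"] t by (simp add: sum_distrib_left mult.assoc diff_diff_add)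
    also have "\<dots> \<le> ?S * norm z ^ 2"
      using t C(1)[of i] CS[of i] by (intro mult_mono power_mono) (auto intro: mult_left_le_one_le)
    finally show "\<bar>partial_dir i h (x + t *\<^sub>R z) - (partial_dir i h x + t * (\<Sum>j\<in>UNIV. z $ j * partial_dir j (partial_dir i h) x))\<bar>
        \<le> ?S * norm z ^ 2" .
  next
    fix t
    have "((\<lambda>t. t * a + t^2 / 2 * b) has_real_derivative a + t * b) (at t)" for a b :: real
      by (auto intro!: derivative_eq_intros)
    moreover have "(\<Sum>i\<in>UNIV. z $ i * (partial_dir i h x + t * (\<Sum>j\<in>UNIV. z $ j * partial_dir j (partial_dir i h) x)))
       = (\<Sum>i\<in>UNIV. z $ i * partial_dir i h x) + t * (\<Sum>i\<in>UNIV. \<Sum>j\<in>UNIV. z $ i * z $ j * partial_dir j (partial_dir i h) x)"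
      by (simp add: distrib_left sum.distrib sum_distrib_left mult_ac)
    ultimately show "(?q x z has_real_derivative (\<Sum>i\<in>UNIV. z $ i * (partial_dir i h x + t * (\<Sum>j\<in>UNIV. z $ j * partial_dir j (partial_dir i h) x)))) (at t)"
      by simp
  qed (use h in \<open>auto simp: test_fn_def\<close>)
  then show thesis
    using that[of "real CARD('n) * ?S"] C by (simp add: sum_pos mult_ac power2_eq_square power3_eq_cube diff_diff_add add.assoc)
qed


section \<open>Radial integrals and second moments\<close>

lemma nn_integral_radial:
  fixes f :: "real \<Rightarrow> ennreal"
  assumes [measurable]: "f \<in> borel_measurable borel"
  shows "(\<integral>\<^sup>+x. f (norm (x::'a::euclidean_space)) \<partial>lborel)
    = ennreal (unit_ball_vol (DIM('a))) * (\<integral>\<^sup>+r. radial_density (DIM('a)) r * f r \<partial>lborel)"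
proof -
  have "(\<integral>\<^sup>+x. f (norm (x::'a)) \<partial>lborel)
      = (\<integral>\<^sup>+r. radial_density (DIM('a)) r * (\<integral>\<^sup>+\<theta>. f (norm (r *\<^sub>R (\<theta>::'a))) \<partial>cone_measure) \<partial>lborel)"
    by (subst nn_integral_polar) simp_all
  also have "\<dots> = (\<integral>\<^sup>+r. ennreal (unit_ball_vol (DIM('a))) * (radial_density (DIM('a)) r * f r) \<partial>lborel)"
  proof (intro nn_integral_cong)
    fix r :: real
    show "radial_density (DIM('a)) r * (\<integral>\<^sup>+\<theta>. f (norm (r *\<^sub>R (\<theta>::'a))) \<partial>cone_measure)
       = ennreal (unit_ball_vol (DIM('a))) * (radial_density (DIM('a)) r * f r)"
    proof (cases "r > 0")
      case True
      have "(\<integral>\<^sup>+\<theta>. f (norm (r *\<^sub>R (\<theta>::'a))) \<partial>cone_measure) = (\<integral>\<^sup>+\<theta>. f r \<partial>(cone_measure :: 'a measure))"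
        by (rule nn_integral_cong_AE_imp[OF AE_cone_measure_norm]) (use True in simp)
      also have "\<dots> = f r * ennreal (unit_ball_vol (DIM('a)))"
        by (simp add: emeasure_cone_UNIV[symmetric] cone_measure_def)
      finally show ?thesis by (simp add: mult_ac)
    qed (simp add: radial_density_def)
  qed
  also have "\<dots> = ennreal (unit_ball_vol (DIM('a))) * (\<integral>\<^sup>+r. radial_density (DIM('a)) r * f r \<partial>lborel)"
    by (rule nn_integral_cmult) simp
  finally show ?thesis .
qed

lemma integrable_radial:
  fixes g :: "real \<Rightarrow> real"
  assumes [measurable]: "g \<in> borel_measurable borel"
    and int: "set_integrable lborel {0<..} (\<lambda>r. g r * r ^ (DIM('a) - 1))"
  shows "integrable lborel (\<lambda>x::'a::euclidean_space. g (norm x))"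
proof (rule integrableI_bounded)
  have "(\<integral>\<^sup>+x. ennreal (norm (g (norm (x::'a)))) \<partial>lborel)
     = ennreal (unit_ball_vol (DIM('a))) * (\<integral>\<^sup>+r. radial_density (DIM('a)) r * ennreal (norm (g r)) \<partial>lborel)"
    by (rule nn_integral_radial) simp
  also have "(\<integral>\<^sup>+r. radial_density (DIM('a)) r * ennreal (norm (g r)) \<partial>lborel)
     = (\<integral>\<^sup>+r. ennreal (real (DIM('a))) * ennreal (norm (indicator {0<..} r *\<^sub>R (g r * r ^ (DIM('a) - 1)))) \<partial>lborel)"
  proof (intro nn_integral_cong)
    fix r :: real
    show "radial_density (DIM('a)) r * ennreal (norm (g r))
      = ennreal (real (DIM('a))) * ennreal (norm (indicator {0<..} r *\<^sub>R (g r * r ^ (DIM('a) - 1))))"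
      by (cases "r > 0") (simp_all add: radial_density_def ennreal_mult[symmetric] abs_mult mult_ac)
  qed
  also have "\<dots> = ennreal (real (DIM('a))) * (\<integral>\<^sup>+r. ennreal (norm (indicator {0<..} r *\<^sub>R (g r * r ^ (DIM('a) - 1)))) \<partial>lborel)"
    using int unfolding set_integrable_def by (intro nn_integral_cmult) auto
  also have "ennreal (unit_ball_vol (DIM('a))) * \<dots> < \<infinity>"
    using int unfolding set_integrable_def integrable_iff_bounded by (simp add: ennreal_mult_less_top)
  finally show "(\<integral>\<^sup>+x. ennreal (norm (g (norm (x::'a)))) \<partial>lborel) < \<infinity>" .
qed simp

text \<open>The factor \<open>real (DIM('a)) * unit_ball_vol (DIM('a))\<close> is the area of the
  unit sphere.\<close>

lemma has_bochner_integral_radial: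
  fixes g :: "real \<Rightarrow> real"
  assumes [measurable]: "g \<in> borel_measurable borel" "S \<in> sets borel"
    and S: "S \<subseteq> {0<..}" and nonneg: "\<And>r. r \<in> S \<Longrightarrow> 0 \<le> g r"
    and int: "((\<lambda>r. g r * r ^ (DIM('a) - 1)) has_integral I) S"
  shows "has_bochner_integral lborel (\<lambda>x::'a::euclidean_space. indicator S (norm x) * g (norm x))
     (real (DIM('a)) * unit_ball_vol (DIM('a)) * I)"
proof (rule has_bochner_integral_nn_integral)
  let ?f = "\<lambda>r. real (DIM('a)) * (indicator S r * (g r * r ^ (DIM('a) - 1)))"
  have I0: "0 \<le> I"
    by (rule has_integral_nonneg[OF int]) (use S nonneg in \<open>auto intro!: mult_nonneg_nonneg\<close>)
  then show "0 \<le> real (DIM('a)) * unit_ball_vol (DIM('a)) * I" by simp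
  show "AE x::'a in lborel. 0 \<le> indicator S (norm x) * g (norm x)"
    using nonneg by (auto simp: indicator_def)
  have "((\<lambda>r. if r \<in> S then g r * r ^ (DIM('a) - 1) else 0) has_integral I) UNIV"
    using int by (simp add: has_integral_restrict_UNIV)
  then have "((\<lambda>r. indicator S r * (g r * r ^ (DIM('a) - 1))) has_integral I) UNIV"
    by (rule has_integral_eq[rotated]) (auto simp: indicator_def)
  then have "(?f has_integral (real (DIM('a)) * I)) UNIV"
    by (rule has_integral_mult_right)
  then have nn: "(\<integral>\<^sup>+r. ennreal (?f r) \<partial>lborel) = ennreal (real (DIM('a)) * I)"
    by (rule nn_integral_has_integral_lborel[rotated 2])
       (use S nonneg in \<open>auto intro!: mult_nonneg_nonneg simp: indicator_def\<close>)
  have "(\<integral>\<^sup>+x. ennreal (indicator S (norm (x::'a)) * g (norm x)) \<partial>lborel)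
     = ennreal (unit_ball_vol (DIM('a))) * (\<integral>\<^sup>+r. radial_density (DIM('a)) r * ennreal (indicator S r * g r) \<partial>lborel)"
    by (rule nn_integral_radial) simp
  also have "(\<integral>\<^sup>+r. radial_density (DIM('a)) r * ennreal (indicator S r * g r) \<partial>lborel) = (\<integral>\<^sup>+r. ennreal (?f r) \<partial>lborel)"
  proof (intro nn_integral_cong)
    fix r :: real
    show "radial_density (DIM('a)) r * ennreal (indicator S r * g r) = ennreal (?f r)"
    proof (cases "r \<in> S")
      case True
      then have "r > 0" "0 \<le> g r" using S nonneg by auto
      then show ?thesis using True by (simp add: radial_density_def ennreal_mult[symmetric] mult_ac)
    qed simp
  qed
  finally show "(\<integral>\<^sup>+x. ennreal (indicator S (norm (x::'a)) * g (norm x)) \<partial>lborel)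
     = ennreal (real (DIM('a)) * unit_ball_vol (DIM('a)) * I)"
    unfolding nn using I0 by (simp add: ennreal_mult[symmetric] mult_ac)
qed simp

lemma powr_times_radial: "r > 0 \<Longrightarrow> d > 0 \<Longrightarrow> r powr e * r ^ (d - 1) = r powr (e + real d - 1)" for r :: real
  by (simp add: powr_realpow[symmetric] powr_add[symmetric] of_nat_diff add_diff_eq)

lemma integrable_norm_powr_tail:
  assumes e: "e < - real (DIM('a))" and a: "a > 0"
  shows "integrable lborel (\<lambda>x::'a::euclidean_space. indicator {a<..} (norm x) * norm x powr e)"
proof -
  have "((\<lambda>r. r powr (e + real (DIM('a)) - 1)) has_integral - (a powr (e + real (DIM('a)) - 1 + 1)) / (e + real (DIM('a)) - 1 + 1)) {a..}"
    using e a by (intro has_integral_powr_to_inf) auto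
  then have "((\<lambda>r. r powr e * r ^ (DIM('a) - 1)) has_integral - (a powr (e + real (DIM('a)) - 1 + 1)) / (e + real (DIM('a)) - 1 + 1)) {a..}"
    by (rule has_integral_eq[rotated]) (use a in \<open>subst powr_times_radial; simp\<close>)
  then have "has_bochner_integral lborel (\<lambda>x::'a. indicator {a..} (norm x) * norm x powr e)
     (real (DIM('a)) * unit_ball_vol (DIM('a)) * (- (a powr (e + real (DIM('a)) - 1 + 1)) / (e + real (DIM('a)) - 1 + 1)))"
    by (intro has_bochner_integral_radial) (use a in auto)
  then have "integrable lborel (\<lambda>x::'a. indicator {a..} (norm x) * norm x powr e)"
    by (rule integrable.intros)
  then show ?thesis by (rule Bochner_Integration.integrable_bound) (auto simp: indicator_def)
qed

lemma has_bochner_integral_norm_powr_ball: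
  assumes e: "e > - real (DIM('a))" and a: "a > 0"
  shows "has_bochner_integral lborel (\<lambda>x::'a::euclidean_space. indicator {0<..a} (norm x) * norm x powr e)
     (real (DIM('a)) * unit_ball_vol (DIM('a)) * (a powr (e + real (DIM('a))) / (e + real (DIM('a)))))"
proof -
  have "((\<lambda>r. r powr (e + real (DIM('a)) - 1)) has_integral (a powr (e + real (DIM('a)) - 1 + 1)) / (e + real (DIM('a)) - 1 + 1)) {0..a}"
    using e a by (intro has_integral_powr_from_0) auto
  then have "((\<lambda>r. r powr (e + real (DIM('a)) - 1)) has_integral (a powr (e + real (DIM('a)))) / (e + real (DIM('a)))) {0<..a}"
    by (subst has_integral_spike_set_eq[of _ "{0..a}"]) (auto intro: negligible_subset[of "{0}"])
  then have "((\<lambda>r. r powr e * r ^ (DIM('a) - 1)) has_integral (a powr (e + real (DIM('a)))) / (e + real (DIM('a)))) {0<..a}"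
    by (rule has_integral_eq[rotated]) (subst powr_times_radial; simp)
  then show ?thesis by (intro has_bochner_integral_radial) auto
qed

text \<open>The exponent is the scale-invariant one: the radial integrand becomes 1 / r. The
  logarithm of the case s = 1 originates here.\<close>

lemma has_bochner_integral_norm_powr_shell:
  assumes a: "0 < a" "a < 1"
  shows "has_bochner_integral lborel (\<lambda>x::'a::euclidean_space. indicator {a<..<1} (norm x) * norm x powr (- real (DIM('a))))
     (real (DIM('a)) * unit_ball_vol (DIM('a)) * ln (1 / a))"
proof -
  have "((\<lambda>r. 1 / r) has_integral ln 1 - ln a) {a..1}"
    using a by (intro fundamental_theorem_of_calculus)
      (auto intro!: derivative_eq_intros simp: has_real_derivative_iff_has_vector_derivative[symmetric])
  then have "((\<lambda>r. 1 / r) has_integral ln (1 / a)) {a<..<1}"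
    using a by (simp add: has_integral_Icc_iff_Ioo ln_div)
  then have "((\<lambda>r. r powr (- real (DIM('a))) * r ^ (DIM('a) - 1)) has_integral ln (1 / a)) {a<..<1}"
    by (rule has_integral_eq[rotated]) (use a in \<open>subst powr_times_radial; simp add: powr_minus_divide\<close>)
  then show ?thesis by (intro has_bochner_integral_radial) (use a in auto)
qed

text \<open>The radial integrand is nonincreasing, so width times value at the inner radius is an
  upper bound. This crude bound avoids singling out the radial exponent -1, where the primitive is a
  logarithm.\<close>

lemma integral_norm_powr_shell_le:
  assumes a: "0 < a" "a \<le> b" and e: "e + real (DIM('a)) - 1 \<le> 0"
  shows "integrable lborel (\<lambda>x::'a::euclidean_space. indicator {a..b} (norm x) * norm x powr e)"
    and "(LINT x::'a|lborel. indicator {a..b} (norm x) * norm x powr e)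
      \<le> real (DIM('a)) * unit_ball_vol (DIM('a)) * ((b - a) * a powr (e + real (DIM('a)) - 1))"
proof -
  let ?e = "e + real (DIM('a)) - 1"
  have "(\<lambda>r. r powr ?e) integrable_on {a..b}"
    using a by (intro integrable_continuous_real continuous_intros) auto
  then obtain I where I: "((\<lambda>r. r powr ?e) has_integral I) {a..b}" by blast
  have "((\<lambda>r. a powr ?e) has_integral (b - a) * a powr ?e) {a..b}"
    using has_integral_const_real[of "a powr ?e" a b] a by simp
  with I have le: "I \<le> (b - a) * a powr ?e"
    by (rule has_integral_le) (use a e in \<open>auto intro: powr_mono2'\<close>)
  have "((\<lambda>r. r powr e * r ^ (DIM('a) - 1)) has_integral I) {a..b}"
    by (rule has_integral_eq[rotated, OF I]) (use a in \<open>subst powr_times_radial; simp\<close>)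
  then have *: "has_bochner_integral lborel (\<lambda>x::'a. indicator {a..b} (norm x) * norm x powr e)
     (real (DIM('a)) * unit_ball_vol (DIM('a)) * I)"
    by (intro has_bochner_integral_radial) (use a in auto)
  show "integrable lborel (\<lambda>x::'a. indicator {a..b} (norm x) * norm x powr e)"
    using * by (rule integrable.intros)
  show "(LINT x::'a|lborel. indicator {a..b} (norm x) * norm x powr e)
      \<le> real (DIM('a)) * unit_ball_vol (DIM('a)) * ((b - a) * a powr ?e)"
    unfolding has_bochner_integral_integral_eq[OF *] using le by (intro mult_left_mono) auto
qed

lemma integrable_one_plus_norm_powr:
  assumes e: "e < - real (DIM('a))"
  shows "integrable lborel (\<lambda>x::'a::euclidean_space. (1 + norm x) powr e)"
proof -
  have "integrable lborel (\<lambda>x::'a. indicator (cball 0 1) x + indicator {1<..} (norm x) * norm x powr e)"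
    by (intro Bochner_Integration.integrable_add integrable_norm_powr_tail e integrable_real_indicator)
       (auto simp: emeasure_cball)
  then show ?thesis
  proof (rule Bochner_Integration.integrable_bound)
    have e0: "e < 0" using e by (smt (verit) of_nat_0_le_iff)
    show "AE x::'a in lborel. norm ((1 + norm x) powr e) \<le> norm (indicator (cball 0 1) x + indicator {1<..} (norm x) * norm x powr e)"
    proof (rule AE_I2)
      fix x :: 'a
      show "norm ((1 + norm x) powr e) \<le> norm (indicator (cball 0 1) x + indicator {1<..} (norm x) * norm x powr e)"
      proof (cases "norm x \<le> 1")
        case True
        have "(1 + norm x) powr e \<le> 1 powr e" using e0 by (intro powr_mono2') auto
        then show ?thesis using True by (simp add: indicator_def)
      next
        case False
        then have "(1 + norm x) powr e \<le> norm x powr e" using e0 by (intro powr_mono2') auto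
        then show ?thesis using False by (simp add: indicator_def)
      qed
    qed
  qed simp
qed

section \<open>Symmetries of Lebesgue measure and second moments of a shell\<close>

lemma lborel_distr_euclidean_uminus: "distr lborel borel uminus = (lborel :: 'a::euclidean_space measure)"
proof -
  have "(lborel :: 'a measure) = density (distr lborel borel (\<lambda>x. 0 + (-1) *\<^sub>R x)) (\<lambda>_. ennreal (\<bar>-1 :: real\<bar> ^ DIM('a)))"
    using lborel_affine[of "-1" "0::'a"] by simp
  then show ?thesis by (simp add: density_1)
qed

lemma lborel_distr_reflect:
  "distr lborel borel (\<lambda>x. x - (2 * x $ i) *\<^sub>R axis i 1) = (lborel :: (real^'n) measure)"
proof -
  let ?c = "\<lambda>j::real^'n. if j = axis i 1 then -1 else 1 :: real"
  have T: "0 + (\<Sum>j\<in>Basis. (?c j * (x \<bullet> j)) *\<^sub>R j) = x - (2 * x $ i) *\<^sub>R axis i 1" for x :: "real^'n"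
  proof -
    have "(\<Sum>j\<in>Basis. (?c j * (x \<bullet> j)) *\<^sub>R j) = (\<Sum>j\<in>Basis. (x \<bullet> j) *\<^sub>R j - (if j = axis i 1 then (2 * x $ i) *\<^sub>R axis i 1 else 0))"
      by (intro sum.cong) (auto simp: inner_axis scaleR_left_distrib[symmetric] simp flip: scaleR_minus_left scaleR_left_diff_distrib)
    also have "\<dots> = x - (2 * x $ i) *\<^sub>R axis i 1"
      by (simp add: sum_subtractf euclidean_representation axis_in_Basis_iff)
    finally show ?thesis by simp
  qed
  have p: "(\<Prod>j\<in>Basis. \<bar>?c j\<bar>) = 1" by (rule prod.neutral) auto
  have "(lborel :: (real^'n) measure) = density (distr lborel borel (\<lambda>x. 0 + (\<Sum>j\<in>Basis. (?c j * (x \<bullet> j)) *\<^sub>R j))) (\<lambda>_. (\<Prod>j\<in>Basis. \<bar>?c j\<bar>))"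
    by (rule lborel_affine_euclidean) auto
  then show ?thesis unfolding T p by (simp add: density_1)
qed

lemma borel_measurable_vec_lambda_permute [measurable]:
  "(\<lambda>x::real^'n. \<chi> k. x $ p k) \<in> borel_measurable borel"
  by (intro borel_measurable_continuous_onI continuous_on_vec_lambda continuous_intros)

lemma prod_Basis_cart:
  fixes x :: "real^'n"
  shows "(\<Prod>b\<in>(Basis :: (real^'n) set). x \<bullet> b) = (\<Prod>k\<in>UNIV. x $ k)"
proof -
  have B: "(Basis :: (real^'n) set) = (\<lambda>k::'n. axis k (1::real)) ` UNIV" by (auto simp: Basis_vec_def)
  have inj: "inj (\<lambda>k::'n. axis k (1::real))" by (auto simp: inj_on_def axis_eq_axis)
  have "(\<Prod>b\<in>(Basis :: (real^'n) set). x \<bullet> b) = (\<Prod>k\<in>UNIV. x \<bullet> axis k 1)"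
    by (simp only: B prod.reindex[OF inj] o_def)
  then show ?thesis by (simp add: inner_axis)
qed

text \<open>The preimage of a box is the box with permuted sides, and the product of the side
  lengths does not depend on their order; Lebesgue measure is characterised by its values on
  boxes.\<close>

lemma lborel_distr_permute:
  fixes p :: "'n::finite \<Rightarrow> 'n"
  assumes p: "bij p"
  shows "distr lborel borel (\<lambda>x. \<chi> k. x $ p k) = (lborel :: (real^'n) measure)"
proof (rule lborel_eqI[symmetric])
  fix l u :: "real^'n" assume lu: "\<And>b. b \<in> Basis \<Longrightarrow> l \<bullet> b \<le> u \<bullet> b"
  let ?q = "inv p"
  have q: "p (?q k) = k" "?q (p k) = k" for k using p by (simp_all add: bij_is_surj surj_f_inv_f bij_is_inj)
  have lu': "l $ k \<le> u $ k" for k using lu[of "axis k 1"] by (simp add: inner_axis axis_in_Basis_iff)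
  have eq: "(\<lambda>x. \<chi> k. x $ p k) -` box l u = box (\<chi> k. l $ ?q k) (\<chi> k. u $ ?q k)"
    by (auto simp: mem_box_cart) (metis q)+
  have "emeasure (distr lborel borel (\<lambda>x. \<chi> k. x $ p k)) (box l u) = emeasure lborel (box (\<chi> k. l $ ?q k) (\<chi> k. u $ ?q k))"
    by (simp add: emeasure_distr eq)
  also have "\<dots> = (\<Prod>b\<in>Basis. ((\<chi> k. u $ ?q k) - (\<chi> k. l $ ?q k)) \<bullet> b)"
    by (rule emeasure_lborel_box) (auto simp: Basis_vec_def inner_axis lu')
  also have "(\<Prod>b\<in>Basis. ((\<chi> k. u $ ?q k) - (\<chi> k. l $ ?q k)) \<bullet> b) = (\<Prod>k\<in>UNIV. u $ ?q k - l $ ?q k)"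
    by (simp add: prod_Basis_cart)
  also have "\<dots> = (\<Prod>k\<in>UNIV. u $ k - l $ k)"
    by (rule prod.reindex_bij_betw[OF bij_imp_bij_inv[OF p], of "\<lambda>k. u $ k - l $ k"])
  also have "\<dots> = (\<Prod>b\<in>Basis. (u - l) \<bullet> b)" by (simp add: prod_Basis_cart)
  finally show "emeasure (distr lborel borel (\<lambda>x. \<chi> k. x $ p k)) (box l u) = (\<Prod>b\<in>Basis. (u - l) \<bullet> b)" .
qed simp

lemma integral_lborel_invariant:
  fixes f :: "'a::euclidean_space \<Rightarrow> real"
  assumes "distr lborel borel T = lborel" "T \<in> borel_measurable borel" "f \<in> borel_measurable borel"
  shows "(LINT x|lborel. f (T x)) = (LINT x|lborel. f x)"
proof -
  have "(LINT x|lborel. f (T x)) = (LINT x|distr lborel borel T. f x)"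
    using assms by (intro integral_distr[symmetric]) auto
  then show ?thesis using assms by simp
qed

lemma integral_odd:
  fixes f :: "'a::euclidean_space \<Rightarrow> real"
  assumes [measurable]: "f \<in> borel_measurable borel" and "\<And>x. f (- x) = - f x"
  shows "(LINT x|lborel. f x) = 0"
proof -
  have "(LINT x|lborel. f (- x)) = (LINT x|lborel. f x)"
    by (rule integral_lborel_invariant[OF lborel_distr_euclidean_uminus]) auto
  then show ?thesis using assms by simp
qed

lemma norm_reflect: "norm (x - (2 * x $ i) *\<^sub>R axis i 1) = norm (x :: real^'n)"
proof -
  have "(norm (x - (2 * x $ i) *\<^sub>R axis i 1))\<^sup>2 = (norm x)\<^sup>2"
    by (simp only: power2_norm_eq_inner inner_diff_left inner_diff_right inner_scaleR_left inner_scaleR_right inner_axis_axis)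
       (simp add: inner_axis inner_axis' algebra_simps)
  then show ?thesis by simp
qed

lemma norm_permute:
  assumes "bij p" shows "norm (\<chi> k. x $ p k) = norm (x :: real^'n)"
proof -
  have "(\<Sum>k\<in>UNIV. (x $ p k)\<^sup>2) = (\<Sum>k\<in>UNIV. (x $ k)\<^sup>2)"
    using assms by (intro sum.reindex_bij_betw)
  then show ?thesis by (simp add: norm_vec_def L2_set_def)
qed

text \<open>Reflecting coordinate \<open>i\<close> changes the sign of a mixed moment, so it
  vanishes; exchanging two coordinates shows that all diagonal moments agree. Together these add up
  to the integral of \<open>norm z powr (- n)\<close> over the shell, n being the dimension, and
  each is one n-th of it.\<close>

lemma second_moment_shell:
  fixes i j :: "'n::finite"
  assumes a: "0 < a" "a < 1"
  defines "w \<equiv> \<lambda>z::real^'n. indicator {a<..<1} (norm z) * norm z powr (- (real CARD('n) + 2))"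
  shows "integrable lborel (\<lambda>z. z $ i * z $ j * w z)"
    and "(LINT z|lborel. z $ i * z $ j * w z) = (if i = j then unit_ball_vol (real CARD('n)) * ln (1 / a) else 0)"
proof -
  have [measurable]: "w \<in> borel_measurable borel" unfolding w_def by measurable
  let ?s = "\<lambda>z::real^'n. indicator {a<..<1} (norm z) * norm z powr (- real CARD('n))"
  note S = has_bochner_integral_norm_powr_shell[OF a, where 'a="real^'n", simplified]
  have ws: "(norm z)\<^sup>2 * w z = ?s z" for z :: "real^'n"
  proof (cases "norm z > a")
    case True
    then have "norm z > 0" using a by linarith
    then have "(norm z)\<^sup>2 * norm z powr (- (real CARD('n) + 2)) = norm z powr (- real CARD('n))"
      by (simp add: powr_numeral[symmetric] powr_add[symmetric] del: powr_numeral)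
    then show ?thesis by (simp add: w_def)
  qed (simp add: w_def)
  have w0: "0 \<le> w z" for z unfolding w_def by simp
  have int: "integrable lborel (\<lambda>z. z $ i * z $ j * w z)" for i j
  proof (rule Bochner_Integration.integrable_bound[OF integrable.intros[OF S]])
    show "AE z in lborel. norm (z $ i * z $ j * w z) \<le> norm (?s z)"
    proof (rule AE_I2)
      fix z :: "real^'n"
      have "\<bar>z $ i\<bar> * \<bar>z $ j\<bar> * w z \<le> norm z * norm z * w z"
        using w0 by (intro mult_right_mono mult_mono component_le_norm_cart) auto
      then have "norm (z $ i * z $ j * w z) \<le> ?s z"
        using ws[of z] w0[of z] by (simp add: abs_mult power2_eq_square)
      then show "norm (z $ i * z $ j * w z) \<le> norm (?s z)" by simp
    qed
  qed measurable
  then show "integrable lborel (\<lambda>z. z $ i * z $ j * w z)" .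
  have off: "(LINT z|lborel. z $ i * z $ j * w z) = 0" if "i \<noteq> j" for i j
  proof -
    let ?T = "\<lambda>z::real^'n. z - (2 * z $ i) *\<^sub>R axis i 1"
    have "(LINT z|lborel. ?T z $ i * ?T z $ j * w (?T z)) = (LINT z|lborel. z $ i * z $ j * w z)"
      by (rule integral_lborel_invariant[OF lborel_distr_reflect, where f = "\<lambda>z. z $ i * z $ j * w z"]) simp_all
    moreover have "?T z $ i * ?T z $ j * w (?T z) = - (z $ i * z $ j * w z)" for z
      using that by (simp only: w_def norm_reflect) (simp add: axis_def)
    ultimately show ?thesis by (simp only: Bochner_Integration.integral_minus)
  qed
  have diag: "(LINT z|lborel. z $ i * z $ i * w z) = (LINT z|lborel. z $ j * z $ j * w z)" for i j
  proof -
    define p where "p k = (if k = i then j else if k = j then i else k)" for k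
    have "p (p k) = k" for k by (cases "k = i"; cases "k = j") (simp_all add: p_def)
    then have p: "bij p" by (intro o_bij[of p p]) (simp_all add: fun_eq_iff)
    let ?T = "\<lambda>z::real^'n. \<chi> k. z $ p k"
    have "(LINT z|lborel. ?T z $ i * ?T z $ i * w (?T z)) = (LINT z|lborel. z $ i * z $ i * w z)"
      by (rule integral_lborel_invariant[OF lborel_distr_permute[OF p], where f = "\<lambda>z. z $ i * z $ i * w z"]) simp_all
    moreover have "?T z $ i * ?T z $ i * w (?T z) = z $ j * z $ j * w z" for z
      by (simp only: w_def norm_permute[OF p]) (simp add: p_def)
    ultimately show ?thesis by simp
  qed
  have "real CARD('n) * unit_ball_vol (real CARD('n)) * ln (1 / a) = (LINT z|lborel. ?s z)"
    using has_bochner_integral_integral_eq[OF S] by simp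
  also have "\<dots> = (LINT z|lborel. (\<Sum>k\<in>UNIV. z $ k * z $ k * w z))"
    by (simp only: ws[symmetric] sum_distrib_right[symmetric] power2_norm_eq_inner inner_vec_def inner_real_def)
  also have "\<dots> = (\<Sum>k\<in>UNIV. LINT z|lborel. z $ k * z $ k * w z)"
    by (rule Bochner_Integration.integral_sum) (rule int)
  also have "\<dots> = (\<Sum>k\<in>(UNIV::'n set). LINT z|lborel. z $ i * z $ i * w z)"
    by (intro sum.cong refl diag)
  finally have "(LINT z|lborel. z $ i * z $ i * w z) = unit_ball_vol (real CARD('n)) * ln (1 / a)"
    by simp
  then show "(LINT z|lborel. z $ i * z $ j * w z) = (if i = j then unit_ball_vol (real CARD('n)) * ln (1 / a) else 0)"
    using off by auto
qed


section \<open>The inversion-invariant truncation\<close>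

text \<open>The bound includes non-integrable \<open>f\<close>, whose integral is 0 by
  convention.\<close>

lemma integral_nonpos:
  fixes f :: "'a \<Rightarrow> real"
  assumes "\<And>x. f x \<le> 0" shows "(LINT x|M. f x) \<le> 0"
  using integral_nonneg_AE[where f = "\<lambda>x. - f x" and M = M] assms by simp

text \<open>The distance is compared with \<epsilon> times the geometric mean of the two norms, in
  squared form to avoid roots. On the diagonal the value is 0.\<close>

definition kern :: "real \<Rightarrow> real \<Rightarrow> 'a::euclidean_space \<Rightarrow> 'a \<Rightarrow> real" where
  "kern p \<epsilon> x y = (if \<epsilon>\<^sup>2 * (norm x * norm y) < (dist x y)\<^sup>2 then dist x y powr (- p) else 0)"

lemma kern_nonneg: "0 \<le> kern p \<epsilon> x y"
  by (simp add: kern_def)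

lemma kern_commute: "kern p \<epsilon> x y = kern p \<epsilon> y x"
  by (simp add: kern_def dist_commute mult.commute)

lemma kern_measurable [measurable]:
  assumes [measurable]: "f \<in> borel_measurable M" "g \<in> borel_measurable M"
  shows "(\<lambda>z. kern p \<epsilon> (f z) (g z)) \<in> borel_measurable M"
  unfolding kern_def by measurable

text \<open>Away from the diagonal, and with one point bounded, the kernel decays like the weight
  against which \<open>u\<close> is integrable. For D = \<open>dist x y\<close> \<ge> c the constant
  comes from 1 + |x| \<le> 1 + R + D \<le> ((1 + R) / c + 1) D.\<close>

lemma dist_powr_le_weight:
  fixes x y :: "'a::real_normed_vector"
  assumes p: "0 \<le> p" and c: "0 < c" "c \<le> dist x y" and y: "norm y \<le> R"
  shows "dist x y powr (- p) \<le> ((1 + R) / c + 1) powr p * (1 + norm x) powr (- p)"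
proof -
  let ?A = "(1 + R) / c + 1"
  have R: "0 \<le> R" using y norm_ge_zero order_trans by blast
  then have A: "0 < ?A" using c by (simp add: add_pos_pos)
  have "norm x \<le> dist x y + norm y"
    by (metis dist_0_norm dist_commute dist_triangle)
  moreover have "1 + R \<le> (1 + R) / c * dist x y"
    using c R mult_right_mono[of c "dist x y" "1 + R"] by (simp add: field_simps)
  ultimately have "1 + norm x \<le> ?A * dist x y"
    using y by (simp add: distrib_right)
  then have "(1 + norm x) / ?A \<le> dist x y"
    using A by (simp add: divide_le_eq mult.commute)
  moreover have "0 < (1 + norm x) / ?A" using A by (simp add: add_pos_nonneg)
  ultimately have "dist x y powr (- p) \<le> ((1 + norm x) / ?A) powr (- p)"
    using p by (intro powr_mono2') auto
  also have "\<dots> = ?A powr p * (1 + norm x) powr (- p)"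
    using A powr_divide[of "1 + norm x" ?A "- p"] by (simp add: powr_minus divide_inverse mult.commute)
  finally show ?thesis .
qed

text \<open>Trades the geometric mean of the norms for \<open>norm x\<close> alone, at the price of
  a factor 2, so that bounds uniform in \<open>y\<close> become possible.\<close>

lemma kern_support_dist:
  fixes x y :: "'a::euclidean_space"
  assumes \<epsilon>: "0 < \<epsilon>" "\<epsilon> \<le> 1" and K: "kern p \<epsilon> x y \<noteq> 0"
  shows "\<epsilon> * norm x / 2 \<le> dist x y"
\<comment> \<open>With \<open>norm y\<close> at least a quarter of \<open>norm x\<close>, the
  truncation gives the factor 1/2, the square root of 1/4; otherwise \<open>y\<close> is so short
  that \<open>dist x y\<close> alone is at least \<open>norm x / 2\<close>.\<close>
proof (cases "norm y \<ge> norm x / 4")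
  case True
  have "(\<epsilon> * norm x / 2)\<^sup>2 = \<epsilon>\<^sup>2 * (norm x * (norm x / 4))"
    by (simp add: power2_eq_square field_simps)
  also have "\<dots> \<le> \<epsilon>\<^sup>2 * (norm x * norm y)"
    using True by (intro mult_left_mono) auto
  also have "\<dots> < (dist x y)\<^sup>2" using K by (auto simp: kern_def split: if_splits)
  finally show ?thesis using power2_less_imp_less[of _ "dist x y"] by fastforce
next
  case False
  have "norm x \<le> dist x y + norm y"
    by (metis dist_0_norm dist_commute dist_triangle)
  then have "norm x / 2 \<le> dist x y" using False norm_ge_zero[of x] by linarith
  moreover have "\<epsilon> * norm x \<le> norm x" using \<epsilon> by (intro mult_left_le_one_le) auto
  ultimately show ?thesis by simp
qed

lemma kern_le_weight:
  fixes x y :: "'a::euclidean_space"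
  assumes p: "0 \<le> p" and \<epsilon>: "0 < \<epsilon>" "\<epsilon> \<le> 1" and a: "0 < a" "a \<le> norm x" "norm x \<le> R"
  shows "kern p \<epsilon> x y \<le> ((1 + R) / (\<epsilon> * a / 2) + 1) powr p * (1 + norm y) powr (- p)"
proof (cases "kern p \<epsilon> x y = 0")
  case False
  have "\<epsilon> * a / 2 \<le> \<epsilon> * norm x / 2" using a \<epsilon> by simp
  also have "\<dots> \<le> dist y x" using kern_support_dist[OF \<epsilon> False] by (simp add: dist_commute)
  finally have "dist y x powr (- p) \<le> ((1 + R) / (\<epsilon> * a / 2) + 1) powr p * (1 + norm y) powr (- p)"
    using p \<epsilon> a by (intro dist_powr_le_weight) auto
  then show ?thesis using False by (simp add: kern_def dist_commute split: if_splits)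
qed simp

text \<open>The sphere of inversion passes through \<open>x\<close>, so \<open>x\<close> is its own
  image and the usual distance formula for inverted points simplifies. Expanding both squares
  verifies it.\<close>

lemma dist_inversion:
  fixes x y :: "'a::real_inner"
  assumes "y \<noteq> 0"
  shows "dist x ((norm x / norm y)\<^sup>2 *\<^sub>R y) = dist x y * (norm x / norm y)"
proof -
  let ?c = "(norm x / norm y)\<^sup>2"
  have c: "?c * (norm y)\<^sup>2 = (norm x)\<^sup>2" using assms by (simp add: power_divide)
  have e: "(norm (x - t *\<^sub>R y))\<^sup>2 = (norm x)\<^sup>2 - 2 * t * (x \<bullet> y) + t * (t * (norm y)\<^sup>2)" for t
    unfolding power2_norm_eq_inner by (simp add: inner_diff_left inner_diff_right inner_commute algebra_simps)
  have "(dist x (?c *\<^sub>R y))\<^sup>2 = (norm x)\<^sup>2 - 2 * ?c * (x \<bullet> y) + ?c * (norm x)\<^sup>2"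
    unfolding dist_norm e c ..
  also have "\<dots> = ?c * ((norm y)\<^sup>2 - 2 * (x \<bullet> y) + (norm x)\<^sup>2)"
    using c by (simp add: algebra_simps)
  also have "\<dots> = (dist x y * (norm x / norm y))\<^sup>2"
  proof -
    have "(norm (x - y))\<^sup>2 = (norm y)\<^sup>2 - 2 * (x \<bullet> y) + (norm x)\<^sup>2" using e[of 1] by simp
    then show ?thesis by (simp only: dist_norm power_mult_distrib mult.commute)
  qed
  finally show ?thesis by (rule power2_eq_imp_eq) auto
qed

text \<open>Both sides of the truncating inequality are multiplied by the square of
  \<open>norm x / norm y\<close>, so the truncation is unaffected and only the power of the distance
  changes.\<close>

lemma kern_inversion:
  fixes x y :: "'a::euclidean_space"
  assumes "x \<noteq> 0" "y \<noteq> 0"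
  shows "kern p \<epsilon> x ((norm x / norm y)\<^sup>2 *\<^sub>R y) = kern p \<epsilon> x y * (norm y / norm x) powr p"
proof -
  let ?r = "norm x / norm y"
  have r: "?r > 0" using assms by simp
  have "\<epsilon>\<^sup>2 * (norm x * norm (?r\<^sup>2 *\<^sub>R y)) = ?r\<^sup>2 * (\<epsilon>\<^sup>2 * (norm x * norm y))"
    by simp
  then have "\<epsilon>\<^sup>2 * (norm x * norm (?r\<^sup>2 *\<^sub>R y)) < (dist x (?r\<^sup>2 *\<^sub>R y))\<^sup>2 \<longleftrightarrow> \<epsilon>\<^sup>2 * (norm x * norm y) < (dist x y)\<^sup>2"
    using r by (simp only: dist_inversion[OF assms(2)] power_mult_distrib mult.commute[of "(dist x y)\<^sup>2"] mult_less_cancel_left_pos zero_less_power)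
  moreover have "(dist x y * ?r) powr (- p) = dist x y powr (- p) * (norm y / norm x) powr p"
    using r assms by (simp add: powr_mult powr_divide powr_minus_divide)
  ultimately show ?thesis
    unfolding kern_def dist_inversion[OF assms(2)] by simp
qed

lemma integral_inversion:
  fixes f :: "'a::euclidean_space \<Rightarrow> real"
  assumes f: "integrable lborel f" and R: "R > 0"
  defines "F \<equiv> \<lambda>y. indicator (- cball 0 R) y * (f ((R / norm y)\<^sup>2 *\<^sub>R y) * (R / norm y) ^ (2 * DIM('a)))"
  shows "integrable lborel F" and "(LINT y|lborel. indicator (ball 0 R) y * f y) = (LINT y|lborel. F y)"
proof -
  have [measurable]: "f \<in> borel_measurable borel" using f by auto
  have [measurable]: "F \<in> borel_measurable borel" unfolding F_def by measurable
  \<comment> \<open>Instances of \<open>g\<close>: \<open>norm\<close> for integrability, the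
    identity and negation for the positive and negative parts, since \<open>ennreal\<close> sends
    negative reals to 0.\<close>
  have *: "(\<integral>\<^sup>+y. ennreal (g (f ((R / norm y)\<^sup>2 *\<^sub>R y)) * (R / norm y) ^ (2 * DIM('a)) * indicator (- cball 0 R) y) \<partial>lborel)
      = (\<integral>\<^sup>+y. ennreal (g (f y) * indicator (ball 0 R) y) \<partial>lborel)"
    if g[measurable]: "g \<in> borel_measurable borel" for g :: "real \<Rightarrow> real"
  proof -
    have "(\<integral>\<^sup>+y. ennreal (g (f y) * indicator (ball 0 R) y) \<partial>lborel) = (\<integral>\<^sup>+y. ennreal (g (f y)) * indicator (ball 0 R) y \<partial>lborel)"
      by (intro nn_integral_cong) (auto simp: indicator_def)
    also have "\<dots> = (\<integral>\<^sup>+y. ennreal (g (f ((R / norm y)\<^sup>2 *\<^sub>R y))) * ennreal ((R / norm y) ^ (2 * DIM('a))) * indicator (- cball 0 R) y \<partial>lborel)"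
      by (rule nn_integral_inversion[OF _ R]) simp
    also have "\<dots> = (\<integral>\<^sup>+y. ennreal (g (f ((R / norm y)\<^sup>2 *\<^sub>R y)) * (R / norm y) ^ (2 * DIM('a)) * indicator (- cball 0 R) y) \<partial>lborel)"
      using R by (intro nn_integral_cong) (auto simp: indicator_def ennreal_mult'')
    finally show ?thesis by simp
  qed
  have int_ball: "integrable lborel (\<lambda>y. indicator (ball 0 R) y * f y)"
    using integrable_mult_indicator[OF _ f, of "ball 0 R"] by simp
  have F_eq: "ennreal (norm (F y)) = ennreal (norm (f ((R / norm y)\<^sup>2 *\<^sub>R y)) * (R / norm y) ^ (2 * DIM('a)) * indicator (- cball 0 R) y)" for y
    using R by (simp add: F_def abs_mult indicator_def)
  have "(\<integral>\<^sup>+y. ennreal (norm (F y)) \<partial>lborel) = (\<integral>\<^sup>+y. ennreal (norm (f y) * indicator (ball 0 R) y) \<partial>lborel)"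
    unfolding F_eq by (rule *) simp
  also have "\<dots> = (\<integral>\<^sup>+y. ennreal (norm (indicator (ball 0 R) y * f y)) \<partial>lborel)"
    by (intro nn_integral_cong) (auto simp: indicator_def)
  also have "\<dots> < \<infinity>" using int_ball by (simp add: integrable_iff_bounded)
  finally show F_int: "integrable lborel F" by (intro integrableI_bounded) simp_all
  have "(\<integral>\<^sup>+y. ennreal (F y) \<partial>lborel) = (\<integral>\<^sup>+y. ennreal (indicator (ball 0 R) y * f y) \<partial>lborel)"
    using *[of "\<lambda>t. t"] by (simp add: F_def mult_ac)
  moreover have "(\<integral>\<^sup>+y. ennreal (- F y) \<partial>lborel) = (\<integral>\<^sup>+y. ennreal (- (indicator (ball 0 R) y * f y)) \<partial>lborel)"
    using *[of "\<lambda>t. - t"] by (simp add: F_def mult_ac)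
  ultimately show "(LINT y|lborel. indicator (ball 0 R) y * f y) = (LINT y|lborel. F y)"
    unfolding real_lebesgue_integral_def[OF F_int] real_lebesgue_integral_def[OF int_ball] by simp
qed

text \<open>Inversion in the sphere through x folds the integral onto the exterior of that sphere, where
  the integrand is the left-hand side of the hypothesis times the kernel.\<close>
lemma kern_integral_nonpos:
  fixes x :: "'a::euclidean_space" and u :: "real \<Rightarrow> real"
  assumes x: "x \<noteq> 0"
    and u: "\<And>r \<tau>. 0 < r \<Longrightarrow> 1 \<le> \<tau> \<Longrightarrow> u r - u (r * \<tau>) + (u r - u (r / \<tau>)) * \<tau> powr (- real (DIM('a)) + 2 * s) \<le> 0"
    and int: "integrable lborel (\<lambda>y. (u (norm x) - u (norm y)) * kern (real (DIM('a)) + 2 * s) \<epsilon> x y)"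
  shows "(LINT y|lborel. (u (norm x) - u (norm y)) * kern (real (DIM('a)) + 2 * s) \<epsilon> x y) \<le> 0"
proof -
  let ?p = "real (DIM('a)) + 2 * s" and ?R = "norm x"
  let ?f = "\<lambda>y. (u (norm x) - u (norm y)) * kern ?p \<epsilon> x y"
  let ?F = "\<lambda>y. indicator (- cball 0 ?R) y * (?f ((?R / norm y)\<^sup>2 *\<^sub>R y) * (?R / norm y) ^ (2 * DIM('a)))"
  have R: "?R > 0" using x by simp
  note inv = integral_inversion[OF int R]
  have int1: "integrable lborel (\<lambda>y. indicator (ball 0 ?R) y * ?f y)"
    using integrable_mult_indicator[OF _ int, of "ball 0 ?R"] by simp
  have int2: "integrable lborel (\<lambda>y. indicator (- cball 0 ?R) y * ?f y)"
    using integrable_mult_indicator[OF _ int, of "- cball 0 ?R"] by simp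
  \<comment> \<open>The two indicators miss the sphere \<open>norm y = norm x\<close>, but there
    \<open>?f\<close> is 0 because \<open>u\<close> takes the same value at both radii.\<close>
  have "(LINT y|lborel. ?f y) = (LINT y|lborel. indicator (ball 0 ?R) y * ?f y + indicator (- cball 0 ?R) y * ?f y)"
    by (intro Bochner_Integration.integral_cong) (auto simp: indicator_def)
  also have "\<dots> = (LINT y|lborel. ?F y) + (LINT y|lborel. indicator (- cball 0 ?R) y * ?f y)"
    by (simp only: Bochner_Integration.integral_add[OF int1 int2] inv(2))
  also have "\<dots> = (LINT y|lborel. ?F y + indicator (- cball 0 ?R) y * ?f y)"
    by (rule Bochner_Integration.integral_add[OF inv(1) int2, symmetric])
  also have "\<dots> \<le> 0"
  proof (rule integral_nonpos)
    fix y :: 'a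
    show "?F y + indicator (- cball 0 ?R) y * ?f y \<le> 0"
    proof (cases "norm y > ?R")
      case True
      define \<tau> where "\<tau> = norm y / ?R"
      have y: "y \<noteq> 0" using True by auto
      have \<tau>: "\<tau> > 1" using True R by (simp add: \<tau>_def)
      have ny: "norm y = ?R * \<tau>" using R by (simp add: \<tau>_def)
      have nI: "norm ((?R / norm y)\<^sup>2 *\<^sub>R y) = ?R / \<tau>"
        using R \<tau> unfolding norm_scaleR ny by (simp add: power2_eq_square field_simps)
      have q: "?R / norm y = 1 / \<tau>" using R \<tau> by (simp add: ny)
      \<comment> \<open>Kernel factor times Jacobian: p - 2 n = -n + 2 s.\<close>
      have J: "\<tau> powr ?p * (1 / \<tau>) ^ (2 * DIM('a)) = \<tau> powr (- real (DIM('a)) + 2 * s)"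
      proof -
        have "(1 / \<tau>) ^ (2 * DIM('a)) = \<tau> powr (- (2 * real (DIM('a))))"
          using \<tau> by (simp add: powr_minus_divide powr_realpow[symmetric] power_one_over)
        then show ?thesis by (simp add: powr_add[symmetric])
      qed
      have "?f ((?R / norm y)\<^sup>2 *\<^sub>R y) * (?R / norm y) ^ (2 * DIM('a))
          = (u ?R - u (?R / \<tau>)) * (kern ?p \<epsilon> x y * \<tau> powr ?p) * (1 / \<tau>) ^ (2 * DIM('a))"
        unfolding nI kern_inversion[OF x y] by (simp only: q \<tau>_def[symmetric])
      also have "\<dots> = kern ?p \<epsilon> x y * ((u ?R - u (?R / \<tau>)) * (\<tau> powr ?p * (1 / \<tau>) ^ (2 * DIM('a))))"
        by (simp add: mult_ac)
      finally have "?f ((?R / norm y)\<^sup>2 *\<^sub>R y) * (?R / norm y) ^ (2 * DIM('a))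
          = kern ?p \<epsilon> x y * ((u ?R - u (?R / \<tau>)) * \<tau> powr (- real (DIM('a)) + 2 * s))"
        by (simp only: J)
      then have "?F y + indicator (- cball 0 ?R) y * ?f y
        = kern ?p \<epsilon> x y * (u ?R - u (?R * \<tau>) + (u ?R - u (?R / \<tau>)) * \<tau> powr (- real (DIM('a)) + 2 * s))"
        using True ny by (simp add: indicator_def algebra_simps)
      also have "\<dots> \<le> 0"
        using u[OF R, of \<tau>] \<tau> by (intro mult_nonneg_nonpos kern_nonneg) auto
      finally show ?thesis .
    qed (simp add: indicator_def)
  qed
  finally show ?thesis .
qed

section \<open>Duality for the truncated operator\<close>

lemma integrable_tensor:
  fixes f g :: "'a::euclidean_space \<Rightarrow> real"
  assumes f: "integrable lborel f" and g: "integrable lborel g"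
  shows "integrable (lborel \<Otimes>\<^sub>M lborel) (\<lambda>z. f (fst z) * g (snd z))"
proof (rule lborel_pair.Fubini_integrable)
  have [measurable]: "f \<in> borel_measurable borel" "g \<in> borel_measurable borel" using f g by auto
  show "(\<lambda>z. f (fst z) * g (snd z)) \<in> borel_measurable (lborel \<Otimes>\<^sub>M lborel)" by measurable
  show "integrable lborel (\<lambda>x. LINT y|lborel. norm (f (fst (x, y)) * g (snd (x, y))))"
    using f g by (simp add: abs_mult)
  show "AE x in lborel. integrable lborel (\<lambda>y. f (fst (x, y)) * g (snd (x, y)))"
    using g by simp
qed

definition trunc_kern :: "real \<Rightarrow> real \<Rightarrow> ('a::euclidean_space \<Rightarrow> real) \<Rightarrow> 'a \<Rightarrow> real" where
  "trunc_kern p \<epsilon> h x = (LINT y|lborel. (h x - h y) * kern p \<epsilon> x y)"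

text \<open>With the singularity removed, the terms with \<open>h x\<close> and with
  \<open>h y\<close> are integrable separately over pairs, so Fubini applies to each, and the
  symmetry of \<open>kern\<close> exchanges the variables in the second. The dominating functions
  are tensor products, because the kernel decays like the weight of \<open>v\<close> once the other
  variable lies in the support of \<open>h\<close>.\<close>

lemma trunc_kern_duality:
  fixes v h :: "'a::euclidean_space \<Rightarrow> real"
  assumes p: "real (DIM('a)) < p" and \<epsilon>: "0 < \<epsilon>" "\<epsilon> \<le> 1"
    and a: "0 < a" and supp: "\<And>y. h y \<noteq> 0 \<Longrightarrow> a \<le> norm y \<and> norm y \<le> R"
    and [measurable]: "v \<in> borel_measurable borel" "h \<in> borel_measurable borel"
    and C: "\<And>y. \<bar>h y\<bar> \<le> C"
    and v: "integrable lborel (\<lambda>x. v x * (1 + norm x) powr (- p))"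
    and W: "integrable lborel (\<lambda>x::'a. (1 + norm x) powr (- p))"
  shows "integrable lborel (\<lambda>x. v x * trunc_kern p \<epsilon> h x)"
    and "(LINT x|lborel. v x * trunc_kern p \<epsilon> h x) = (LINT x|lborel. h x * (LINT y|lborel. (v x - v y) * kern p \<epsilon> x y))"
proof -
  let ?K = "kern p \<epsilon> :: 'a \<Rightarrow> 'a \<Rightarrow> real" and ?W = "\<lambda>x::'a. (1 + norm x) powr (- p)"
  let ?c = "((1 + R) / (\<epsilon> * a / 2) + 1) powr p"
  have p0: "0 \<le> p" using p by (smt (verit) of_nat_0_le_iff)
  have K: "?K x y \<le> ?c * ?W y" if "h x \<noteq> 0" for x y
    using kern_le_weight[OF p0 \<epsilon> a] supp[OF that] by blast
  have C0: "0 \<le> C" using C[of 0] by (meson abs_ge_zero order_trans)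
  \<comment> \<open>On the support of \<open>h\<close> the weight \<open>?W\<close> is at least
    \<open>(1 + R) powr (- p)\<close>, so integrability of \<open>v\<close> against
    \<open>?W\<close> is enough.\<close>
  have hv: "integrable lborel (\<lambda>x. v x * h x)"
  proof (rule Bochner_Integration.integrable_bound)
    show "integrable lborel (\<lambda>x. (C * (1 + R) powr p) * (v x * ?W x))" using v by simp
    show "AE x in lborel. norm (v x * h x) \<le> norm ((C * (1 + R) powr p) * (v x * ?W x))"
    proof (rule AE_I2)
      fix x
      show "norm (v x * h x) \<le> norm ((C * (1 + R) powr p) * (v x * ?W x))"
      proof (cases "h x = 0")
        case False
        then have xR: "norm x \<le> R" using supp by blast
        then have "(1 + norm x) powr p \<le> (1 + R) powr p" using p0 by (intro powr_mono2) auto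
        then have "1 \<le> (1 + R) powr p * ?W x"
          using powr_gt_zero[of "1 + norm x" p] norm_ge_zero[of x]
          by (simp add: powr_minus_divide le_divide_eq del: norm_ge_zero)
        then have "\<bar>h x\<bar> * 1 \<le> C * ((1 + R) powr p * ?W x)" using C C0 by (intro mult_mono) auto
        then have "\<bar>v x\<bar> * \<bar>h x\<bar> \<le> \<bar>v x\<bar> * (C * ((1 + R) powr p * ?W x))" by (intro mult_left_mono) auto
        then show ?thesis using C0 by (simp add: abs_mult mult_ac)
      qed simp
    qed
  qed simp
  have h: "integrable lborel h"
  proof (rule Bochner_Integration.integrable_bound)
    show "integrable lborel (\<lambda>x::'a. C * indicator (cball 0 R) x)"
      by (intro integrable_mult_right integrable_real_indicator)
         (use emeasure_bounded_finite[of "cball (0::'a) R"] in auto)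
    show "AE x in lborel. norm (h x) \<le> norm (C * indicator (cball 0 R) x :: real)"
    proof (rule AE_I2)
      fix x show "norm (h x) \<le> norm (C * indicator (cball 0 R) x :: real)"
        using C[of x] C0 supp[of x] by (cases "h x = 0") (auto simp: indicator_def)
    qed
  qed simp
  have P: "integrable (lborel \<Otimes>\<^sub>M lborel) (\<lambda>z. v (fst z) * h (fst z) * ?K (fst z) (snd z))" (is "integrable _ ?P")
  proof (rule Bochner_Integration.integrable_bound)
    show "integrable (lborel \<Otimes>\<^sub>M lborel) (\<lambda>z. ?c * ((v (fst z) * h (fst z)) * ?W (snd z)))"
      by (intro integrable_mult_right integrable_tensor[OF hv W])
    show "AE z in lborel \<Otimes>\<^sub>M lborel. norm (?P z) \<le> norm (?c * ((v (fst z) * h (fst z)) * ?W (snd z)))"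
    proof (rule AE_I2)
      fix z :: "'a \<times> 'a"
      show "norm (?P z) \<le> norm (?c * ((v (fst z) * h (fst z)) * ?W (snd z)))"
      proof (cases "h (fst z) = 0")
        case False
        then have "\<bar>v (fst z) * h (fst z)\<bar> * ?K (fst z) (snd z) \<le> \<bar>v (fst z) * h (fst z)\<bar> * (?c * ?W (snd z))"
          by (intro mult_left_mono K) auto
        then show ?thesis by (simp add: abs_mult kern_nonneg mult_ac)
      qed simp
    qed
  qed simp
  \<comment> \<open>The variable in the support of \<open>h\<close> is now the second one, so the
    kernel bound is used with its arguments exchanged and the decay benefits
    \<open>v\<close>.\<close>
  have Q: "integrable (lborel \<Otimes>\<^sub>M lborel) (\<lambda>z. v (fst z) * h (snd z) * ?K (fst z) (snd z))" (is "integrable _ ?Q")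
  proof (rule Bochner_Integration.integrable_bound)
    show "integrable (lborel \<Otimes>\<^sub>M lborel) (\<lambda>z. ?c * ((v (fst z) * ?W (fst z)) * h (snd z)))"
      by (intro integrable_mult_right integrable_tensor[OF v h])
    show "AE z in lborel \<Otimes>\<^sub>M lborel. norm (?Q z) \<le> norm (?c * ((v (fst z) * ?W (fst z)) * h (snd z)))"
    proof (rule AE_I2)
      fix z :: "'a \<times> 'a"
      show "norm (?Q z) \<le> norm (?c * ((v (fst z) * ?W (fst z)) * h (snd z)))"
      proof (cases "h (snd z) = 0")
        case False
        then have "\<bar>v (fst z) * h (snd z)\<bar> * ?K (snd z) (fst z) \<le> \<bar>v (fst z) * h (snd z)\<bar> * (?c * ?W (fst z))"
          by (intro mult_left_mono K) auto
        then show ?thesis by (simp add: abs_mult kern_nonneg mult_ac kern_commute[of _ _ "fst z"])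
      qed simp
    qed
  qed simp
  have Q': "integrable (lborel \<Otimes>\<^sub>M lborel) (\<lambda>z. v (snd z) * h (fst z) * ?K (fst z) (snd z))" (is "integrable _ ?Q'")
    using lborel_pair.integrable_product_swap[OF Q] by (simp add: case_prod_beta' kern_commute[of _ _ "snd _"])
  have swap: "(LINT z|(lborel \<Otimes>\<^sub>M lborel). ?Q' z) = (LINT z|(lborel \<Otimes>\<^sub>M lborel). ?Q z)"
    using lborel_pair.integral_product_swap[of ?Q] Q by (simp add: case_prod_beta' kern_commute[of _ _ "snd _"] borel_measurable_integrable)
  have L: "v x * trunc_kern p \<epsilon> h x = (LINT y|lborel. ?P (x, y) - ?Q (x, y))" for x
    unfolding trunc_kern_def by (subst integral_mult_right_zero[symmetric]) (simp add: algebra_simps)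
  have PQ: "integrable (lborel \<Otimes>\<^sub>M lborel) (\<lambda>z. ?P z - ?Q z)" using P Q by (rule Bochner_Integration.integrable_diff)
  have PQ': "integrable (lborel \<Otimes>\<^sub>M lborel) (\<lambda>z. ?P z - ?Q' z)" using P Q' by (rule Bochner_Integration.integrable_diff)
  show "integrable lborel (\<lambda>x. v x * trunc_kern p \<epsilon> h x)"
    unfolding L using lborel_pair.integrable_fst'[OF PQ] by simp
  have R: "h x * (LINT y|lborel. (v x - v y) * ?K x y) = (LINT y|lborel. ?P (x, y) - ?Q' (x, y))" for x
    by (subst integral_mult_right_zero[symmetric]) (simp add: algebra_simps)
  have "(LINT x|lborel. v x * trunc_kern p \<epsilon> h x) = (LINT z|(lborel \<Otimes>\<^sub>M lborel). ?P z - ?Q z)"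
    unfolding L using lborel_pair.integral_fst'[OF PQ] by simp
  also have "\<dots> = (LINT z|(lborel \<Otimes>\<^sub>M lborel). ?P z - ?Q' z)"
    unfolding Bochner_Integration.integral_diff[OF P Q] Bochner_Integration.integral_diff[OF P Q'] swap ..
  also have "\<dots> = (LINT x|lborel. h x * (LINT y|lborel. (v x - v y) * ?K x y))"
    unfolding R using lborel_pair.integral_fst'[OF PQ'] by simp
  finally show "(LINT x|lborel. v x * trunc_kern p \<epsilon> h x) = (LINT x|lborel. h x * (LINT y|lborel. (v x - v y) * kern p \<epsilon> x y))" .
qed


section \<open>Comparison with the principal value\<close>

lemma integrable_mult_bounded:
  fixes f g :: "'a \<Rightarrow> real"
  assumes f: "integrable M f" and [measurable]: "g \<in> borel_measurable M" and g: "\<And>x. \<bar>g x\<bar> \<le> C"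
  shows "integrable M (\<lambda>x. f x * g x)"
proof (rule Bochner_Integration.integrable_bound)
  show "integrable M (\<lambda>x. f x * C)" using f by simp
  show "AE x in M. norm (f x * g x) \<le> norm (f x * C)"
    by (rule AE_I2) (auto simp: abs_mult intro!: mult_left_mono order_trans[OF g abs_ge_self])
qed (use f in measurable)

lemma norm_integral_le:
  fixes f g :: "'a \<Rightarrow> real"
  assumes "integrable M f" "integrable M g" "\<And>x. norm (f x) \<le> g x"
  shows "norm (LINT x|M. f x) \<le> (LINT x|M. g x)"
  using assms by (intro order_trans[OF integral_norm_bound Bochner_Integration.integral_mono]) auto

lemma powr_neg_mult_power: "0 < r \<Longrightarrow> r powr (- p) * (c * r ^ k) = c * r powr (real k - p)"
  for r :: real
  by (simp add: powr_diff powr_minus_divide powr_realpow)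

text \<open>For p = n + 2 s this is the integral under the limit in \<open>frac_lap\<close>.\<close>

definition trunc_ball :: "real \<Rightarrow> real \<Rightarrow> ('a::euclidean_space \<Rightarrow> real) \<Rightarrow> 'a \<Rightarrow> real" where
  "trunc_ball p \<delta> h x = (LINT y|lborel. indicator {\<delta><..} (dist x y) * dist x y powr (- p) * (h x - h y))"

lemma integral_translate:
  fixes f :: "'a::euclidean_space \<Rightarrow> real"
  assumes [measurable]: "f \<in> borel_measurable borel"
  shows "(LINT y|lborel. f y) = (LINT z|lborel. f (x + z))"
proof -
  have "distr lborel borel (\<lambda>z. x + z) = (lborel :: 'a measure)" by (rule lborel_distr_plus)
  then show ?thesis by (intro integral_lborel_invariant[symmetric]) simp_all
qed

lemma integrable_translate:
  fixes f :: "'a::euclidean_space \<Rightarrow> real"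
  assumes f: "integrable lborel f"
  shows "integrable lborel (\<lambda>y. f (y - x))"
proof -
  have "distr lborel borel (\<lambda>z. - x + z) = (lborel :: 'a measure)" by (rule lborel_distr_plus)
  then have "integrable (distr lborel borel (\<lambda>z. - x + z)) f" using f by simp
  then show ?thesis
    by (subst (asm) integrable_distr_eq) (use f in auto)
qed

text \<open>The added first-order term is odd in z, so it does not change the integral but makes the
  integrand quadratically small near 0.\<close>
lemma trunc_ball_corrected:
  fixes h :: "real^'n \<Rightarrow> real" and x :: "real^'n" and c :: "'n \<Rightarrow> real"
  assumes p: "real CARD('n) < p" and \<delta>: "0 < \<delta>" "\<delta> < 1"
    and [measurable]: "h \<in> borel_measurable borel" and C: "\<And>y. \<bar>h y\<bar> \<le> C"
  defines "F \<equiv> \<lambda>z. indicator {\<delta><..} (norm z) * norm z powr (- p) *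
        (h x - h (x + z) + indicator {..<1} (norm z) * (\<Sum>i\<in>UNIV. z $ i * c i))"
  shows "integrable lborel F" and "trunc_ball p \<delta> h x = (LINT z|lborel. F z)"
proof -
  let ?T = "\<lambda>z::real^'n. indicator {\<delta><..} (norm z) * norm z powr (- p)"
  \<comment> \<open>The cut-off at radius 1 is there for infinity: a linear term against
    \<open>norm z powr (- p)\<close> is not absolutely integrable there when p \<le> n + 1, that is
    for s \<le> 1/2.\<close>
  let ?o = "\<lambda>z. indicator {..<1} (norm z) * (\<Sum>i\<in>UNIV. z $ i * c i)"
  have T: "integrable lborel ?T" using p \<delta> by (intro integrable_norm_powr_tail) auto
  have i1: "integrable lborel (\<lambda>z. ?T z * (h x - h (x + z)))"
  proof (rule integrable_mult_bounded[OF T])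
    show "\<bar>h x - h (x + z)\<bar> \<le> 2 * C" for z using C[of x] C[of "x + z"] by linarith
  qed measurable
  have i2: "integrable lborel (\<lambda>z. ?T z * ?o z)"
  proof (rule integrable_mult_bounded[OF T])
    fix z :: "real^'n"
    show "\<bar>?o z\<bar> \<le> (\<Sum>i\<in>UNIV. \<bar>c i\<bar>)"
    proof (cases "norm z < 1")
      case True
      have "\<bar>\<Sum>i\<in>UNIV. z $ i * c i\<bar> \<le> (\<Sum>i\<in>UNIV. \<bar>c i\<bar>)"
      proof (rule order_trans[OF sum_abs sum_mono])
        fix i
        have "\<bar>z $ i\<bar> \<le> 1" using component_le_norm_cart[of z i] True by linarith
        then show "\<bar>z $ i * c i\<bar> \<le> \<bar>c i\<bar>" by (simp add: abs_mult mult_left_le_one_le)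
      qed
      then show ?thesis using True by simp
    qed (simp add: sum_nonneg)
  qed measurable
  have F: "F = (\<lambda>z. ?T z * (h x - h (x + z)) + ?T z * ?o z)"
    by (simp add: F_def fun_eq_iff distrib_left)
  show "integrable lborel F" unfolding F by (intro Bochner_Integration.integrable_add i1 i2)
  have "(LINT z|lborel. ?T z * ?o z) = 0"
    by (rule integral_odd) (simp_all add: sum_negf)
  then have "(LINT z|lborel. F z) = (LINT z|lborel. ?T z * (h x - h (x + z)))"
    unfolding F Bochner_Integration.integral_add[OF i1 i2] by simp
  also have "\<dots> = trunc_ball p \<delta> h x"
    unfolding trunc_ball_def by (subst integral_translate[where x = x]) (simp_all add: dist_norm)
  finally show "trunc_ball p \<delta> h x = (LINT z|lborel. F z)" ..
qed

lemma test_fn_measurable: "test_fn \<Omega> h \<Longrightarrow> h \<in> borel_measurable borel"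
  unfolding test_fn_def by (intro borel_measurable_continuous_onI smooth_fn_continuous) auto

text \<open>The limit is the corrected integral without any truncation, which the quadratic
  remainder makes absolutely convergent. The difference is an integral over the ball of radius
  \<delta> of at most \<open>C2 * norm z powr (2 - p)\<close>; this gives the rate, uniformly in
  \<open>x\<close>.\<close>

lemma trunc_ball_limit:
  fixes h :: "real^'n \<Rightarrow> real"
  assumes h: "test_fn \<Omega> h" and p: "real CARD('n) < p" "p < real CARD('n) + 2"
  obtains l C where "C > 0" "\<And>x \<delta>. 0 < \<delta> \<Longrightarrow> \<delta> < 1 \<Longrightarrow> \<bar>trunc_ball p \<delta> h x - l x\<bar> \<le> C * \<delta> powr (real CARD('n) + 2 - p)"
proof -
  obtain C0 where C0: "C0 > 0" "\<And>x. \<bar>h x\<bar> \<le> C0" using test_fn_bounded[OF h] by blast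
  obtain C2 where C2: "C2 > 0" "\<And>x z. \<bar>h (x + z) - h x - (\<Sum>i\<in>UNIV. z $ i * partial_dir i h x)\<bar> \<le> C2 * norm z ^ 2"
    using test_fn_taylor2[OF h] by blast
  note [measurable] = test_fn_measurable[OF h]
  let ?E = "\<lambda>x z. h x - h (x + z) + indicator {..<1} (norm z) * (\<Sum>i\<in>UNIV. z $ i * partial_dir i h x)"
  let ?G = "\<lambda>x z. norm z powr (- p) * ?E x z"
  let ?near = "\<lambda>\<delta> z::real^'n. indicator {0<..\<delta>} (norm z) * norm z powr (2 - p)"
  \<comment> \<open>Any threshold below 1 would do: the strict inequality of the indicator must
    still cover \<open>norm z = 1\<close>.\<close>
  let ?far = "\<lambda>z::real^'n. indicator {1/2<..} (norm z) * norm z powr (- p)"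
  let ?e = "real CARD('n) + 2 - p"
  let ?A = "real CARD('n) * unit_ball_vol (real CARD('n))"
  have near: "has_bochner_integral lborel (?near \<delta>) (?A * (\<delta> powr ?e / ?e))" if "\<delta> > 0" for \<delta>
    using has_bochner_integral_norm_powr_ball[where 'a = "real^'n" and e = "2 - p" and a = \<delta>] p that
    by (simp add: algebra_simps)
  have far: "integrable lborel ?far" using p by (intro integrable_norm_powr_tail) auto
  have Gnear: "\<bar>?G x z\<bar> \<le> C2 * ?near \<delta> z" if z: "norm z \<le> \<delta>" "norm z < 1" for x z \<delta>
  proof (cases "z = 0")
    case False
    have "\<bar>?E x z\<bar> \<le> C2 * norm z ^ 2" using C2(2)[of x z] z by simp
    then have "norm z powr (- p) * \<bar>?E x z\<bar> \<le> norm z powr (- p) * (C2 * norm z ^ 2)"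
      by (intro mult_left_mono) auto
    also have "\<dots> = C2 * norm z powr (2 - p)"
      using False powr_neg_mult_power[of "norm z" p C2 2] by simp
    finally show ?thesis using False z by (simp add: abs_mult)
  qed simp
  have Gfar: "\<bar>?G x z\<bar> \<le> 2 * C0 * ?far z" if z: "norm z \<ge> 1" for x z
  proof -
    have "\<bar>?E x z\<bar> \<le> 2 * C0" using C0(2)[of x] C0(2)[of "x + z"] z by simp
    then have "norm z powr (- p) * \<bar>?E x z\<bar> \<le> norm z powr (- p) * (2 * C0)"
      by (intro mult_left_mono) auto
    then show ?thesis using z by (simp add: abs_mult mult_ac)
  qed
  have G: "integrable lborel (?G x)" for x
  proof (rule Bochner_Integration.integrable_bound)
    show "integrable lborel (\<lambda>z. C2 * ?near 1 z + 2 * C0 * ?far z)"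
      by (intro Bochner_Integration.integrable_add integrable_mult_right far integrable.intros[OF near]) simp
    have 0: "0 \<le> C2 * ?near 1 z" "0 \<le> 2 * C0 * ?far z" for z using C0 C2 by simp_all
    show "AE z in lborel. norm (?G x z) \<le> norm (C2 * ?near 1 z + 2 * C0 * ?far z)"
    proof (rule AE_I2)
      fix z
      have "\<bar>?G x z\<bar> \<le> C2 * ?near 1 z + 2 * C0 * ?far z"
      proof (cases "norm z < 1")
        case True
        then show ?thesis using Gnear[of z 1 x] 0(2)[of z] by linarith
      next
        case False
        then show ?thesis using Gfar[of z x] 0(1)[of z] by linarith
      qed
      then show "norm (?G x z) \<le> norm (C2 * ?near 1 z + 2 * C0 * ?far z)" by simp
    qed
  qed measurable
  have main: "\<bar>trunc_ball p \<delta> h x - (LINT z|lborel. ?G x z)\<bar> \<le> (C2 * (?A / ?e)) * \<delta> powr ?e"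
    if \<delta>: "0 < \<delta>" "\<delta> < 1" for x \<delta>
  proof -
    note t = trunc_ball_corrected[OF p(1) \<delta> _ C0(2), where c = "\<lambda>i. partial_dir i h x" and x = x, OF test_fn_measurable[OF h]]
    have eq: "(LINT z|lborel. ?G x z) - trunc_ball p \<delta> h x
       = (LINT z|lborel. ?G x z - indicator {\<delta><..} (norm z) * norm z powr (- p) * ?E x z)"
      unfolding t(2) by (rule Bochner_Integration.integral_diff[symmetric, OF G t(1)])
    have "norm ((LINT z|lborel. ?G x z) - trunc_ball p \<delta> h x) \<le> (LINT z|lborel. C2 * ?near \<delta> z)"
      unfolding eq
    proof (rule norm_integral_le)
      show "integrable lborel (\<lambda>z. ?G x z - indicator {\<delta><..} (norm z) * norm z powr (- p) * ?E x z)"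
        by (rule Bochner_Integration.integrable_diff[OF G t(1)])
      show "integrable lborel (\<lambda>z. C2 * ?near \<delta> z)"
        by (intro integrable_mult_right integrable.intros[OF near] \<delta>)
      fix z
      show "norm (?G x z - indicator {\<delta><..} (norm z) * norm z powr (- p) * ?E x z) \<le> C2 * ?near \<delta> z"
      proof (cases "norm z \<le> \<delta>")
        case True
        then have "indicator {\<delta><..} (norm z) = (0::real)" by simp
        moreover have "\<bar>?G x z\<bar> \<le> C2 * ?near \<delta> z" using True \<delta> by (intro Gnear) auto
        ultimately show ?thesis by (simp only: mult_zero_left diff_0_right real_norm_def)
      next
        case False
        then have "indicator {\<delta><..} (norm z) = (1::real)" by simp
        moreover have "0 \<le> C2 * ?near \<delta> z" using C2(1) by simp
        ultimately show ?thesis by (simp only: mult_1 diff_self norm_zero)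
      qed
    qed
    also have "\<dots> = (C2 * (?A / ?e)) * \<delta> powr ?e"
      by (simp only: integral_mult_right_zero has_bochner_integral_integral_eq[OF near[OF \<delta>(1)]] divide_inverse mult_ac)
    finally show ?thesis by (simp only: real_norm_def abs_minus_commute)
  qed
  have "C2 * (?A / ?e) > 0" using C2 p by simp
  then show thesis using main by (rule that)
qed

text \<open>Once the odd term is removed, the expansion of \<open>h x - h (x + z)\<close> starts
  with minus half the Hessian form. Integrated over the shell between \<delta> and 1, only its trace
  survives by \<open>second_moment_shell\<close>, which yields the logarithm times the Laplacian.
  What remains is cubic near 0 and bounded far away, hence integrable with a bound independent of
  \<delta> and \<open>x\<close>.\<close>

lemma trunc_ball_log_asymptotics:
  fixes h :: "real^'n \<Rightarrow> real"
  assumes h: "test_fn \<Omega> h"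
  obtains C where "C > 0" "\<And>x \<delta>. 0 < \<delta> \<Longrightarrow> \<delta> < 1 \<Longrightarrow>
    \<bar>trunc_ball (real CARD('n) + 2) \<delta> h x + unit_ball_vol (real CARD('n)) / 2 * ln (1 / \<delta>) * laplacian h x\<bar> \<le> C"
proof -
  let ?p = "real CARD('n) + 2"
  obtain C0 where C0: "C0 > 0" "\<And>x. \<bar>h x\<bar> \<le> C0" using test_fn_bounded[OF h] by blast
  obtain C3 where C3: "C3 > 0" "\<And>x z. \<bar>h (x + z) - h x - (\<Sum>i\<in>UNIV. z $ i * partial_dir i h x)
     - (\<Sum>i\<in>UNIV. \<Sum>j\<in>UNIV. z $ i * z $ j * partial_dir j (partial_dir i h) x) / 2\<bar> \<le> C3 * norm z ^ 3"
    using test_fn_taylor3[OF h] by blast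
  note [measurable] = test_fn_measurable[OF h]
  let ?E = "\<lambda>x z. h x - h (x + z) + indicator {..<1} (norm z) * (\<Sum>i\<in>UNIV. z $ i * partial_dir i h x)"
  let ?H = "\<lambda>x z. (\<Sum>i\<in>UNIV. \<Sum>j\<in>UNIV. z $ i * z $ j * partial_dir j (partial_dir i h) x) / 2"
  \<comment> \<open>The cubic remainder against the kernel: the exponent is 1 - n for dimension n,
    above the critical value -n.\<close>
  let ?near = "\<lambda>z::real^'n. indicator {0<..1} (norm z) * norm z powr (3 - ?p)"
  let ?far = "\<lambda>z::real^'n. indicator {1/2<..} (norm z) * norm z powr (- ?p)"
  have near: "integrable lborel ?near"
    using has_bochner_integral_norm_powr_ball[where 'a = "real^'n" and e = "3 - ?p" and a = 1]
    by (auto intro: integrable.intros)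
  have far: "integrable lborel ?far" by (intro integrable_norm_powr_tail) auto
  let ?B = "\<lambda>z. C3 * ?near z + 2 * C0 * ?far z"
  have B: "integrable lborel ?B" by (intro Bochner_Integration.integrable_add integrable_mult_right near far)
  have B0: "0 \<le> C3 * ?near z" "0 \<le> 2 * C0 * ?far z" for z using C0 C3 by simp_all
  have main: "\<bar>trunc_ball ?p \<delta> h x + unit_ball_vol (real CARD('n)) / 2 * ln (1 / \<delta>) * laplacian h x\<bar>
     \<le> (LINT z|lborel. ?B z)" if \<delta>: "0 < \<delta>" "\<delta> < 1" for x \<delta>
  proof -
    let ?T = "\<lambda>z::real^'n. indicator {\<delta><..} (norm z) * norm z powr (- ?p)"
    let ?w = "\<lambda>z::real^'n. indicator {\<delta><..<1} (norm z) * norm z powr (- ?p)"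
    have pp: "real CARD('n) < ?p" by simp
    note t = trunc_ball_corrected[OF pp \<delta> _ C0(2), where c = "\<lambda>i. partial_dir i h x" and x = x, OF test_fn_measurable[OF h]]
    note m = second_moment_shell[OF \<delta>, where 'n = 'n]
    \<comment> \<open>Half the Hessian form on the shell, with the coefficients pulled out so that
      every term is a second moment.\<close>
    let ?S = "\<lambda>z. \<Sum>i\<in>UNIV. \<Sum>j\<in>UNIV. (partial_dir j (partial_dir i h) x / 2) * (z $ i * z $ j * ?w z)"
    have S_int: "integrable lborel ?S"
      by (intro Bochner_Integration.integrable_sum integrable_mult_right m(1))
    have "(LINT z|lborel. ?S z) = (\<Sum>i\<in>UNIV. (LINT z|lborel. (\<Sum>j\<in>UNIV. (partial_dir j (partial_dir i h) x / 2) * (z $ i * z $ j * ?w z))))"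
      by (rule Bochner_Integration.integral_sum) (intro Bochner_Integration.integrable_sum integrable_mult_right m(1))
    also have "\<dots> = (\<Sum>i\<in>UNIV. \<Sum>j\<in>UNIV. (LINT z|lborel. (partial_dir j (partial_dir i h) x / 2) * (z $ i * z $ j * ?w z)))"
      by (intro sum.cong refl Bochner_Integration.integral_sum integrable_mult_right m(1))
    also have "\<dots> = (\<Sum>i\<in>UNIV. \<Sum>j\<in>UNIV. partial_dir j (partial_dir i h) x / 2 * (if i = j then unit_ball_vol (real CARD('n)) * ln (1 / \<delta>) else 0))"
      by (simp only: integral_mult_right_zero m(2))
    also have "\<dots> = unit_ball_vol (real CARD('n)) / 2 * ln (1 / \<delta>) * laplacian h x"
      by (simp add: laplacian_def sum_distrib_left sum_distrib_right if_distrib[of "\<lambda>t. _ * t"] mult_ac cong: if_cong)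
    finally have S: "(LINT z|lborel. ?S z) = unit_ball_vol (real CARD('n)) / 2 * ln (1 / \<delta>) * laplacian h x" .
    have S_eq: "?S z = ?w z * ?H x z" for z
      by (simp add: sum_distrib_left sum_divide_distrib mult_ac)
    have eq: "trunc_ball ?p \<delta> h x + unit_ball_vol (real CARD('n)) / 2 * ln (1 / \<delta>) * laplacian h x
       = (LINT z|lborel. ?T z * ?E x z + ?S z)"
      unfolding t(2) S[symmetric] by (rule Bochner_Integration.integral_add[symmetric, OF t(1) S_int])
    have "norm (trunc_ball ?p \<delta> h x + unit_ball_vol (real CARD('n)) / 2 * ln (1 / \<delta>) * laplacian h x) \<le> (LINT z|lborel. ?B z)"
      unfolding eq
    proof (rule norm_integral_le[OF _ B])
      show "integrable lborel (\<lambda>z. ?T z * ?E x z + ?S z)"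
        by (rule Bochner_Integration.integrable_add[OF t(1) S_int])
      fix z
      show "norm (?T z * ?E x z + ?S z) \<le> ?B z"
      proof (cases "norm z < 1")
        case True
        show ?thesis
        proof (cases "norm z > \<delta>")
          case z: True
          then have z0: "z \<noteq> 0" using \<delta> by auto
          have "?T z * ?E x z + ?S z = norm z powr (- ?p) * (h x - h (x + z) + (\<Sum>i\<in>UNIV. z $ i * partial_dir i h x) + ?H x z)"
            unfolding S_eq using True z by (simp add: algebra_simps)
          also have "\<bar>\<dots>\<bar> \<le> norm z powr (- ?p) * (C3 * norm z ^ 3)"
            using C3(2)[of x z] by (simp only: abs_mult abs_of_nonneg[OF powr_ge_zero]) (intro mult_left_mono, linarith, simp)
          also have "\<dots> = C3 * norm z powr (3 - ?p)"
            using z0 powr_neg_mult_power[of "norm z" ?p C3 3] by simp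
          finally show ?thesis using z0 True B0[of z] by simp
        next
          case False
          then have "?T z * ?E x z + ?S z = 0" unfolding S_eq by simp
          then show ?thesis using B0[of z] by simp
        qed
      next
        case False
        have "?T z * ?E x z + ?S z = norm z powr (- ?p) * (h x - h (x + z))"
          unfolding S_eq using False \<delta> by simp
        also have "\<bar>\<dots>\<bar> \<le> norm z powr (- ?p) * (2 * C0)"
          using C0(2)[of x] C0(2)[of "x + z"] by (simp only: abs_mult abs_of_nonneg[OF powr_ge_zero]) (intro mult_left_mono, linarith, simp)
        also have "\<dots> = 2 * C0 * ?far z" using False by simp
        finally show ?thesis using B0[of z] by simp
      qed
    qed
    then show ?thesis by (simp only: real_norm_def)
  qed
  have "0 \<le> (LINT z|lborel. ?B z)" using B0 by (intro integral_nonneg_AE AE_I2 add_nonneg_nonneg)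
  \<comment> \<open>Adding 1 makes the constant strictly positive.\<close>
  then have pos: "0 < (LINT z|lborel. ?B z) + 1" by linarith
  show thesis
  proof (rule that[OF pos])
    fix x :: "real^'n" and \<delta> :: real assume \<delta>: "0 < \<delta>" "\<delta> < 1"
    show "\<bar>trunc_ball ?p \<delta> h x + unit_ball_vol (real CARD('n)) / 2 * ln (1 / \<delta>) * laplacian h x\<bar> \<le> (LINT z|lborel. ?B z) + 1"
      by (rule order_trans[OF main[OF \<delta>]]) simp
  qed
qed

section \<open>Comparison of the two truncations\<close>

text \<open>Put d = \<epsilon> |x| and D = |x - y|. Since |y| differs from |x| by at most D, the
  threshold for D^2 lies between d^2 - \<epsilon> d D and d^2 + \<epsilon> d D, so a disagreement
  with the test D > d forces D to be within \<epsilon> d of d.\<close>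

lemma truncations_differ_shell:
  fixes x y :: "'a::euclidean_space"
  assumes \<epsilon>: "0 < \<epsilon>" "\<epsilon> \<le> 1" and x: "x \<noteq> 0"
    and diff: "(\<epsilon>\<^sup>2 * (norm x * norm y) < (dist x y)\<^sup>2) \<noteq> (\<epsilon> * norm x < dist x y)"
  shows "\<epsilon> * norm x * (1 - \<epsilon>) \<le> dist x y" "dist x y \<le> \<epsilon> * norm x * (1 + \<epsilon>)"
proof -
  define D where "D = dist x y"
  define d where "d = \<epsilon> * norm x"
  have d: "d > 0" using \<epsilon> x by (simp add: d_def)
  have D0: "0 \<le> D" by (simp add: D_def)
  have y: "norm y \<le> norm x + D" "norm x - D \<le> norm y"
    unfolding D_def dist_norm using norm_triangle_sub[of y x] norm_triangle_ineq2[of x y] by (auto simp: norm_minus_commute)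
  have sq: "\<epsilon>\<^sup>2 * (norm x * (norm x + t)) = d * d + \<epsilon> * d * t" for t
    by (simp add: d_def power2_eq_square algebra_simps)
  have "d * (1 - \<epsilon>) \<le> D \<and> D \<le> d * (1 + \<epsilon>)"
  proof (cases "d < D")
    case True
    then have le: "D * D \<le> \<epsilon>\<^sup>2 * (norm x * norm y)"
      using diff by (simp add: D_def d_def power2_eq_square not_less)
    also have "\<dots> \<le> \<epsilon>\<^sup>2 * (norm x * (norm x + D))" using y by (intro mult_left_mono) auto
    finally have "D * D \<le> d * d + \<epsilon> * d * D" by (simp only: sq)
    then have *: "D * (D - \<epsilon> * d) \<le> d * d" by (simp add: algebra_simps)
    have "D \<le> d * (1 + \<epsilon>)"
    proof (rule ccontr)
      assume "\<not> D \<le> d * (1 + \<epsilon>)"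
      then have "d < D - \<epsilon> * d" by (simp add: algebra_simps)
      then have "d * d < D * (D - \<epsilon> * d)" using True d by (intro mult_strict_mono) auto
      then show False using * by simp
    qed
    moreover have "0 \<le> d * \<epsilon>" using d \<epsilon> by simp
    then have "d * (1 - \<epsilon>) \<le> D" using True by (simp add: right_diff_distrib)
    ultimately show ?thesis by simp
  next
    case False
    then have gt: "\<epsilon>\<^sup>2 * (norm x * norm y) < D\<^sup>2" using diff by (simp add: D_def d_def)
    \<comment> \<open>One factor \<open>1 - \<epsilon>\<close> is given away so that the lower bound
      for the square of \<open>D\<close> is itself a square.\<close>
    have "(d * (1 - \<epsilon>))\<^sup>2 = d * d * (1 - \<epsilon>) * (1 - \<epsilon>)" by (simp add: power2_eq_square algebra_simps)
    also have "\<dots> \<le> d * d * (1 - \<epsilon>)" using \<epsilon> by (intro mult_left_le) auto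
    also have "\<dots> \<le> d * d + \<epsilon> * d * (- D)"
      using False d \<epsilon> mult_left_mono[of D d "\<epsilon> * d"] by (simp add: algebra_simps)
    also have "\<dots> = \<epsilon>\<^sup>2 * (norm x * (norm x - D))" using sq[of "- D"] by simp
    also have "\<dots> \<le> \<epsilon>\<^sup>2 * (norm x * norm y)" using y by (intro mult_left_mono) auto
    also note gt
    finally have "d * (1 - \<epsilon>) < D" using D0 by (rule power2_less_imp_less)
    moreover have "D \<le> d * (1 + \<epsilon>)" using False d \<epsilon> by (simp add: distrib_left add_increasing2)
    ultimately show ?thesis by simp
  qed
  then show "\<epsilon> * norm x * (1 - \<epsilon>) \<le> dist x y" "dist x y \<le> \<epsilon> * norm x * (1 + \<epsilon>)"
    by (simp_all add: D_def d_def)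
qed

lemma integrable_kern_mult:
  fixes x :: "'a::euclidean_space"
  assumes p: "real (DIM('a)) < p" and \<epsilon>: "0 < \<epsilon>" "\<epsilon> \<le> 1" and x: "x \<noteq> 0"
    and [measurable]: "g \<in> borel_measurable borel"
    and g: "integrable lborel (\<lambda>y. g y * (1 + norm y) powr (- p))"
  shows "integrable lborel (\<lambda>y. g y * kern p \<epsilon> x y)"
proof (rule Bochner_Integration.integrable_bound)
  let ?c = "((1 + norm x) / (\<epsilon> * norm x / 2) + 1) powr p"
  show "integrable lborel (\<lambda>y. ?c * (g y * (1 + norm y) powr (- p)))" using g by simp
  show "AE y in lborel. norm (g y * kern p \<epsilon> x y) \<le> norm (?c * (g y * (1 + norm y) powr (- p)))"
  proof (rule AE_I2)
    fix y
    have p0: "0 \<le> p" using p by (smt (verit) of_nat_0_le_iff)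
    have "kern p \<epsilon> x y \<le> ?c * (1 + norm y) powr (- p)"
      using x by (intro kern_le_weight p0 \<epsilon>) auto
    then have "\<bar>g y\<bar> * kern p \<epsilon> x y \<le> \<bar>g y\<bar> * (?c * (1 + norm y) powr (- p))" by (intro mult_left_mono) auto
    then show "norm (g y * kern p \<epsilon> x y) \<le> norm (?c * (g y * (1 + norm y) powr (- p)))"
      by (simp add: abs_mult kern_nonneg mult_ac)
  qed
qed measurable

text \<open>The two kernels differ only on the shell of \<open>truncations_differ_shell\<close>.
  There the Lipschitz bound cancels one power of the distance, and the thinness of the shell
  supplies a further factor \<epsilon>, so first-order information on \<open>h\<close> is enough.
  The condition \<open>\<epsilon> \<le> 1/2\<close> keeps the inner radius above half of
  \<open>\<epsilon> * norm x\<close>.\<close>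

lemma trunc_kern_minus_trunc_ball:
  fixes h :: "'a::euclidean_space \<Rightarrow> real"
  assumes s: "0 < s" and \<epsilon>: "0 < \<epsilon>" "\<epsilon> \<le> 1/2" and x: "x \<noteq> 0"
    and [measurable]: "h \<in> borel_measurable borel" and C0: "\<And>y. \<bar>h y\<bar> \<le> C0"
    and C: "0 \<le> C" "\<And>x z. \<bar>h (x + z) - h x\<bar> \<le> C * norm z"
  defines "p \<equiv> real (DIM('a)) + 2 * s"
  shows "\<bar>trunc_kern p \<epsilon> h x - trunc_ball p (\<epsilon> * norm x) h x\<bar>
    \<le> C * (real (DIM('a)) * unit_ball_vol (DIM('a)) * (2 * \<epsilon> * (\<epsilon> * norm x) * (\<epsilon> * norm x / 2) powr (- 2 * s)))"
proof -
  let ?d = "\<epsilon> * norm x"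
  let ?a = "?d * (1 - \<epsilon>)" and ?b = "?d * (1 + \<epsilon>)"
  let ?A = "real (DIM('a)) * unit_ball_vol (DIM('a))"
  have d: "?d > 0" using \<epsilon> x by simp
  have a: "0 < ?a" "?d / 2 \<le> ?a" "?a \<le> ?b"
    using d \<epsilon> mult_left_mono[of "1/2" "1 - \<epsilon>" ?d] by (auto intro!: mult_left_mono)
  have p: "real (DIM('a)) < p" using s by (simp add: p_def)
  let ?T = "\<lambda>y. indicator {?d<..} (dist x y) * dist x y powr (- p)"
  have W: "integrable lborel (\<lambda>y::'a. (1 + norm y) powr (- p))"
    using p by (intro integrable_one_plus_norm_powr) simp
  have bd: "\<bar>h x - h y\<bar> \<le> 2 * C0" for y using C0[of x] C0[of y] by linarith
  have i1: "integrable lborel (\<lambda>y. (h x - h y) * kern p \<epsilon> x y)"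
    using integrable_mult_bounded[OF W, of "\<lambda>y. h x - h y"] bd \<epsilon>
    by (intro integrable_kern_mult[OF p _ _ x]) (auto simp: mult.commute)
  have "integrable lborel (\<lambda>z::'a. indicator {?d<..} (norm z) * norm z powr (- p))"
    using p d by (intro integrable_norm_powr_tail) auto
  from integrable_translate[OF this, of x] have "integrable lborel ?T"
    by (simp add: dist_norm norm_minus_commute)
  then have i2: "integrable lborel (\<lambda>y. ?T y * (h x - h y))"
    using bd by (intro integrable_mult_bounded[where f = ?T]) auto
  let ?s = "\<lambda>z::'a. indicator {?a..?b} (norm z) * norm z powr (1 - p)"
  \<comment> \<open>In polar coordinates the kernel, the Lipschitz factor and the volume element
    leave the radial power -2 s.\<close>
  have e: "(1 - p) + real (DIM('a)) - 1 = - 2 * s" by (simp add: p_def)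
  have e0: "(1 - p) + real (DIM('a)) - 1 \<le> 0" using s e by simp
  note sh = integral_norm_powr_shell_le[OF a(1,3) e0, unfolded e]
  have sx: "integrable lborel (\<lambda>y. ?s (y - x))" by (rule integrable_translate[OF sh(1)])
  have eq: "trunc_kern p \<epsilon> h x - trunc_ball p ?d h x = (LINT y|lborel. (h x - h y) * kern p \<epsilon> x y - ?T y * (h x - h y))"
    unfolding trunc_kern_def trunc_ball_def by (rule Bochner_Integration.integral_diff[symmetric, OF i1 i2])
  have "norm (trunc_kern p \<epsilon> h x - trunc_ball p ?d h x) \<le> (LINT y|lborel. C * ?s (y - x))"
    unfolding eq
  proof (rule norm_integral_le)
    show "integrable lborel (\<lambda>y. (h x - h y) * kern p \<epsilon> x y - ?T y * (h x - h y))"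
      by (rule Bochner_Integration.integrable_diff[OF i1 i2])
    show "integrable lborel (\<lambda>y. C * ?s (y - x))" using sx by (rule integrable_mult_right)
    fix y
    let ?I = "\<epsilon>\<^sup>2 * (norm x * norm y) < (dist x y)\<^sup>2"
    show "norm ((h x - h y) * kern p \<epsilon> x y - ?T y * (h x - h y)) \<le> C * ?s (y - x)"
    proof (cases "?I = (?d < dist x y)")
      case True
      then have "(h x - h y) * kern p \<epsilon> x y - ?T y * (h x - h y) = 0" by (simp add: kern_def)
      then show ?thesis using C(1) by (simp only: norm_zero) simp
    next
      case False
      have \<epsilon>1: "\<epsilon> \<le> 1" using \<epsilon> by simp
      note dd = truncations_differ_shell[OF \<epsilon>(1) \<epsilon>1 x False]
      have D: "0 < dist x y" using dd(1) a(1) by linarith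
      have "norm ((h x - h y) * kern p \<epsilon> x y - ?T y * (h x - h y)) = \<bar>h y - h x\<bar> * dist x y powr (- p)"
        using False by (auto simp: kern_def abs_mult abs_minus_commute)
      also have "\<dots> \<le> (C * dist x y) * dist x y powr (- p)"
        using C(2)[of x "y - x"] by (intro mult_right_mono) (auto simp: dist_norm norm_minus_commute)
      also have "\<dots> = C * dist x y powr (1 - p)"
        using D by (simp add: powr_diff powr_minus_divide)
      also have "\<dots> = C * ?s (y - x)" using dd by (simp add: dist_norm norm_minus_commute)
      finally show ?thesis .
    qed
  qed
  also have "\<dots> = C * (LINT z|lborel. ?s z)"
    using integral_translate[of "\<lambda>y. C * ?s (y - x)" x] by simp
  also have "\<dots> \<le> C * (?A * ((?b - ?a) * ?a powr (- 2 * s)))"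
    by (intro mult_left_mono sh(2) C)
  also have "\<dots> \<le> C * (?A * (2 * \<epsilon> * ?d * (?d / 2) powr (- 2 * s)))"
  proof (intro mult_left_mono C)
    have "?b - ?a = 2 * \<epsilon> * ?d" by (simp add: algebra_simps)
    moreover have "?a powr (- 2 * s) \<le> (?d / 2) powr (- 2 * s)"
      using s a d by (intro powr_mono2') auto
    ultimately show "(?b - ?a) * ?a powr (- 2 * s) \<le> 2 * \<epsilon> * ?d * (?d / 2) powr (- 2 * s)"
      using d \<epsilon> by (simp add: mult_left_mono)
  qed auto
  finally show ?thesis by (simp only: real_norm_def)
qed


section \<open>The pairing with radial functions\<close>

text \<open>Strict sublevel sets within the positive half-line are open. The indicator removes r
  \<le> 0, where nothing is known about \<open>u\<close>.\<close>

lemma usc_on_positive_measurable: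
  fixes u :: "real \<Rightarrow> real"
  assumes "usc_on {0<..} u"
  shows "(\<lambda>r. indicator {0<..} r * u r) \<in> borel_measurable borel"
proof -
  have op: "open {r. 0 < r \<and> u r < a}" for a
  proof (subst open_subopen, rule ballI)
    fix r assume r: "r \<in> {r. 0 < r \<and> u r < a}"
    then have "\<forall>\<^sub>F y in at r within {0<..}. u y < a"
      using assms unfolding usc_on_def by auto
    then obtain T where T: "open T" "r \<in> T" "\<And>y. y \<in> T \<Longrightarrow> y \<noteq> r \<Longrightarrow> 0 < y \<Longrightarrow> u y < a"
      unfolding eventually_at_topological by auto
    then show "\<exists>T. open T \<and> r \<in> T \<and> T \<subseteq> {r. 0 < r \<and> u r < a}"
      using r by (intro exI[of _ "T \<inter> {0<..}"]) auto
  qed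
  have "{r. indicator {0<..} r * u r < a} = {r. 0 < r \<and> u r < a} \<union> (if 0 < a then {..0} else {})" for a
    by (auto simp: indicator_def)
  then show ?thesis unfolding borel_measurable_iff_less using op by auto
qed

lemma usc_on_radial:
  fixes u :: "real \<Rightarrow> real"
  assumes "usc_on {0<..} u"
  shows "usc_on (UNIV - {0}) (\<lambda>x::'a::real_normed_vector. u (norm x))"
  unfolding usc_on_def
proof (intro ballI allI impI)
  fix x :: 'a and a assume x: "x \<in> UNIV - {0}" and a: "u (norm x) < a"
  then have "\<forall>\<^sub>F r in at (norm x) within {0<..}. u r < a"
    using assms unfolding usc_on_def by auto
  then obtain T where T: "open T" "norm x \<in> T" "\<And>r. r \<in> T \<Longrightarrow> r \<noteq> norm x \<Longrightarrow> 0 < r \<Longrightarrow> u r < a"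
    unfolding eventually_at_topological by auto
  have "open (norm -` T :: 'a set)"
    using T(1) by (intro open_vimage continuous_on_norm_id)
  \<comment> \<open>Points with \<open>norm y = norm x\<close> escape the punctured neighbourhood of
    \<open>norm x\<close>; for them the bound is the assumption on \<open>u (norm x)\<close>
    itself.\<close>
  moreover have "u (norm y) < a" if "y \<in> norm -` T" "y \<noteq> 0" for y :: 'a
    using T(3)[of "norm y"] that a by (cases "norm y = norm x") auto
  ultimately show "\<forall>\<^sub>F y in at x within UNIV - {0}. u (norm y) < a"
    unfolding eventually_at_topological using T(2) by (intro exI[of _ "norm -` T"]) auto
qed

text \<open>The uncontrolled value \<open>u 0\<close> enters at a single point only and is split off
  there.\<close>

lemma radial_measurable:
  fixes u :: "real \<Rightarrow> real"
  assumes "usc_on {0<..} u"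
  shows "(\<lambda>x::'a::euclidean_space. u (norm x)) \<in> borel_measurable borel"
proof -
  note [measurable] = usc_on_positive_measurable[OF assms]
  have "(\<lambda>x::'a. indicator {0<..} (norm x) * u (norm x) + indicator {0} x * u 0) \<in> borel_measurable borel"
    using measurable_compose[OF borel_measurable_norm usc_on_positive_measurable[OF assms]] by measurable
  moreover have "(\<lambda>x::'a. indicator {0<..} (norm x) * u (norm x) + indicator {0} x * u 0) = (\<lambda>x. u (norm x))"
    by (auto simp: fun_eq_iff indicator_def)
  ultimately show ?thesis by simp
qed

lemma integrable_radial_weight:
  fixes u :: "real \<Rightarrow> real"
  assumes u: "usc_on {0<..} u"
    and int: "set_integrable lborel {0<..} (\<lambda>r. \<bar>u r\<bar> / (1 + r) powr p * r ^ (DIM('a) - 1))"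
  shows "integrable lborel (\<lambda>x::'a::euclidean_space. u (norm x) * (1 + norm x) powr (- p))"
proof -
  note [measurable] = usc_on_positive_measurable[OF u] radial_measurable[OF u]
  let ?g = "\<lambda>r. \<bar>indicator {0<..} r * u r\<bar> * (1 + r) powr (- p)"
  have "set_integrable lborel {0<..} (\<lambda>r. ?g r * r ^ (DIM('a) - 1))"
    using int by (rule set_integrable_cong[THEN iffD1, rotated 3]) (auto simp: powr_minus_divide)
  then have "integrable lborel (\<lambda>x::'a. ?g (norm x))"
    by (rule integrable_radial[rotated]) measurable
  then have "integrable lborel (\<lambda>x::'a. \<bar>u (norm x) * (1 + norm x) powr (- p)\<bar>)"
  proof (rule integrable_cong_AE_imp)
    show "AE x::'a in lborel. ?g (norm x) = \<bar>u (norm x) * (1 + norm x) powr (- p)\<bar>"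
      using AE_lborel_singleton[of "0::'a"] by eventually_elim (simp add: abs_mult)
  qed measurable
  then show ?thesis by (subst (asm) integrable_abs_iff) measurable
qed

text \<open>Passes from the weight in the hypothesis on \<open>u\<close> to the one in
  \<open>s_subharmonic\<close>; they are compared through (1 + r)^2 \<le> 2 (1 + r^2).\<close>

lemma integrable_quadratic_weight:
  fixes v :: "'a::euclidean_space \<Rightarrow> real"
  assumes p: "0 \<le> p" and [measurable]: "v \<in> borel_measurable borel"
    and v: "integrable lborel (\<lambda>x. v x * (1 + norm x) powr (- p))"
  shows "integrable lborel (\<lambda>x. \<bar>v x\<bar> / (1 + (norm x)\<^sup>2) powr (p / 2))"
proof (rule Bochner_Integration.integrable_bound)
  show "integrable lborel (\<lambda>x. 2 powr (p / 2) * (v x * (1 + norm x) powr (- p)))" using v by simp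
  show "AE x in lborel. norm (\<bar>v x\<bar> / (1 + (norm x)\<^sup>2) powr (p / 2)) \<le> norm (2 powr (p / 2) * (v x * (1 + norm x) powr (- p)))"
  proof (rule AE_I2)
    fix x :: 'a
    have pos: "0 < 1 + norm x" "0 < 1 + (norm x)\<^sup>2" by (simp_all add: add_pos_nonneg)
    have "0 \<le> (1 - norm x)\<^sup>2" by simp
    then have "(1 + norm x)\<^sup>2 \<le> 2 * (1 + (norm x)\<^sup>2)" by (simp add: power2_eq_square algebra_simps)
    then have "((1 + norm x)\<^sup>2) powr (p / 2) \<le> (2 * (1 + (norm x)\<^sup>2)) powr (p / 2)"
      using p by (intro powr_mono2) auto
    also have "((1 + norm x)\<^sup>2) powr (p / 2) = (1 + norm x) powr p"
      using pos(1) by (simp add: powr_powr powr_numeral[symmetric] del: powr_numeral)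
    finally have "(1 + norm x) powr p \<le> 2 powr (p / 2) * (1 + (norm x)\<^sup>2) powr (p / 2)"
      by (subst powr_mult[symmetric]) (simp_all add: add_nonneg_nonneg)
    then have "1 / (1 + (norm x)\<^sup>2) powr (p / 2) \<le> 2 powr (p / 2) / (1 + norm x) powr p"
      using pos by (simp add: field_simps)
    then have "\<bar>v x\<bar> * (1 / (1 + (norm x)\<^sup>2) powr (p / 2)) \<le> \<bar>v x\<bar> * (2 powr (p / 2) / (1 + norm x) powr p)"
      by (intro mult_left_mono) auto
    then show "norm (\<bar>v x\<bar> / (1 + (norm x)\<^sup>2) powr (p / 2)) \<le> norm (2 powr (p / 2) * (v x * (1 + norm x) powr (- p)))"
      by (simp add: abs_mult powr_minus_divide mult_ac)
  qed
qed measurable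

lemma set_integrable_compact:
  fixes v :: "'a::euclidean_space \<Rightarrow> real"
  assumes p: "0 \<le> p" and [measurable]: "v \<in> borel_measurable borel"
    and v: "integrable lborel (\<lambda>x. v x * (1 + norm x) powr (- p))" and K: "compact K"
  shows "set_integrable lborel K v"
proof -
  obtain R where R: "\<And>x. x \<in> K \<Longrightarrow> norm x \<le> R"
    using compact_imp_bounded[OF K] bounded_iff by blast
  have [measurable]: "K \<in> sets borel" using K by (simp add: borel_compact)
  show ?thesis
    unfolding set_integrable_def
  proof (rule Bochner_Integration.integrable_bound)
    show "(\<lambda>x. indicator K x *\<^sub>R v x) \<in> borel_measurable lborel" by measurable
    show "integrable lborel (\<lambda>x. (1 + R) powr p * (v x * (1 + norm x) powr (- p)))" using v by simp
    show "AE x in lborel. norm (indicator K x *\<^sub>R v x) \<le> norm ((1 + R) powr p * (v x * (1 + norm x) powr (- p)))"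
    proof (rule AE_I2)
      fix x
      show "norm (indicator K x *\<^sub>R v x) \<le> norm ((1 + R) powr p * (v x * (1 + norm x) powr (- p)))"
      proof (cases "x \<in> K")
        case True
        have pos: "0 < 1 + norm x" by (simp add: add_pos_nonneg)
        have "(1 + norm x) powr p \<le> (1 + R) powr p" using R[OF True] p by (intro powr_mono2) auto
        then have "1 \<le> (1 + R) powr p * (1 + norm x) powr (- p)"
          using pos by (simp add: powr_minus_divide le_divide_eq)
        then have "\<bar>v x\<bar> * 1 \<le> \<bar>v x\<bar> * ((1 + R) powr p * (1 + norm x) powr (- p))"
          by (intro mult_left_mono) auto
        then show ?thesis using True by (simp add: abs_mult mult_ac)
      qed simp
    qed
  qed
qed

section \<open>The limit argument\<close>

text \<open>Covers both limits: \<open>c\<close> is 1 for s < 1 and a multiple of ln (1 /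
  \<epsilon>) for s = 1. Replacing \<open>c \<epsilon> * l\<close> by \<open>L \<epsilon>\<close>
  costs at most \<open>\<eta> \<epsilon>\<close> times the integral of
  \<open>\<bar>v x * W x\<bar>\<close>, and division by \<open>c \<epsilon>\<close> sends this cost
  to 0.\<close>

lemma integral_nonpos_comparison:
  fixes v l W :: "'a::euclidean_space \<Rightarrow> real" and L :: "real \<Rightarrow> 'a \<Rightarrow> real"
  assumes vW: "integrable lborel (\<lambda>x. v x * W x)" and W: "\<And>x. 0 \<le> W x" and b: "0 < b"
    and L: "\<And>\<epsilon>. 0 < \<epsilon> \<Longrightarrow> \<epsilon> < b \<Longrightarrow> integrable lborel (\<lambda>x. v x * L \<epsilon> x)"
      "\<And>\<epsilon>. 0 < \<epsilon> \<Longrightarrow> \<epsilon> < b \<Longrightarrow> (LINT x|lborel. v x * L \<epsilon> x) \<le> 0"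
    and bound: "\<And>\<epsilon> x. 0 < \<epsilon> \<Longrightarrow> \<epsilon> < b \<Longrightarrow> x \<noteq> 0 \<Longrightarrow> \<bar>c \<epsilon> * l x - L \<epsilon> x\<bar> \<le> \<eta> \<epsilon> * W x"
    and c: "\<And>\<epsilon>. 0 < \<epsilon> \<Longrightarrow> \<epsilon> < b \<Longrightarrow> 0 < c \<epsilon>"
    and lim: "((\<lambda>\<epsilon>. \<eta> \<epsilon> / c \<epsilon>) \<longlongrightarrow> 0) (at_right 0)"
  shows "(LINT x|lborel. v x * l x) \<le> 0"
proof (cases "integrable lborel (\<lambda>x. v x * l x)")
  case False
  \<comment> \<open>A non-integrable product has integral 0 by convention.\<close>
  then show ?thesis by (simp add: not_integrable_integral_eq)
next
  case vl: True
  define B where "B = (LINT x|lborel. \<bar>v x * W x\<bar>)"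
  have "(LINT x|lborel. v x * l x) \<le> \<eta> \<epsilon> / c \<epsilon> * B" if \<epsilon>: "0 < \<epsilon>" "\<epsilon> < b" for \<epsilon>
  proof -
    have i: "integrable lborel (\<lambda>x. c \<epsilon> * (v x * l x) - v x * L \<epsilon> x)"
      using vl L(1)[OF \<epsilon>] by simp
    have "c \<epsilon> * (LINT x|lborel. v x * l x) - (LINT x|lborel. v x * L \<epsilon> x) = (LINT x|lborel. c \<epsilon> * (v x * l x) - v x * L \<epsilon> x)"
      using vl L(1)[OF \<epsilon>] by simp
    moreover have "(LINT x|lborel. c \<epsilon> * (v x * l x) - v x * L \<epsilon> x) \<le> (LINT x|lborel. \<eta> \<epsilon> * \<bar>v x * W x\<bar>)"
    proof (rule integral_mono_AE[OF i])
      show "integrable lborel (\<lambda>x. \<eta> \<epsilon> * \<bar>v x * W x\<bar>)" using vW by simp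
      show "AE x in lborel. c \<epsilon> * (v x * l x) - v x * L \<epsilon> x \<le> \<eta> \<epsilon> * \<bar>v x * W x\<bar>"
        using AE_lborel_singleton[of "0::'a"]
      proof eventually_elim
        case (elim x)
        have "c \<epsilon> * (v x * l x) - v x * L \<epsilon> x = v x * (c \<epsilon> * l x - L \<epsilon> x)" by (simp add: algebra_simps)
        also have "\<dots> \<le> \<bar>v x\<bar> * \<bar>c \<epsilon> * l x - L \<epsilon> x\<bar>" by (metis abs_ge_self abs_mult)
        also have "\<dots> \<le> \<bar>v x\<bar> * (\<eta> \<epsilon> * W x)" using bound[OF \<epsilon> elim] by (intro mult_left_mono) auto
        also have "\<dots> = \<eta> \<epsilon> * \<bar>v x * W x\<bar>" using W by (simp add: abs_mult)
        finally show ?case .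
      qed
    qed
    moreover have "(LINT x|lborel. \<eta> \<epsilon> * \<bar>v x * W x\<bar>) = \<eta> \<epsilon> * B" by (simp add: B_def)
    ultimately have "c \<epsilon> * (LINT x|lborel. v x * l x) \<le> \<eta> \<epsilon> * B" using L(2)[OF \<epsilon>] by linarith
    then show ?thesis using c[OF \<epsilon>] by (simp add: field_simps)
  qed
  moreover have "\<forall>\<^sub>F \<epsilon> in at_right 0. 0 < \<epsilon> \<and> \<epsilon> < b"
    using b by (auto simp: eventually_at_right_field)
  ultimately have "\<forall>\<^sub>F \<epsilon> in at_right 0. (LINT x|lborel. v x * l x) \<le> \<eta> \<epsilon> / c \<epsilon> * B"
    by (auto elim: eventually_mono)
  moreover have "((\<lambda>\<epsilon>. \<eta> \<epsilon> / c \<epsilon> * B) \<longlongrightarrow> 0) (at_right 0)"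
    using tendsto_mult_left_zero[OF lim] .
  ultimately show ?thesis by (intro tendsto_lowerbound) auto
qed

text \<open>\<open>kern_integral_nonpos\<close> is a statement at single points \<open>x\<close>;
  \<open>trunc_kern_duality\<close> carries it over to the test function, and
  \<open>h \<ge> 0\<close> preserves the sign. The support of \<open>h\<close> avoids 0, where there
  is no sphere through \<open>x\<close> to invert in.\<close>

lemma trunc_kern_pairing_nonpos:
  fixes u :: "real \<Rightarrow> real" and h :: "'a::euclidean_space \<Rightarrow> real"
  assumes s: "0 < s" and u: "usc_on {0<..} u"
    and ineq: "\<And>r \<tau>. 0 < r \<Longrightarrow> 1 \<le> \<tau> \<Longrightarrow> u r - u (r * \<tau>) + (u r - u (r / \<tau>)) * \<tau> powr (- real (DIM('a)) + 2 * s) \<le> 0"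
    and uW: "integrable lborel (\<lambda>x::'a. u (norm x) * (1 + norm x) powr (- p))" and p: "p = real (DIM('a)) + 2 * s"
    and \<epsilon>: "0 < \<epsilon>" "\<epsilon> \<le> 1"
    and a: "0 < a" and supp: "\<And>y. h y \<noteq> 0 \<Longrightarrow> a \<le> norm y \<and> norm y \<le> R"
    and h: "h \<in> borel_measurable borel" "\<And>y. \<bar>h y\<bar> \<le> C" "\<And>y. 0 \<le> h y"
  shows "integrable lborel (\<lambda>x. u (norm x) * trunc_kern p \<epsilon> h x)"
    and "(LINT x|lborel. u (norm x) * trunc_kern p \<epsilon> h x) \<le> 0"
proof -
  have pd: "real (DIM('a)) < p" using s p by simp
  have W: "integrable lborel (\<lambda>x::'a. (1 + norm x) powr (- p))"
    using pd by (intro integrable_one_plus_norm_powr) simp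
  note v = radial_measurable[OF u, where 'a = 'a]
  note [measurable] = v
  note D = trunc_kern_duality[where v = "\<lambda>x. u (norm x)" and h = h, OF pd \<epsilon> a supp v h(1,2) uW W]
  show "integrable lborel (\<lambda>x. u (norm x) * trunc_kern p \<epsilon> h x)" by (rule D(1))
  have "(LINT x|lborel. h x * (LINT y|lborel. (u (norm x) - u (norm y)) * kern p \<epsilon> x y)) \<le> 0"
  proof (rule integral_nonpos)
    fix x
    show "h x * (LINT y|lborel. (u (norm x) - u (norm y)) * kern p \<epsilon> x y) \<le> 0"
    proof (cases "h x = 0")
      case False
      then have x: "x \<noteq> 0" using supp a by fastforce
      have "integrable lborel (\<lambda>y::'a. (u (norm x) - u (norm y)) * (1 + norm y) powr (- p))"
        using W uW by (simp add: left_diff_distrib)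
      then have "integrable lborel (\<lambda>y. (u (norm x) - u (norm y)) * kern p \<epsilon> x y)"
        by (intro integrable_kern_mult[OF pd \<epsilon> x]) measurable
      then have "(LINT y|lborel. (u (norm x) - u (norm y)) * kern p \<epsilon> x y) \<le> 0"
        unfolding p by (intro kern_integral_nonpos x ineq) auto
      then show ?thesis using h(3) by (intro mult_nonneg_nonpos)
    qed simp
  qed
  then show "(LINT x|lborel. u (norm x) * trunc_kern p \<epsilon> h x) \<le> 0"
    using D(2) by simp
qed

section \<open>Test functions supported away from the origin\<close>

lemma test_fn_integrable:
  fixes h :: "real^'n \<Rightarrow> real"
  assumes "test_fn \<Omega> h" shows "integrable lborel h"
proof -
  let ?K = "closure {x. h x \<noteq> 0}"
  have "integrable lborel (\<lambda>x. indicator ?K x *\<^sub>R h x)"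
    using assms by (intro borel_integrable_compact continuous_on_subset[OF smooth_fn_continuous])
      (auto simp: test_fn_def)
  moreover have "(\<lambda>x. indicator ?K x *\<^sub>R h x) = h"
    using closure_subset[of "{x. h x \<noteq> 0}"] by (auto simp: fun_eq_iff indicator_def)
  ultimately show ?thesis by simp
qed

lemma test_fn_support_annulus:
  fixes h :: "real^'n \<Rightarrow> real"
  assumes "test_fn (UNIV - {0}) h"
  obtains a R where "0 < a" "a < R" "\<And>y. y \<in> closure {x. h x \<noteq> 0} \<Longrightarrow> a \<le> norm y \<and> norm y \<le> R"
proof -
  let ?K = "closure {x. h x \<noteq> 0}"
  have K: "compact ?K" "0 \<notin> ?K" using assms by (auto simp: test_fn_def)
  obtain R where R: "\<And>y. y \<in> ?K \<Longrightarrow> norm y \<le> R"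
    using compact_imp_bounded[OF K(1)] bounded_iff by blast
  have "open (- ?K)" by (intro open_Compl closed_closure)
  then obtain a where a: "0 < a" "ball 0 a \<subseteq> - ?K" using K(2) by (meson ComplI open_contains_ball)
  have "a \<le> norm y" if "y \<in> ?K" for y
    using a that by (meson ComplD in_mono mem_ball_0 not_le)
  \<comment> \<open>The maximum secures \<open>a < R\<close> even if the support is empty.\<close>
  then show thesis using that[of a "max R (a + 1)"] a(1) R by (simp add: le_max_iff_disj)
qed

text \<open>With m the larger norm, the distance is at least m / 2, while
  \<open>\<epsilon>\<^sup>2 * (norm x * norm y)\<close> is at most m^2 / 8. If \<open>x\<close> lies
  outside the annulus a / 2 \<le> |x| \<le> 2 R, every \<open>y\<close> with a \<le> |y| \<le> R is
  in this position, so the truncation never acts there.\<close>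

lemma separated_norms:
  fixes x y :: "'a::real_normed_vector"
  assumes \<epsilon>: "0 < \<epsilon>" "\<epsilon> \<le> 1/2" and xy: "2 * norm x < norm y \<or> 2 * norm y < norm x"
  shows "\<epsilon>\<^sup>2 * (norm x * norm y) < (dist x y)\<^sup>2" "norm x / 2 \<le> dist x y" "norm y / 2 \<le> dist x y"
proof -
  define m where "m = max (norm x) (norm y)"
  have m: "norm x \<le> m" "norm y \<le> m" by (simp_all add: m_def)
  have "norm y - norm x \<le> dist x y" "norm x - norm y \<le> dist x y"
    unfolding dist_norm using norm_triangle_ineq2[of x y] norm_triangle_ineq2[of y x] by (simp_all add: norm_minus_commute)
  then have d: "m / 2 \<le> dist x y" using xy by (auto simp: m_def)
  then show "norm x / 2 \<le> dist x y" "norm y / 2 \<le> dist x y" using m by linarith+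
  have m0: "0 < m" using xy norm_ge_zero[of x] norm_ge_zero[of y] unfolding m_def by linarith
  have mm: "norm x * norm y \<le> m / 2 * m"
    using xy
  proof
    assume "2 * norm x < norm y"
    then have "norm x \<le> m / 2" using m(2) by linarith
    then show ?thesis using m(2) m0 by (intro mult_mono) auto
  next
    assume "2 * norm y < norm x"
    then have "norm y \<le> m / 2" using m(1) by linarith
    then have "norm x * norm y \<le> m * (m / 2)" using m(1) m0 by (intro mult_mono) auto
    then show ?thesis by simp
  qed
  have "\<epsilon>\<^sup>2 \<le> (1/2)\<^sup>2" using \<epsilon> by (intro power_mono) auto
  from mult_mono[OF this mm] have "\<epsilon>\<^sup>2 * (norm x * norm y) \<le> (1/2)\<^sup>2 * (m / 2 * m)" by simp
  also have "\<dots> < (m / 2)\<^sup>2" using m0 by (simp add: power2_eq_square)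
  also have "\<dots> \<le> (dist x y)\<^sup>2" using d m0 by (intro power_mono) auto
  finally show "\<epsilon>\<^sup>2 * (norm x * norm y) < (dist x y)\<^sup>2" .
qed

lemma weight_lower_bound:
  fixes x :: "'a::real_normed_vector"
  assumes "0 \<le> p" "norm x \<le> R" "0 \<le> M"
  shows "M \<le> M * (1 + R) powr p * (1 + norm x) powr (- p)"
proof -
  have pos: "0 < 1 + norm x" by (simp add: add_pos_nonneg)
  have "(1 + norm x) powr p \<le> (1 + R) powr p" using assms by (intro powr_mono2) auto
  then have "1 \<le> (1 + R) powr p * (1 + norm x) powr (- p)"
    using pos by (simp add: powr_minus_divide le_divide_eq)
  from mult_left_mono[OF this assms(3)] show ?thesis by (simp add: mult.assoc)
qed

text \<open>The shell error is of order \<epsilon>^2 |x| (\<epsilon> |x|)^(-2 s), and on an annulus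
  the powers of |x| are absorbed into the constant. At s = 1 the remaining power of \<epsilon> is 1
  and the error is merely bounded.\<close>

lemma truncation_error_annulus:
  fixes h :: "real^'n \<Rightarrow> real"
  assumes h: "test_fn \<Omega> h" and s: "0 < s" and a: "0 < a" "a \<le> R"
  obtains M where "M \<ge> 0" "\<And>\<epsilon> x. 0 < \<epsilon> \<Longrightarrow> \<epsilon> \<le> 1/2 \<Longrightarrow> a \<le> norm x \<Longrightarrow> norm x \<le> R \<Longrightarrow>
    \<bar>trunc_kern (real CARD('n) + 2 * s) \<epsilon> h x - trunc_ball (real CARD('n) + 2 * s) (\<epsilon> * norm x) h x\<bar> \<le> M * \<epsilon> powr (2 - 2 * s)"
proof -
  obtain C0 where C0: "C0 > 0" "\<And>x. \<bar>h x\<bar> \<le> C0" using test_fn_bounded[OF h] by blast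
  obtain C where C: "C > 0" "\<And>x z. \<bar>h (x + z) - h x\<bar> \<le> C * norm z" using test_fn_lipschitz[OF h] by blast
  let ?A = "real CARD('n) * unit_ball_vol (real CARD('n))"
  let ?M = "C * (?A * (2 * R * (a / 2) powr (- 2 * s)))"
  have "\<bar>trunc_kern (real CARD('n) + 2 * s) \<epsilon> h x - trunc_ball (real CARD('n) + 2 * s) (\<epsilon> * norm x) h x\<bar> \<le> ?M * \<epsilon> powr (2 - 2 * s)"
    if \<epsilon>: "0 < \<epsilon>" "\<epsilon> \<le> 1/2" and x: "a \<le> norm x" "norm x \<le> R" for \<epsilon> x
  proof -
    have x0: "x \<noteq> 0" using x a by auto
    have C': "0 \<le> C" using C by simp
    have "\<bar>trunc_kern (real CARD('n) + 2 * s) \<epsilon> h x - trunc_ball (real CARD('n) + 2 * s) (\<epsilon> * norm x) h x\<bar>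
      \<le> C * (?A * (2 * \<epsilon> * (\<epsilon> * norm x) * (\<epsilon> * norm x / 2) powr (- 2 * s)))"
      using trunc_kern_minus_trunc_ball[OF s \<epsilon> x0 test_fn_measurable[OF h] C0(2) C' C(2)] by simp
    also have "\<dots> \<le> C * (?A * (2 * R * (a / 2) powr (- 2 * s) * \<epsilon> powr (2 - 2 * s)))"
    proof (intro mult_left_mono C')
      have "(\<epsilon> * norm x / 2) powr (- 2 * s) = \<epsilon> powr (- 2 * s) * (norm x / 2) powr (- 2 * s)"
        using \<epsilon> by (simp add: powr_mult[symmetric])
      moreover have "\<epsilon> * \<epsilon> * \<epsilon> powr (- 2 * s) = \<epsilon> powr (2 - 2 * s)"
        using powr_neg_mult_power[of \<epsilon> "2 * s" 1 2] \<epsilon> by (simp add: power2_eq_square mult_ac)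
      moreover have "2 * \<epsilon> * (\<epsilon> * norm x) * (X * Y) = 2 * norm x * Y * (\<epsilon> * \<epsilon> * X)" for X Y :: real
        by (simp only: mult_ac)
      ultimately have "2 * \<epsilon> * (\<epsilon> * norm x) * (\<epsilon> * norm x / 2) powr (- 2 * s)
         = 2 * norm x * (norm x / 2) powr (- 2 * s) * \<epsilon> powr (2 - 2 * s)"
        by (simp only:)
      also have "\<dots> \<le> 2 * R * (a / 2) powr (- 2 * s) * \<epsilon> powr (2 - 2 * s)"
        using x a s by (intro mult_right_mono mult_mono powr_mono2') auto
      finally show "2 * \<epsilon> * (\<epsilon> * norm x) * (\<epsilon> * norm x / 2) powr (- 2 * s) \<le> 2 * R * (a / 2) powr (- 2 * s) * \<epsilon> powr (2 - 2 * s)" .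
    qed auto
    finally show ?thesis by (simp only: mult.assoc)
  qed
  moreover have "?M \<ge> 0" using C a by simp
  ultimately show thesis using that by blast
qed

text \<open>The error between \<open>trunc_kern\<close> and the limit of the ball truncations is
  small near the support of \<open>h\<close> and zero elsewhere. It therefore lives on a bounded
  annulus, where any constant is dominated by the weight.\<close>

lemma frac_lap_pairing_nonpos:
  fixes u :: "real \<Rightarrow> real" and h :: "real^'n \<Rightarrow> real"
  assumes s: "0 < s" "s < 1" and u: "usc_on {0<..} u"
    and ineq: "\<And>r \<tau>. 0 < r \<Longrightarrow> 1 \<le> \<tau> \<Longrightarrow> u r - u (r * \<tau>) + (u r - u (r / \<tau>)) * \<tau> powr (- real CARD('n) + 2 * s) \<le> 0"
    and uW: "integrable lborel (\<lambda>x::real^'n. u (norm x) * (1 + norm x) powr (- (real CARD('n) + 2 * s)))"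
    and h: "test_fn (UNIV - {0}) h" "\<And>x. 0 \<le> h x"
  shows "(LINT x|lborel. u (norm x) * frac_lap s h x) \<le> 0"
proof -
  define p where "p = real CARD('n) + 2 * s"
  have p: "real CARD('n) < p" "p < real CARD('n) + 2" "0 \<le> p" using s by (simp_all add: p_def)
  obtain C0 where C0: "C0 > 0" "\<And>x. \<bar>h x\<bar> \<le> C0" using test_fn_bounded[OF h(1)] by blast
  obtain a R where aR: "0 < a" "a < R" and supp': "\<And>y. y \<in> closure {x. h x \<noteq> 0} \<Longrightarrow> a \<le> norm y \<and> norm y \<le> R"
    using test_fn_support_annulus[OF h(1)] by blast
  have supp: "a \<le> norm y \<and> norm y \<le> R" if "h y \<noteq> 0" for y
    using supp'[of y] that closure_subset[of "{x. h x \<noteq> 0}"] by blast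
  obtain l C where C: "C > 0" and l: "\<And>x \<delta>. 0 < \<delta> \<Longrightarrow> \<delta> < 1 \<Longrightarrow> \<bar>trunc_ball p \<delta> h x - l x\<bar> \<le> C * \<delta> powr (real CARD('n) + 2 - p)"
    by (rule trunc_ball_limit[OF h(1) p(1,2)]) (rule that)
  have e: "real CARD('n) + 2 - p = 2 - 2 * s" by (simp add: p_def)
  have pow0: "((\<lambda>\<delta>::real. \<delta> powr (2 - 2 * s)) \<longlongrightarrow> 0) (at_right 0)"
  proof (rule tendsto_zero_powrI[OF tendsto_ident_at tendsto_const])
    show "\<forall>\<^sub>F \<delta>::real in at_right 0. 0 \<le> \<delta>"
      using eventually_at_right_less[of "0::real"] by (rule eventually_mono) simp
  qed (use s in simp)
  have lim: "((\<lambda>\<delta>. trunc_ball p \<delta> h x) \<longlongrightarrow> l x) (at_right 0)" for x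
  proof (rule LIM_zero_cancel, rule Lim_null_comparison)
    have "\<forall>\<^sub>F \<delta>::real in at_right 0. 0 < \<delta> \<and> \<delta> < 1"
      by (auto simp: eventually_at_right_field intro!: exI[of _ 1])
    then show "\<forall>\<^sub>F \<delta> in at_right 0. norm (trunc_ball p \<delta> h x - l x) \<le> C * \<delta> powr (2 - 2 * s)"
      by eventually_elim (use l[of _ x] e in auto)
    show "((\<lambda>\<delta>. C * \<delta> powr (2 - 2 * s)) \<longlongrightarrow> 0) (at_right 0)"
      using tendsto_mult_right_zero[OF pow0] .
  qed
  have frac: "frac_lap s h x = frac_const s CARD('n) * l x" for x
  proof -
    have "(LINT y|lborel. indicator {y. dist x y > \<delta>} y * ((h x - h y) / dist x y powr (real CARD('n) + 2 * s))) = trunc_ball p \<delta> h x" for \<delta>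
      unfolding trunc_ball_def p_def[symmetric] powr_minus_divide
      by (intro Bochner_Integration.integral_cong) (auto simp: indicator_def)
    then show ?thesis
      using s tendsto_Lim[OF _ lim] by (simp add: frac_lap_def)
  qed
  \<comment> \<open>The annulus of the support is widened by a factor 2 on both sides, so that
    \<open>separated_norms\<close> applies to every \<open>x\<close> outside it.\<close>
  have a2: "0 < a / 2" "a / 2 \<le> 2 * R" using aR by auto
  obtain M where M: "M \<ge> 0" "\<And>\<epsilon> x. 0 < \<epsilon> \<Longrightarrow> \<epsilon> \<le> 1/2 \<Longrightarrow> a / 2 \<le> norm x \<Longrightarrow> norm x \<le> 2 * R \<Longrightarrow>
    \<bar>trunc_kern p \<epsilon> h x - trunc_ball p (\<epsilon> * norm x) h x\<bar> \<le> M * \<epsilon> powr (2 - 2 * s)"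
    by (rule truncation_error_annulus[OF h(1) s(1) a2, folded p_def]) (rule that)
  define M' where "M' = M + C * (2 * R) powr (2 - 2 * s)"
  have M'0: "0 \<le> M'" using M(1) C by (simp add: M'_def)
  \<comment> \<open>Below this bound \<open>\<epsilon> * norm x\<close> stays less than 1 on the
    widened annulus, as the estimate \<open>l\<close> requires.\<close>
  define \<epsilon>0 where "\<epsilon>0 = min (1/2) (1 / (2 * R))"
  have nonpos: "(LINT x|lborel. u (norm x) * l x) \<le> 0"
  proof (rule integral_nonpos_comparison[where W = "\<lambda>x. (1 + norm x) powr (- p)" and b = \<epsilon>0
        and L = "\<lambda>\<epsilon>. trunc_kern p \<epsilon> h" and c = "\<lambda>_. 1" and \<eta> = "\<lambda>\<epsilon>. (M' * (1 + 2 * R) powr p) * \<epsilon> powr (2 - 2 * s)"])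
    show "integrable lborel (\<lambda>x::real^'n. u (norm x) * (1 + norm x) powr (- p))" using uW by (simp add: p_def)
    show "0 < \<epsilon>0" using aR by (simp add: \<epsilon>0_def)
    fix \<epsilon> :: real assume \<epsilon>: "0 < \<epsilon>" "\<epsilon> < \<epsilon>0"
    then have \<epsilon>': "\<epsilon> \<le> 1" "\<epsilon> \<le> 1/2" "\<epsilon> * (2 * R) < 1" using aR by (auto simp: \<epsilon>0_def field_simps)
    have ineq': "u r - u (r * \<tau>) + (u r - u (r / \<tau>)) * \<tau> powr (- real DIM(real^'n) + 2 * s) \<le> 0" if "0 < r" "1 \<le> \<tau>" for r \<tau>
      using ineq[OF that] by simp
    have uW': "integrable lborel (\<lambda>x::real^'n. u (norm x) * (1 + norm x) powr (- p))" using uW by (simp add: p_def)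
    have p': "p = real DIM(real^'n) + 2 * s" by (simp add: p_def)
    note P = trunc_kern_pairing_nonpos[OF s(1) u ineq' uW' p' \<epsilon>(1) \<epsilon>'(1) aR(1) supp test_fn_measurable[OF h(1)] C0(2) h(2)]
    show "integrable lborel (\<lambda>x. u (norm x) * trunc_kern p \<epsilon> h x)" by (rule P(1))
    show "(LINT x|lborel. u (norm x) * trunc_kern p \<epsilon> h x) \<le> 0" by (rule P(2))
    fix x :: "real^'n" assume x: "x \<noteq> 0"
    show "\<bar>1 * l x - trunc_kern p \<epsilon> h x\<bar> \<le> (M' * (1 + 2 * R) powr p) * \<epsilon> powr (2 - 2 * s) * (1 + norm x) powr (- p)"
    proof (cases "a / 2 \<le> norm x \<and> norm x \<le> 2 * R")
      case True
      have b: "\<epsilon> * norm x \<le> \<epsilon> * (2 * R)" using True \<epsilon> by simp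
      have "\<bar>trunc_ball p (\<epsilon> * norm x) h x - l x\<bar> \<le> C * (\<epsilon> * norm x) powr (2 - 2 * s)"
        using l[of "\<epsilon> * norm x" x] \<epsilon> \<epsilon>'(3) b x e by simp
      also have "\<dots> \<le> C * (\<epsilon> * (2 * R)) powr (2 - 2 * s)"
        using b C \<epsilon> s by (intro mult_left_mono powr_mono2) auto
      also have "\<dots> = C * (2 * R) powr (2 - 2 * s) * \<epsilon> powr (2 - 2 * s)"
        using \<epsilon> aR by (simp add: powr_mult mult_ac)
      finally have "\<bar>trunc_ball p (\<epsilon> * norm x) h x - l x\<bar> \<le> C * (2 * R) powr (2 - 2 * s) * \<epsilon> powr (2 - 2 * s)" .
      then have "\<bar>1 * l x - trunc_kern p \<epsilon> h x\<bar> \<le> M' * \<epsilon> powr (2 - 2 * s)"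
        using M(2)[OF \<epsilon>(1) \<epsilon>'(2), of x] True unfolding M'_def distrib_right by linarith
      also have "\<dots> \<le> M' * \<epsilon> powr (2 - 2 * s) * (1 + 2 * R) powr p * (1 + norm x) powr (- p)"
        using True p(3) M'0 by (intro weight_lower_bound) auto
      finally show ?thesis by (simp add: mult_ac)
    next
      case False
      have sep: "2 * norm x < norm y \<or> 2 * norm y < norm x" if "h y \<noteq> 0" for y
        using supp[OF that] False by linarith
      have hx: "h x = 0" using sep[of x] by force
      \<comment> \<open>Neither truncation removes anything from the support of \<open>h\<close>
        here, so the integrals agree for every small \<delta> and the limit is attained.\<close>
      have ev: "trunc_ball p \<delta> h x = trunc_kern p \<epsilon> h x" if \<delta>: "\<delta> < a / 2" for \<delta>
        unfolding trunc_ball_def trunc_kern_def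
      proof (intro Bochner_Integration.integral_cong refl)
        fix y
        show "indicator {\<delta><..} (dist x y) * dist x y powr (- p) * (h x - h y) = (h x - h y) * kern p \<epsilon> x y"
        proof (cases "h y = 0")
          case False
          note S = separated_norms[OF \<epsilon>(1) \<epsilon>'(2) sep[OF False]]
          have "\<delta> < dist x y" using S(3) supp[OF False] \<delta> by linarith
          then show ?thesis using S(1) by (simp add: kern_def)
        qed (simp add: hx)
      qed
      have "\<forall>\<^sub>F \<delta> in at_right 0. trunc_ball p \<delta> h x = trunc_kern p \<epsilon> h x"
        using aR(1) ev by (auto simp: eventually_at_right_field intro!: exI[of _ "a / 2"])
      then have "((\<lambda>\<delta>. trunc_ball p \<delta> h x) \<longlongrightarrow> trunc_kern p \<epsilon> h x) (at_right 0)"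
        by (rule tendsto_eventually)
      then have "l x = trunc_kern p \<epsilon> h x" using lim[of x] tendsto_unique trivial_limit_at_right_real by blast
      then show ?thesis using M'0 by simp
    qed
  next
    show "((\<lambda>\<epsilon>. (M' * (1 + 2 * R) powr p) * \<epsilon> powr (2 - 2 * s) / 1) \<longlongrightarrow> 0) (at_right 0)"
      using tendsto_mult_right_zero[OF pow0] by simp
  qed auto
  have "0 \<le> frac_const s CARD('n)"
    using s by (auto simp: frac_const_def intro!: divide_nonneg_nonneg mult_nonneg_nonneg less_imp_le[OF Gamma_real_pos])
  moreover have "(LINT x|lborel. u (norm x) * frac_lap s h x) = frac_const s CARD('n) * (LINT x|lborel. u (norm x) * l x)"
  proof -
    have "u (norm x) * (c * l x) = c * (u (norm x) * l x)" for x c by simp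
    then show ?thesis by (simp only: frac integral_mult_right_zero)
  qed
  ultimately show ?thesis using nonpos by (simp add: mult_nonneg_nonpos)
qed

text \<open>Since everything is divided by ln (1 / \<epsilon>), an error bounded by a multiple of
  the weight suffices. Unlike for s < 1, the limit operator is local: far from the support of
  \<open>h\<close> it vanishes while \<open>trunc_kern\<close> need not, so there the decay of
  \<open>trunc_kern\<close> itself has to be estimated.\<close>

lemma laplacian_pairing_nonneg:
  fixes u :: "real \<Rightarrow> real" and h :: "real^'n \<Rightarrow> real"
  assumes u: "usc_on {0<..} u"
    and ineq: "\<And>r \<tau>. 0 < r \<Longrightarrow> 1 \<le> \<tau> \<Longrightarrow> u r - u (r * \<tau>) + (u r - u (r / \<tau>)) * \<tau> powr (- real CARD('n) + 2) \<le> 0"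
    and uW: "integrable lborel (\<lambda>x::real^'n. u (norm x) * (1 + norm x) powr (- (real CARD('n) + 2)))"
    and h: "test_fn (UNIV - {0}) h" "\<And>x. 0 \<le> h x"
  shows "(LINT x|lborel. u (norm x) * (- laplacian h x)) \<le> 0"
proof -
  define p where "p = real CARD('n) + 2"
  have p: "real CARD('n) < p" "0 \<le> p" by (simp_all add: p_def)
  let ?\<omega> = "unit_ball_vol (real CARD('n))"
  obtain C0 where C0: "C0 > 0" "\<And>x. \<bar>h x\<bar> \<le> C0" using test_fn_bounded[OF h(1)] by blast
  obtain a R where aR: "0 < a" "a < R" and supp': "\<And>y. y \<in> closure {x. h x \<noteq> 0} \<Longrightarrow> a \<le> norm y \<and> norm y \<le> R"
    using test_fn_support_annulus[OF h(1)] by blast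
  have supp: "a \<le> norm y \<and> norm y \<le> R" if "h y \<noteq> 0" for y
    using supp'[of y] that closure_subset[of "{x. h x \<noteq> 0}"] by blast
  obtain C where C: "C > 0" and l: "\<And>x \<delta>. 0 < \<delta> \<Longrightarrow> \<delta> < 1 \<Longrightarrow>
      \<bar>trunc_ball p \<delta> h x + ?\<omega> / 2 * ln (1 / \<delta>) * laplacian h x\<bar> \<le> C"
    by (rule trunc_ball_log_asymptotics[OF h(1), folded p_def]) (rule that)
  have a2: "0 < a / 2" "a / 2 \<le> 2 * R" using aR by auto
  obtain M where M: "M \<ge> 0" "\<And>\<epsilon> x. 0 < \<epsilon> \<Longrightarrow> \<epsilon> \<le> 1/2 \<Longrightarrow> a / 2 \<le> norm x \<Longrightarrow> norm x \<le> 2 * R \<Longrightarrow>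
    \<bar>trunc_kern p \<epsilon> h x - trunc_ball p (\<epsilon> * norm x) h x\<bar> \<le> M"
  proof -
    have p1: "real CARD('n) + 2 * 1 = p" by (simp add: p_def)
    obtain M where M: "M \<ge> 0" "\<And>\<epsilon> x. 0 < \<epsilon> \<Longrightarrow> \<epsilon> \<le> 1/2 \<Longrightarrow> a / 2 \<le> norm x \<Longrightarrow> norm x \<le> 2 * R \<Longrightarrow>
      \<bar>trunc_kern p \<epsilon> h x - trunc_ball p (\<epsilon> * norm x) h x\<bar> \<le> M * \<epsilon> powr (2 - 2 * 1)"
      by (rule truncation_error_annulus[OF h(1) zero_less_one a2, unfolded p1]) (rule that)
    show thesis
    proof (rule that[OF M(1)])
      fix \<epsilon> :: real and x :: "real^'n" assume "0 < \<epsilon>" "\<epsilon> \<le> 1/2" "a / 2 \<le> norm x" "norm x \<le> 2 * R"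
      then show "\<bar>trunc_kern p \<epsilon> h x - trunc_ball p (\<epsilon> * norm x) h x\<bar> \<le> M"
        using M(2)[of \<epsilon> x] by simp
    qed
  qed
  obtain H where H: "H \<ge> 0" "\<And>x. \<bar>laplacian h x\<bar> \<le> H"
  proof -
    have "\<forall>i. \<exists>C>0. \<forall>x. \<bar>partial_dir i (partial_dir i h) x\<bar> \<le> C"
      using test_fn_bounded[OF test_fn_partial_dir[OF test_fn_partial_dir[OF h(1)]]] by metis
    then obtain c where c: "\<And>i. c i > 0" "\<And>i x. \<bar>partial_dir i (partial_dir i h) x\<bar> \<le> c i" by metis
    have "\<bar>laplacian h x\<bar> \<le> (\<Sum>i\<in>UNIV. c i)" for x
      unfolding laplacian_def by (rule order_trans[OF sum_abs sum_mono]) (simp add: c)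
    moreover have "0 \<le> (\<Sum>i\<in>UNIV. c i)" using c by (intro sum_nonneg) (auto intro: less_imp_le)
    ultimately show thesis using that by blast
  qed
  have lap0: "laplacian h x = 0" if "\<not> (a \<le> norm x \<and> norm x \<le> R)" for x
  proof -
    have "partial_dir i (partial_dir i h) x = 0" for i
    proof (rule ccontr)
      assume "partial_dir i (partial_dir i h) x \<noteq> 0"
      then have "x \<in> closure {x. partial_dir i h x \<noteq> 0}" using partial_dir_support by blast
      also have "\<dots> \<subseteq> closure {x. h x \<noteq> 0}" by (intro closure_minimal partial_dir_support closed_closure)
      finally show False using supp' that by blast
    qed
    then show ?thesis by (simp add: laplacian_def)
  qed
  \<comment> \<open>Bounds the logarithm of \<open>norm x\<close> on the annulus, which appears when
    \<open>ln (1 / (\<epsilon> * norm x))\<close> is replaced by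
    \<open>ln (1 / \<epsilon>)\<close>.\<close>
  define K where "K = \<bar>ln (a / 2)\<bar> + \<bar>ln (2 * R)\<bar>"
  \<comment> \<open>Three errors on the annulus: the asymptotics of the ball truncation, the
    replaced logarithm, and the shell between the two truncations.\<close>
  define M1 where "M1 = C + ?\<omega> / 2 * K * H + M"
  have M10: "0 \<le> M1" using C M(1) H(1) by (simp add: M1_def K_def)
  \<comment> \<open>The constant of \<open>dist_powr_le_weight\<close> for distances of at least
    \<open>a / 2\<close>.\<close>
  define A where "A = ((1 + R) / (a / 2) + 1) powr p"
  have h_int: "integrable lborel (\<lambda>y. \<bar>h y\<bar>)"
    by (intro integrable_abs test_fn_integrable[OF h(1)])
  define M2 where "M2 = A * (LINT y|lborel. \<bar>h y\<bar>)"
  have M20: "0 \<le> M2" by (simp add: M2_def A_def)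
  define \<epsilon>0 where "\<epsilon>0 = min (1/2) (1 / (2 * R))"
  define \<eta> where "\<eta> = M1 * (1 + 2 * R) powr p + M2"
  show ?thesis
  proof (rule integral_nonpos_comparison[where W = "\<lambda>x. (1 + norm x) powr (- p)" and b = \<epsilon>0
        and L = "\<lambda>\<epsilon>. trunc_kern p \<epsilon> h" and c = "\<lambda>\<epsilon>. ?\<omega> / 2 * ln (1 / \<epsilon>)" and \<eta> = "\<lambda>\<epsilon>. \<eta>"])
    show uW': "integrable lborel (\<lambda>x::real^'n. u (norm x) * (1 + norm x) powr (- p))" using uW by (simp add: p_def)
    show "0 < \<epsilon>0" using aR by (simp add: \<epsilon>0_def)
    have "((\<lambda>\<epsilon>. \<eta> * inverse (?\<omega> / 2 * - ln \<epsilon>)) \<longlongrightarrow> \<eta> * 0) (at_right 0)"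
      by (intro tendsto_mult_left tendsto_inverse_0_at_top filterlim_tendsto_pos_mult_at_top[OF tendsto_const]
            filterlim_uminus_at_top_at_bot[THEN filterlim_compose] ln_at_0) simp_all
    then have "((\<lambda>\<epsilon>. \<eta> * inverse (?\<omega> / 2 * - ln \<epsilon>)) \<longlongrightarrow> 0) (at_right 0)"
      by (simp only: mult_zero_right)
    then show "((\<lambda>\<epsilon>. \<eta> / (?\<omega> / 2 * ln (1 / \<epsilon>))) \<longlongrightarrow> 0) (at_right 0)"
    proof (rule Lim_transform_eventually)
      show "\<forall>\<^sub>F \<epsilon> in at_right 0. \<eta> * inverse (?\<omega> / 2 * - ln \<epsilon>) = \<eta> / (?\<omega> / 2 * ln (1 / \<epsilon>))"
        using eventually_at_right_less[of "0::real"]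
      proof eventually_elim
        case (elim \<epsilon>)
        then have "ln (1 / \<epsilon>) = - ln \<epsilon>" by (simp add: ln_div)
        then show ?case by (simp only: divide_inverse[of \<eta>])
      qed
    qed
    fix \<epsilon> :: real assume \<epsilon>: "0 < \<epsilon>" "\<epsilon> < \<epsilon>0"
    then have \<epsilon>': "\<epsilon> \<le> 1" "\<epsilon> \<le> 1/2" "\<epsilon> * (2 * R) < 1" using aR by (auto simp: \<epsilon>0_def field_simps)
    show "0 < ?\<omega> / 2 * ln (1 / \<epsilon>)" using \<epsilon> \<epsilon>' by simp
    have ineq': "u r - u (r * \<tau>) + (u r - u (r / \<tau>)) * \<tau> powr (- real DIM(real^'n) + 2 * 1) \<le> 0" if "0 < r" "1 \<le> \<tau>" for r \<tau>
      using ineq[OF that] by simp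
    have p': "p = real DIM(real^'n) + 2 * 1" by (simp add: p_def)
    note P = trunc_kern_pairing_nonpos[OF zero_less_one u ineq' uW' p' \<epsilon>(1) \<epsilon>'(1) aR(1) supp test_fn_measurable[OF h(1)] C0(2) h(2)]
    show "integrable lborel (\<lambda>x. u (norm x) * trunc_kern p \<epsilon> h x)" by (rule P(1))
    show "(LINT x|lborel. u (norm x) * trunc_kern p \<epsilon> h x) \<le> 0" by (rule P(2))
    fix x :: "real^'n" assume x: "x \<noteq> 0"
    have W0: "0 \<le> (1 + norm x) powr (- p)" by simp
    show "\<bar>?\<omega> / 2 * ln (1 / \<epsilon>) * (- laplacian h x) - trunc_kern p \<epsilon> h x\<bar> \<le> \<eta> * (1 + norm x) powr (- p)"
    proof (cases "a / 2 \<le> norm x \<and> norm x \<le> 2 * R")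
      case True
      have nx: "0 < norm x" using x by simp
      have "\<epsilon> * norm x \<le> \<epsilon> * (2 * R)" using True \<epsilon> by simp
      then have "\<epsilon> * norm x < 1" using \<epsilon>'(3) by linarith
      moreover have "0 < \<epsilon> * norm x" using \<epsilon> nx by simp
      ultimately have l': "\<bar>trunc_ball p (\<epsilon> * norm x) h x + ?\<omega> / 2 * ln (1 / (\<epsilon> * norm x)) * laplacian h x\<bar> \<le> C"
        by (intro l)
      have "ln (1 / (\<epsilon> * norm x)) = ln (1 / \<epsilon>) - ln (norm x)"
        using \<epsilon> nx by (simp add: ln_div ln_mult)
      then have eq: "?\<omega> / 2 * ln (1 / (\<epsilon> * norm x)) * laplacian h x = ?\<omega> / 2 * ln (1 / \<epsilon>) * laplacian h x - ?\<omega> / 2 * ln (norm x) * laplacian h x"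
        by (simp only: right_diff_distrib left_diff_distrib)
      have "ln (a / 2) \<le> ln (norm x)" "ln (norm x) \<le> ln (2 * R)" using True aR nx by (simp_all)
      then have "\<bar>ln (norm x)\<bar> \<le> K" unfolding K_def by linarith
      then have "\<bar>?\<omega> / 2 * ln (norm x) * laplacian h x\<bar> \<le> ?\<omega> / 2 * K * H"
        unfolding abs_mult using H by (intro mult_mono) auto
      moreover have "\<bar>trunc_kern p \<epsilon> h x - trunc_ball p (\<epsilon> * norm x) h x\<bar> \<le> M"
        using M(2) \<epsilon> \<epsilon>' True by blast
      ultimately have "\<bar>?\<omega> / 2 * ln (1 / \<epsilon>) * laplacian h x + trunc_kern p \<epsilon> h x\<bar> \<le> M1"
        using l' unfolding eq M1_def by linarith
      then have "\<bar>?\<omega> / 2 * ln (1 / \<epsilon>) * (- laplacian h x) - trunc_kern p \<epsilon> h x\<bar> \<le> M1"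
        unfolding mult_minus_right by linarith
      also have "\<dots> \<le> M1 * (1 + 2 * R) powr p * (1 + norm x) powr (- p)"
        using True p(2) M10 by (intro weight_lower_bound) auto
      also have "\<dots> \<le> \<eta> * (1 + norm x) powr (- p)"
        using M20 by (intro mult_right_mono) (auto simp: \<eta>_def)
      finally show ?thesis .
    next
      case False
      have sep: "2 * norm x < norm y \<or> 2 * norm y < norm x" if "h y \<noteq> 0" for y
        using supp[OF that] False by linarith
      have hx: "h x = 0" using sep[of x] by force
      have lap: "laplacian h x = 0" using False aR by (intro lap0) linarith
      have W: "integrable lborel (\<lambda>y::real^'n. (1 + norm y) powr (- p))"
        using p by (intro integrable_one_plus_norm_powr) simp
      \<comment> \<open>As \<open>h x = 0\<close>, only support points \<open>y\<close> contribute,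
        all at distance at least \<open>a / 2\<close> from \<open>x\<close>, where the kernel decays
        like the weight in \<open>x\<close>.\<close>
      have "norm (trunc_kern p \<epsilon> h x) \<le> (LINT y|lborel. \<bar>h y\<bar> * (A * (1 + norm x) powr (- p)))"
        unfolding trunc_kern_def
      proof (rule norm_integral_le)
        show "integrable lborel (\<lambda>y. \<bar>h y\<bar> * (A * (1 + norm x) powr (- p)))"
          using h_int by simp
        have bd: "\<bar>h x - h y\<bar> \<le> C0" for y using C0(2)[of y] hx by simp
        note [measurable] = test_fn_measurable[OF h(1)]
        have pd: "real DIM(real^'n) < p" using p by simp
        show "integrable lborel (\<lambda>y. (h x - h y) * kern p \<epsilon> x y)"
          using integrable_mult_bounded[OF W, of "\<lambda>y. h x - h y", OF _ bd]
          by (intro integrable_kern_mult[OF pd \<epsilon>(1) \<epsilon>'(1) x]) (auto simp: mult.commute)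
        fix y
        show "norm ((h x - h y) * kern p \<epsilon> x y) \<le> \<bar>h y\<bar> * (A * (1 + norm x) powr (- p))"
        proof (cases "h y = 0")
          case False
          have "a / 2 \<le> dist x y"
            using separated_norms(3)[OF \<epsilon>(1) \<epsilon>'(2) sep[OF False]] supp[OF False] by linarith
          then have "dist x y powr (- p) \<le> A * (1 + norm x) powr (- p)"
            unfolding A_def using aR p(2) supp[OF False] by (intro dist_powr_le_weight) auto
          moreover have "kern p \<epsilon> x y \<le> dist x y powr (- p)" by (simp add: kern_def)
          ultimately have "\<bar>h y\<bar> * kern p \<epsilon> x y \<le> \<bar>h y\<bar> * (A * (1 + norm x) powr (- p))"
            by (intro mult_left_mono) auto
          then show ?thesis by (simp add: hx abs_mult kern_nonneg)
        qed (simp add: hx)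
      qed
      also have "\<dots> = M2 * (1 + norm x) powr (- p)" by (simp add: M2_def)
      also have "\<dots> \<le> \<eta> * (1 + norm x) powr (- p)"
        using M10 by (intro mult_right_mono) (auto simp: \<eta>_def)
      finally show ?thesis by (simp add: lap)
    qed
  qed auto
qed

theorem theorem1p2:
  fixes u :: "real \<Rightarrow> real" and s :: real
  assumes "CARD('n::finite) \<ge> 2"
    and "0 < s" and "s \<le> 1"
    and "usc_on {0<..} u"
    and "set_integrable lborel {0<..}
           (\<lambda>r. \<bar>u r\<bar> / (1 + r) powr (real CARD('n) + 2 * s) * r ^ (CARD('n) - 1))"
    and "\<forall>r>0. \<forall>\<tau>\<ge>1. u r - u (r * \<tau>) + (u r - u (r / \<tau>)) * \<tau> powr (- real CARD('n) + 2 * s) \<le> 0"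
  shows "s_subharmonic s (UNIV - {0}) (\<lambda>x::real^'n. u (norm x))"
proof -
  let ?p = "real CARD('n) + 2 * s"
  have p: "0 \<le> ?p" using assms(2) by simp
  note v = radial_measurable[OF assms(4), where 'a = "real^'n"]
  have uW: "integrable lborel (\<lambda>x::real^'n. u (norm x) * (1 + norm x) powr (- ?p))"
    using assms(5) by (intro integrable_radial_weight assms(4)) simp
  have ineq: "u r - u (r * \<tau>) + (u r - u (r / \<tau>)) * \<tau> powr (- real CARD('n) + 2 * s) \<le> 0" if "0 < r" "1 \<le> \<tau>" for r \<tau>
    using assms(6) that by blast
  have "(LINT x|lborel. u (norm x) * frac_lap s h x) \<le> 0"
    if h: "test_fn (UNIV - {0}) h" "\<And>x. 0 \<le> h x" for h :: "real^'n \<Rightarrow> real"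
  proof (cases "s = 1")
    case True
    have "(LINT x|lborel. u (norm x) * (- laplacian h x)) \<le> 0"
      using ineq uW by (intro laplacian_pairing_nonneg assms(4) h) (simp_all add: True)
    then show ?thesis by (simp add: frac_lap_def True)
  next
    case False
    then show ?thesis using assms(3) by (intro frac_lap_pairing_nonpos assms(2,4) ineq uW h) auto
  qed
  then show ?thesis
    unfolding s_subharmonic_def
    using set_integrable_compact[OF p v uW] integrable_quadratic_weight[OF p v uW] usc_on_radial[OF assms(4)]
    by auto
qed

end
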